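(* Let $n, k', \alpha$ be integers with $\alpha\ge 2$, and let $G$ be a simple, undirected, connected graph on $n$ vertices with essential connectivity $\kappa'(G)=k'$ and independence number $\alpha(G)=\alpha$. Let $\lambda_1(\cdot)$ denote the distance spectral radius. (i) If $n\ge k'+\alpha+3$, then $$\lambda_1(G)\ \ge\ \lambda_1\Big(K_{k'}\vee\big((K_{n-k'-\alpha-1}\vee(\alpha-1)K_1)\cup K_2\big)\Big),$$ and equality holds if and only if $G\cong K_{k'}\vee\big((K_{n-k'-\alpha-1}\vee(\alpha-1)K_1)\cup K_2\big)$. (ii) If $n=k'+\alpha+2$, then $$\lambda_1(G)\ \ge\ \lambda_1\Big(K_{k'}\vee\big((K_1\vee\lfloor \alpha/2\rfloor K_1)\cup(K_1\vee\lceil \alpha/2\rceil K_1)\big)\Big),$$ and equality holds if and only if $G\cong K_{k'}\vee\big((K_1\vee\lfloor \alpha/2\rfloor K_1)\cup(K_1\vee\lceil \alpha/2\rceil K_1)\big)$.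
   Context: All graphs are finite, simple, undirected and connected (except for pieces used to build graphs by union and join). For a connected graph $G$ with vertices $u_1,\dots,u_n$, the distance matrix $D(G)$ is the $n\times n$ real symmetric matrix whose $(i,j)$-entry is the length $d_G(u_i,u_j)$ of a shortest path between $u_i$ and $u_j$ (so the diagonal is zero). The distance spectral radius $\lambda_1(G)$ is the largest eigenvalue of $D(G)$. The independence number $\alpha(G)$ is the maximum cardinality of a set of pairwise non-adjacent vertices. The essential connectivity $\kappa'(G)$ is the minimum number of vertices of $G$ whose removal produces a disconnected graph with at least two non-trivial connected components (a component is non-trivial if it has at least two vertices). The hypothesis $\kappa'(G)=k'$ includes that such a vertex set exists; since $G$ is connected, $k'\ge 1$. $K_m$ is the complete graph on $m$ vertices; $mK_1$ is the edgeless graph on $m$ vertices. For disjoint graphs $G$ and $H$, $G\cup H$ is the disjoint union, and the join $G\vee H$ is obtained from $G\cup H$ by adding all edges between $V(G)$ and $V(H)$. *)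

theory Defs
  imports
    "Graph_Theory.Graph_Theory"
    "Jordan_Normal_Form.Char_Poly"
    "HOL-Library.Extended_Nat"
begin

text \<open>
  A finite simple undirected graph is a value of type \<^typ>\<open>'a pair_pre_digraph\<close> satisfying
  \<^const>\<open>pair_graph\<close>: finitely many vertices, and an irreflexive symmetric set of
  arcs, so that the undirected edge $uv$ is the pair of arcs $(u,v)$, $(v,u)$.
\<close>

definition graph_dist :: "'a pair_pre_digraph \<Rightarrow> 'a \<Rightarrow> 'a \<Rightarrow> nat" where
  "graph_dist G u v = (LEAST l. \<exists>p. pre_digraph.apath (with_proj G) u p v \<and> length p = l)"

definition distance_matrix :: "'a pair_pre_digraph \<Rightarrow> 'a list \<Rightarrow> real mat" where
  "distance_matrix G us =
     mat (length us) (length us) (\<lambda>(i, j). real (graph_dist G (us ! i) (us ! j)))"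

definition vertex_list :: "'a pair_pre_digraph \<Rightarrow> 'a list" where
  "vertex_list G = (SOME us. distinct us \<and> set us = pverts G)"

text \<open>
  Another enumeration of the vertices conjugates the distance matrix by a permutation matrix, so
  the choice made by \<^const>\<open>vertex_list\<close> does not affect the eigenvalues.  The matrix is real
  symmetric, hence all its eigenvalues are real.
\<close>
definition distance_spectral_radius :: "'a pair_pre_digraph \<Rightarrow> real" where
  "distance_spectral_radius G = Max {x. eigenvalue (distance_matrix G (vertex_list G)) x}"

definition independent_set :: "'a pair_pre_digraph \<Rightarrow> 'a set \<Rightarrow> bool" where
  "independent_set G I \<longleftrightarrow> I \<subseteq> pverts G \<and> (\<forall>u\<in>I. \<forall>v\<in>I. u \<noteq> v \<longrightarrow> (u, v) \<notin> parcs G)"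

definition independence_number :: "'a pair_pre_digraph \<Rightarrow> nat" where
  "independence_number G = Max (card ` {I. independent_set G I})"

text \<open>
  In a symmetric digraph the strongly connected components are the connected components of the
  underlying undirected graph.
\<close>
definition essential_cut :: "'a pair_pre_digraph \<Rightarrow> 'a set \<Rightarrow> bool" where
  "essential_cut G S \<longleftrightarrow> S \<subseteq> pverts G \<and>
     \<not> Digraph_Component.connected (with_proj G \<restriction> (pverts G - S)) \<and>
     (\<exists>C \<in> pre_digraph.sccs_verts (with_proj G \<restriction> (pverts G - S)).
      \<exists>D \<in> pre_digraph.sccs_verts (with_proj G \<restriction> (pverts G - S)).
        C \<noteq> D \<and> card C \<ge> 2 \<and> card D \<ge> 2)"

text \<open>The value is \<^term>\<open>\<infinity> :: enat\<close> exactly when no essential cut exists.\<close>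
definition essential_connectivity :: "'a pair_pre_digraph \<Rightarrow> enat" where
  "essential_connectivity G = (INF S\<in>{S. essential_cut G S}. enat (card S))"

definition complete_graph :: "nat \<Rightarrow> nat pair_pre_digraph" where
  "complete_graph m = \<lparr> pverts = {..<m}, parcs = {(u, v). u < m \<and> v < m \<and> u \<noteq> v} \<rparr>"

definition edgeless_graph :: "nat \<Rightarrow> nat pair_pre_digraph" where
  "edgeless_graph m = \<lparr> pverts = {..<m}, parcs = {} \<rparr>"

definition graph_union ::
    "'a pair_pre_digraph \<Rightarrow> 'b pair_pre_digraph \<Rightarrow> ('a + 'b) pair_pre_digraph"
    (infixr \<open>\<union>\<^sub>G\<close> 65) where
  "G \<union>\<^sub>G H = \<lparr> pverts = pverts G <+> pverts H,
              parcs = map_prod Inl Inl ` parcs G \<union> map_prod Inr Inr ` parcs H \<rparr>"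

definition graph_join ::
    "'a pair_pre_digraph \<Rightarrow> 'b pair_pre_digraph \<Rightarrow> ('a + 'b) pair_pre_digraph"
    (infixr \<open>\<or>\<^sub>G\<close> 70) where
  "G \<or>\<^sub>G H = \<lparr> pverts = pverts (G \<union>\<^sub>G H),
              parcs = parcs (G \<union>\<^sub>G H)
                \<union> Inl ` pverts G \<times> Inr ` pverts H \<union> Inr ` pverts H \<times> Inl ` pverts G \<rparr>"

definition extremal_graph ::
    "nat \<Rightarrow> nat \<Rightarrow> nat \<Rightarrow> (nat + (nat + nat) + nat) pair_pre_digraph" where
  "extremal_graph n k \<alpha> =
     complete_graph k \<or>\<^sub>G
       ((complete_graph (n - k - \<alpha> - 1) \<or>\<^sub>G edgeless_graph (\<alpha> - 1)) \<union>\<^sub>G complete_graph 2)"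

definition extremal_graph_balanced ::
    "nat \<Rightarrow> nat \<Rightarrow> (nat + (nat + nat) + nat + nat) pair_pre_digraph" where
  "extremal_graph_balanced k \<alpha> =
     complete_graph k \<or>\<^sub>G
       ((complete_graph 1 \<or>\<^sub>G edgeless_graph (nat \<lfloor>real \<alpha> / 2\<rfloor>)) \<union>\<^sub>G
        (complete_graph 1 \<or>\<^sub>G edgeless_graph (nat \<lceil>real \<alpha> / 2\<rceil>)))"

end

(* The distance matrix of G dominates entrywise the matrix with zero diagonal and off-diagonal
   entries 1 + N, where N is the adjacency matrix of a complete bipartite graph between the two
   sides A, B of the cut together with a clique on a maximum independent set I.
   The spectral radius of such a matrix exceeds lam - 1 as soon as some vector z satisfies
   2 * sum z - lam * |z|^2 + z N z > 1, because (sum z)^2 >= 2 * sum z - 1.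
   With lam - 1 the spectral radius of the extremal matrix, suitable z are obtained by laying out
   the entries of the extremal Perron vector (normalised to sum 1) on the vertices of G; only when
   one side of the cut misses I is the clique part of z recomputed. *)

theory Submission
  imports Defs "HOL-Analysis.Function_Topology"
begin

section \<open>Top eigenvalues of symmetric matrices\<close>

text \<open>The inequality \<open>(sum z)^2 >= 2 * sum z - 1\<close> is the tangent at
  \<open>sum z = 1\<close>, so it loses nothing on a Perron vector of sum 1: there
  \<open>lam * |z|^2 = 1 + z N z\<close>, and the tested expression equals exactly 1. A layout keeps
  every Perron entry with its multiplicity, hence \<open>sum z\<close> and \<open>|z|^2\<close>; the
  comparison shrinks to the change of \<open>z N z\<close>, a short polynomial whose sign follows
  from crude bounds on the entries. Since the tangent form does not ask for
  \<open>sum z = 1\<close>, part of \<open>z\<close> may also be recomputed freely. The obstacle is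
  that \<open>I\<close> may reach into the separator: then some places in \<open>A\<close> and
  \<open>B\<close> are taken by vertices outside \<open>I\<close>, and the entries meant for
  \<open>I\<close> contribute there only through the clique. For the balanced extremal graph such
  configurations are not compared directly. An intermediate matrix is inserted, with the side sizes
  of \<open>G\<close> or with a side of two vertices; its spectral radius is at least the balanced
  one, and the configuration exceeds it strictly.\<close>

definition quad_form :: "'a set \<Rightarrow> ('a \<Rightarrow> 'a \<Rightarrow> real) \<Rightarrow> ('a \<Rightarrow> real) \<Rightarrow> real" where
  "quad_form V M x = (\<Sum>u\<in>V. \<Sum>v\<in>V. M u v * x u * x v)"

definition eigen_on :: "'a set \<Rightarrow> ('a \<Rightarrow> 'a \<Rightarrow> real) \<Rightarrow> real \<Rightarrow> ('a \<Rightarrow> real) \<Rightarrow> bool" where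
  "eigen_on V M r x \<longleftrightarrow> (\<forall>u\<in>V. (\<Sum>v\<in>V. M u v * x v) = r * x u)"

text \<open>The Rayleigh bound together with an eigenvector pins \<open>r\<close> down without any
  enumeration of \<open>V\<close>, so the notion transports along bijections.\<close>

definition top_eigenvalue :: "'a set \<Rightarrow> ('a \<Rightarrow> 'a \<Rightarrow> real) \<Rightarrow> real \<Rightarrow> bool" where
  "top_eigenvalue V M r \<longleftrightarrow>
     (\<forall>x. quad_form V M x \<le> r * (\<Sum>u\<in>V. (x u)\<^sup>2)) \<and>
     (\<exists>z. (\<exists>u\<in>V. z u \<noteq> 0) \<and> eigen_on V M r z)"

lemma quad_form_eigen:
  assumes "eigen_on V M r x"
  shows "quad_form V M x = r * (\<Sum>u\<in>V. (x u)\<^sup>2)"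
proof -
  have "quad_form V M x = (\<Sum>u\<in>V. x u * (\<Sum>v\<in>V. M u v * x v))"
    unfolding quad_form_def by (simp add: sum_distrib_left mult_ac)
  also have "\<dots> = (\<Sum>u\<in>V. r * (x u)\<^sup>2)"
    using assms unfolding eigen_on_def by (intro sum.cong) (auto simp: power2_eq_square)
  finally show ?thesis by (simp add: sum_distrib_left)
qed

text \<open>First-order condition at the minimum \<open>e = 0\<close>. The test point
  \<open>- b / K\<close> uses a positive \<open>K\<close> above \<open>c\<close>, because
  \<open>c\<close> itself may be zero or negative.\<close>

lemma quadratic_nonneg_imp_linear_zero:
  fixes b c :: real
  assumes "\<And>e. 0 \<le> 2 * e * b + e\<^sup>2 * c"
  shows "b = 0"
proof (rule ccontr)
  assume b: "b \<noteq> 0"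
  define K where "K = \<bar>c\<bar> + 1"
  have K: "K > 0" "c \<le> K" unfolding K_def by auto
  have "0 \<le> 2 * (- b / K) * b + (- b / K)\<^sup>2 * c" by (rule assms)
  also have "\<dots> \<le> 2 * (- b / K) * b + (- b / K)\<^sup>2 * K"
    using K by (intro add_left_mono mult_left_mono) auto
  also have "\<dots> = - (b\<^sup>2 / K)" using K by (simp add: power2_eq_square field_simps)
  finally show False using b K by (simp add: field_simps zero_less_mult_iff)
qed

text \<open>Perturbing \<open>z\<close> by \<open>e\<close> in the single coordinate
  \<open>w\<close> leaves the deficit \<open>r * |x|^2 - quad_form\<close> nonnegative, and it
  vanishes at \<open>e = 0\<close>. Its linear coefficient in \<open>e\<close> is therefore zero,
  and that coefficient is row \<open>w\<close> of the eigenvalue equation.\<close>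

lemma quad_form_maximizer_eigen:
  assumes fin: "finite V" and sym: "\<And>u v. u \<in> V \<Longrightarrow> v \<in> V \<Longrightarrow> M u v = M v u"
    and max: "\<And>x. quad_form V M x \<le> r * (\<Sum>u\<in>V. (x u)\<^sup>2)"
    and eq: "quad_form V M z = r * (\<Sum>u\<in>V. (z u)\<^sup>2)"
  shows "eigen_on V M r z"
  unfolding eigen_on_def
proof
  fix w assume w: "w \<in> V"
  define d where "d = (\<lambda>u. if u = w then 1 else 0 :: real)"
  define L where "L = (\<Sum>v\<in>V. M w v * z v)"
  have 1: "(\<Sum>u\<in>V. \<Sum>v\<in>V. M u v * d u * z v) = L"
  proof -
    have "(\<Sum>u\<in>V. \<Sum>v\<in>V. M u v * d u * z v) = (\<Sum>u\<in>V. if u = w then L else 0)"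
      by (intro sum.cong) (auto simp: d_def L_def)
    then show ?thesis using w fin by simp
  qed
  have 2: "(\<Sum>u\<in>V. \<Sum>v\<in>V. M u v * z u * d v) = L"
  proof -
    have "(\<Sum>u\<in>V. \<Sum>v\<in>V. M u v * z u * d v) = (\<Sum>v\<in>V. \<Sum>u\<in>V. M u v * z u * d v)"
      by (rule sum.swap)
    also have "\<dots> = (\<Sum>v\<in>V. \<Sum>u\<in>V. M v u * d v * z u)"
      using sym by (intro sum.cong) auto
    finally show ?thesis using 1 by simp
  qed
  have 3: "(\<Sum>u\<in>V. \<Sum>v\<in>V. M u v * d u * d v) = M w w"
  proof -
    have "(\<Sum>u\<in>V. \<Sum>v\<in>V. M u v * d u * d v) = (\<Sum>u\<in>V. if u = w then M w w else 0)"
    proof (intro sum.cong refl)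
      fix u assume "u \<in> V"
      have "(\<Sum>v\<in>V. M u v * d u * d v) = (\<Sum>v\<in>V. if v = w then M u w * d u else 0)"
        by (intro sum.cong) (auto simp: d_def)
      then show "(\<Sum>v\<in>V. M u v * d u * d v) = (if u = w then M w w else 0)"
        using w fin by (auto simp: d_def)
    qed
    then show ?thesis using w fin by simp
  qed
  have "0 \<le> 2 * e * (r * z w - L) + e\<^sup>2 * (r - M w w)" for e
  proof -
    have "quad_form V M (\<lambda>u. z u + e * d u) =
      quad_form V M z + e * (\<Sum>u\<in>V. \<Sum>v\<in>V. M u v * d u * z v)
       + e * (\<Sum>u\<in>V. \<Sum>v\<in>V. M u v * z u * d v) + e\<^sup>2 * (\<Sum>u\<in>V. \<Sum>v\<in>V. M u v * d u * d v)"
      unfolding quad_form_def sum_distrib_left sum.distrib[symmetric]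
      by (intro sum.cong refl) (simp add: algebra_simps power2_eq_square)
    also have "\<dots> = quad_form V M z + 2 * e * L + e\<^sup>2 * M w w"
      unfolding 1 2 3 by simp
    finally have q: "quad_form V M (\<lambda>u. z u + e * d u) = quad_form V M z + 2 * e * L + e\<^sup>2 * M w w" .
    have "(\<Sum>u\<in>V. (z u + e * d u)\<^sup>2) =
        (\<Sum>u\<in>V. (z u)\<^sup>2 + (if u = w then 2 * e * z w + e\<^sup>2 else 0))"
      by (intro sum.cong refl) (auto simp: d_def power2_eq_square algebra_simps)
    also have "\<dots> = (\<Sum>u\<in>V. (z u)\<^sup>2) + 2 * e * z w + e\<^sup>2"
      using w fin by (simp add: sum.distrib)
    finally have s: "(\<Sum>u\<in>V. (z u + e * d u)\<^sup>2) = (\<Sum>u\<in>V. (z u)\<^sup>2) + 2 * e * z w + e\<^sup>2" .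
    show ?thesis using max[of "\<lambda>u. z u + e * d u"] unfolding q s eq
      by (simp add: algebra_simps)
  qed
  then have "r * z w - L = 0" by (rule quadratic_nonneg_imp_linear_zero)
  then show "(\<Sum>v\<in>V. M w v * z v) = r * z w" unfolding L_def by simp
qed

lemma quad_form_scale: "quad_form V M (\<lambda>u. c * x u) = c\<^sup>2 * quad_form V M x"
  unfolding quad_form_def by (simp add: sum_distrib_left power2_eq_square mult_ac)

lemma quad_form_cong:
  "(\<And>u. u \<in> V \<Longrightarrow> x u = y u) \<Longrightarrow> quad_form V M x = quad_form V M y"
  unfolding quad_form_def by (intro sum.cong) auto

text \<open>Maximise the form on the unit sphere. The vectors are functions on a possibly infinite
  type, so compactness comes from Tychonoff: they take values in \<open>[-1, 1]\<close> on
  \<open>V\<close> and are frozen to 0 elsewhere.\<close>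

lemma top_eigenvalue_exists:
  assumes fin: "finite V" and ne: "V \<noteq> {}"
    and sym: "\<And>u v. u \<in> V \<Longrightarrow> v \<in> V \<Longrightarrow> M u v = M v u"
  shows "\<exists>r. top_eigenvalue V M r"
proof -
  define n2 where "n2 = (\<lambda>x :: 'a \<Rightarrow> real. \<Sum>u\<in>V. (x u)\<^sup>2)"
  define B where "B = PiE UNIV (\<lambda>u. if u \<in> V then {-1..1::real} else {0})"
  have "compactin (product_topology (\<lambda>_. euclidean) UNIV) B"
    unfolding B_def compactin_PiE by auto
  then have cB: "compact B"
    unfolding euclidean_product_topology by simp
  have cont: "continuous_on UNIV n2" "continuous_on UNIV (quad_form V M)"
    unfolding n2_def quad_form_def
    by (intro continuous_intros continuous_on_product_coordinates; simp)+
  have "closed (n2 -` {1})"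
    using cont(1) by (intro closed_vimage) auto
  then have cS: "compact (B \<inter> n2 -` {1})" using cB by (rule compact_Int_closed[rotated])
  obtain w where w: "w \<in> V" using ne by auto
  have "(\<lambda>u. if u = w then 1 else 0) \<in> B \<inter> n2 -` {1}"
  proof -
    have "n2 (\<lambda>u. if u = w then 1 else 0) = (\<Sum>u\<in>V. if u = w then 1 else 0)"
      unfolding n2_def by (intro sum.cong) auto
    then show ?thesis using w fin unfolding B_def by auto
  qed
  then have "B \<inter> n2 -` {1} \<noteq> {}" by auto
  from continuous_attains_sup[OF cS this continuous_on_subset[OF cont(2)]]
  obtain z where z: "z \<in> B" "n2 z = 1"
    and zmax: "\<And>y. y \<in> B \<Longrightarrow> n2 y = 1 \<Longrightarrow> quad_form V M y \<le> quad_form V M z"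
    by auto
  define r where "r = quad_form V M z"
  have max: "quad_form V M x \<le> r * n2 x" for x
  proof (cases "n2 x = 0")
    case True
    then have "\<And>u. u \<in> V \<Longrightarrow> x u = 0" unfolding n2_def using fin by (simp add: sum_nonneg_eq_0_iff)
    then show ?thesis using True unfolding quad_form_def by simp
  next
    case False
    have pos: "n2 x > 0" using False unfolding n2_def
      by (metis (no_types, lifting) less_eq_real_def sum_nonneg zero_le_power2)
    define c where "c = 1 / sqrt (n2 x)"
    have c2: "c\<^sup>2 = 1 / n2 x" unfolding c_def using pos by (simp add: power_divide)
    define y where "y = (\<lambda>u. if u \<in> V then c * x u else 0)"
    have n2y: "n2 y = 1"
    proof -
      have "n2 y = (\<Sum>u\<in>V. c\<^sup>2 * (x u)\<^sup>2)" unfolding n2_def y_def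
        by (intro sum.cong) (auto simp: power_mult_distrib)
      also have "\<dots> = c\<^sup>2 * n2 x" unfolding n2_def by (simp add: sum_distrib_left)
      finally show ?thesis using c2 pos by simp
    qed
    have "(y u)\<^sup>2 \<le> 1" if "u \<in> V" for u
    proof -
      have "(y u)\<^sup>2 \<le> n2 y" unfolding n2_def using fin that
        by (intro member_le_sum) auto
      then show ?thesis using n2y by simp
    qed
    then have "\<And>u. u \<in> V \<Longrightarrow> \<bar>y u\<bar> \<le> 1" by (simp add: abs_square_le_1)
    then have "y \<in> B" unfolding B_def
      by (auto simp: PiE_def Pi_def abs_le_iff y_def)
    then have "quad_form V M y \<le> r" unfolding r_def using zmax n2y by blast
    moreover have "quad_form V M y = quad_form V M (\<lambda>u. c * x u)"
      by (intro quad_form_cong) (auto simp: y_def)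
    ultimately have "quad_form V M x / n2 x \<le> r" unfolding quad_form_scale c2 by simp
    then show ?thesis using pos by (simp add: field_simps)
  qed
  have "eigen_on V M r z"
    using max z(2) by (intro quad_form_maximizer_eigen[OF fin sym]) (auto simp: n2_def r_def)
  moreover have "\<exists>u\<in>V. z u \<noteq> 0"
  proof (rule ccontr)
    assume "\<not> ?thesis"
    then have "n2 z = 0" unfolding n2_def by simp
    then show False using z(2) by simp
  qed
  ultimately show ?thesis unfolding top_eigenvalue_def using max unfolding n2_def by blast
qed

text \<open>Passing to absolute values keeps the norm and does not decrease the form, so the result
  is again a maximiser and hence an eigenvector. A zero entry would make its own row vanish, and
  positive off-diagonal entries would then kill every other entry. Sum 1 is the scale at which the
  tangent bound is exact.\<close>

lemma perron_vector:
  assumes fin: "finite V"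
    and sym: "\<And>u v. u \<in> V \<Longrightarrow> v \<in> V \<Longrightarrow> M u v = M v u"
    and nn: "\<And>u v. u \<in> V \<Longrightarrow> v \<in> V \<Longrightarrow> M u v \<ge> 0"
    and offdiag: "\<And>u v. u \<in> V \<Longrightarrow> v \<in> V \<Longrightarrow> u \<noteq> v \<Longrightarrow> M u v > 0"
    and top: "top_eigenvalue V M r"
  shows "\<exists>x. (\<forall>u\<in>V. x u > 0) \<and> (\<Sum>u\<in>V. x u) = 1 \<and> eigen_on V M r x"
proof -
  obtain z u0 where z: "u0 \<in> V" "z u0 \<noteq> 0" "eigen_on V M r z"
    and max: "\<And>x. quad_form V M x \<le> r * (\<Sum>u\<in>V. (x u)\<^sup>2)"
    using top unfolding top_eigenvalue_def by blast
  define y where "y = (\<lambda>u. \<bar>z u\<bar>)"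
  have "quad_form V M z \<le> quad_form V M y"
    unfolding quad_form_def
  proof (intro sum_mono)
    fix u v assume "u \<in> V" "v \<in> V"
    then have "M u v * (z u * z v) \<le> M u v * (y u * y v)"
      using nn unfolding y_def by (intro mult_left_mono) (auto simp flip: abs_mult)
    then show "M u v * z u * z v \<le> M u v * y u * y v" by (simp add: mult.assoc)
  qed
  moreover have "(\<Sum>u\<in>V. (y u)\<^sup>2) = (\<Sum>u\<in>V. (z u)\<^sup>2)" unfolding y_def by simp
  ultimately have "quad_form V M y = r * (\<Sum>u\<in>V. (y u)\<^sup>2)"
    using max[of y] quad_form_eigen[OF z(3)] by simp
  then have ey: "eigen_on V M r y" by (intro quad_form_maximizer_eigen[OF fin sym max])
  have ypos: "y u > 0" if u: "u \<in> V" for u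
  proof (rule ccontr)
    assume "\<not> y u > 0"
    then have yu: "y u = 0" unfolding y_def by simp
    then have "(\<Sum>v\<in>V. M u v * y v) = 0" using ey u unfolding eigen_on_def by simp
    then have "M u u0 * y u0 = 0"
      using fin z(1) nn u by (subst (asm) sum_nonneg_eq_0_iff) (auto simp: y_def)
    then show False using offdiag[OF u z(1)] z(2) yu unfolding y_def by (cases "u = u0") auto
  qed
  define T where "T = (\<Sum>u\<in>V. y u)"
  have T: "T > 0" unfolding T_def using fin z(1) ypos by (intro sum_pos) auto
  have "eigen_on V M r (\<lambda>u. y u / T)"
    using ey unfolding eigen_on_def by (simp flip: sum_divide_distrib)
  moreover have "(\<Sum>u\<in>V. y u / T) = 1" using T by (simp add: T_def flip: sum_divide_distrib)
  ultimately show ?thesis using ypos T by (intro exI[of _ "\<lambda>u. y u / T"]) auto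
qed

section \<open>From matrices indexed by positions to functions on the vertex set\<close>

lemma eigenvalue_mat_iff_eigen_on:
  fixes us :: "'a list"
  assumes "distinct us"
  shows "eigenvalue (mat (length us) (length us) (\<lambda>(i, j). M (us ! i) (us ! j))) r \<longleftrightarrow>
    (\<exists>z. (\<exists>u\<in>set us. z u \<noteq> 0) \<and> eigen_on (set us) M r z)" (is "eigenvalue ?A r \<longleftrightarrow> _")
proof -
  let ?n = "length us"
  have sum_nth: "(\<Sum>v\<in>set us. f v) = (\<Sum>j<?n. f (us ! j))" for f :: "'a \<Rightarrow> real"
    using sum.reindex_bij_betw[OF bij_betw_nth[OF assms refl refl], of f] by simp
  have entry: "(?A *\<^sub>v v) $ i = (\<Sum>j<?n. M (us ! i) (us ! j) * v $ j)"
    if "i < ?n" "v \<in> carrier_vec ?n" for i v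
    using that by (simp add: scalar_prod_def atLeast0LessThan)
  show ?thesis
  proof
    assume "eigenvalue ?A r"
    then obtain v where v: "v \<in> carrier_vec ?n" "v \<noteq> 0\<^sub>v ?n" "?A *\<^sub>v v = r \<cdot>\<^sub>v v"
      unfolding eigenvalue_def eigenvector_def by auto
    \<comment> \<open>\<open>z u\<close> reads the vector at the position of \<open>u\<close>;
      \<open>distinct us\<close> makes this position unique.\<close>
    define z where "z = (\<lambda>u. v $ (THE i. i < ?n \<and> us ! i = u))"
    have z: "z (us ! i) = v $ i" if "i < ?n" for i
    proof -
      have "(THE k. k < ?n \<and> us ! k = us ! i) = i"
        using that assms by (intro the_equality) (auto simp: nth_eq_iff_index_eq)
      then show ?thesis unfolding z_def by simp
    qed
    have "eigen_on (set us) M r z"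
      unfolding eigen_on_def sum_nth
    proof
      fix u assume "u \<in> set us"
      then obtain i where i: "i < ?n" "u = us ! i" by (metis in_set_conv_nth)
      have "(\<Sum>j<?n. M u (us ! j) * z (us ! j)) = (?A *\<^sub>v v) $ i"
        unfolding entry[OF i(1) v(1)] using i(2) by (intro sum.cong) (auto simp: z)
      also have "\<dots> = r * z u" using i v z by simp
      finally show "(\<Sum>j<?n. M u (us ! j) * z (us ! j)) = r * z u" .
    qed
    moreover have "\<exists>u\<in>set us. z u \<noteq> 0"
    proof (rule ccontr)
      assume "\<not> ?thesis"
      then have "v = 0\<^sub>v ?n" using v(1) z by (intro eq_vecI) auto
      then show False using v by simp
    qed
    ultimately show "\<exists>z. (\<exists>u\<in>set us. z u \<noteq> 0) \<and> eigen_on (set us) M r z" by blast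
  next
    assume "\<exists>z. (\<exists>u\<in>set us. z u \<noteq> 0) \<and> eigen_on (set us) M r z"
    then obtain z u where z: "u \<in> set us" "z u \<noteq> 0" "eigen_on (set us) M r z" by blast
    define v where "v = vec ?n (\<lambda>i. z (us ! i))"
    have vc: "v \<in> carrier_vec ?n" unfolding v_def by simp
    have "?A *\<^sub>v v = r \<cdot>\<^sub>v v"
    proof (intro eq_vecI)
      fix i assume "i < dim_vec (r \<cdot>\<^sub>v v)"
      then have i: "i < ?n" unfolding v_def by simp
      have "(?A *\<^sub>v v) $ i = (\<Sum>j<?n. M (us ! i) (us ! j) * z (us ! j))"
        unfolding entry[OF i vc] by (intro sum.cong) (auto simp: v_def)
      also have "\<dots> = r * z (us ! i)"
        using z(3) i unfolding eigen_on_def sum_nth by auto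
      finally show "(?A *\<^sub>v v) $ i = (r \<cdot>\<^sub>v v) $ i" using i unfolding v_def by simp
    qed (simp add: v_def)
    moreover have "v \<noteq> 0\<^sub>v ?n"
    proof
      assume "v = 0\<^sub>v ?n"
      moreover obtain i where i: "i < ?n" "u = us ! i" using z(1) by (metis in_set_conv_nth)
      ultimately have "vec ?n (\<lambda>i. z (us ! i)) $ i = 0" using v_def by simp
      then show False using i z by simp
    qed
    ultimately show "eigenvalue ?A r"
      unfolding eigenvalue_def eigenvector_def using vc by auto
  qed
qed

text \<open>\<open>Max\<close> is meaningful because eigenvalues are roots of the nonzero
  characteristic polynomial, hence finitely many, and the top eigenvalue is one of them. The
  Rayleigh bound shows that it dominates the others.\<close>

lemma Max_eigenvalue_top:
  assumes "distinct us" "us \<noteq> []"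
    and sym: "\<And>u v. u \<in> set us \<Longrightarrow> v \<in> set us \<Longrightarrow> M u v = M v u"
  shows "top_eigenvalue (set us) M
    (Max {x. eigenvalue (mat (length us) (length us) (\<lambda>(i, j). M (us ! i) (us ! j))) x})"
proof -
  let ?A = "mat (length us) (length us) (\<lambda>(i, j). M (us ! i) (us ! j))"
  obtain r where r: "top_eigenvalue (set us) M r"
    using top_eigenvalue_exists[of "set us" M] assms by auto
  have car: "?A \<in> carrier_mat (length us) (length us)" by simp
  have "char_poly ?A \<noteq> 0" using degree_monic_char_poly[OF car] by auto
  then have fin: "finite {x. eigenvalue ?A x}"
    unfolding eigenvalue_root_char_poly[OF car] by (rule poly_roots_finite)
  have "Max {x. eigenvalue ?A x} = r"
  proof (intro Max_eqI fin)
    show "r \<in> {x. eigenvalue ?A x}"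
      using r unfolding mem_Collect_eq eigenvalue_mat_iff_eigen_on[OF assms(1)] top_eigenvalue_def by blast
    fix y assume "y \<in> {x. eigenvalue ?A x}"
    then obtain z u where z: "u \<in> set us" "z u \<noteq> 0" "eigen_on (set us) M y z"
      unfolding mem_Collect_eq eigenvalue_mat_iff_eigen_on[OF assms(1)] by blast
    have "y * (\<Sum>u\<in>set us. (z u)\<^sup>2) \<le> r * (\<Sum>u\<in>set us. (z u)\<^sup>2)"
      using r unfolding top_eigenvalue_def quad_form_eigen[OF z(3), symmetric] by blast
    moreover have "(\<Sum>u\<in>set us. (z u)\<^sup>2) > 0"
      using z by (intro sum_pos2[of _ u]) auto
    ultimately show "y \<le> r" by simp
  qed
  then show ?thesis using r by simp
qed

lemma distance_spectral_radius_top: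
  assumes fin: "finite (pverts G)" and ne: "pverts G \<noteq> {}"
    and sym: "\<And>u v. u \<in> pverts G \<Longrightarrow> v \<in> pverts G \<Longrightarrow> graph_dist G u v = graph_dist G v u"
  shows "top_eigenvalue (pverts G) (\<lambda>u v. real (graph_dist G u v)) (distance_spectral_radius G)"
proof -
  have "distinct (vertex_list G) \<and> set (vertex_list G) = pverts G"
    unfolding vertex_list_def by (rule someI_ex) (use finite_distinct_list[OF fin] in blast)
  moreover from this have "vertex_list G \<noteq> []" using ne by auto
  ultimately show ?thesis
    using Max_eigenvalue_top[of "vertex_list G" "\<lambda>u v. real (graph_dist G u v)"] sym
    unfolding distance_spectral_radius_def distance_matrix_def by simp
qed

section \<open>Perron data of the extremal matrices\<close>

text \<open>
  The equations say that \<open>1 / lam\<close>, \<open>t\<close>, \<open>p\<close>, \<open>q\<close> are the entries of a Perron vector with sum 1 for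
  \<open>lam - 1\<close>, on the vertices of $K_k$, $K_2$, $K_{b_0}$ and $be\,K_1$ of
  $K_k \vee ((K_{b_0} \vee be\,K_1) \cup K_2)$.
\<close>

locale pendant_pair_numbers =
  fixes k b0 be lam t p q :: real
  assumes k: "k \<ge> 1" and b0: "b0 \<ge> 1" and be: "be \<ge> 1"
    and lam: "lam > 0" and tpq: "t > 0" "p > 0" "q > 0"
    and eq_t: "lam * t = 1 + b0 * p + be * q"
    and eq_p: "lam * p = 1 + 2 * t"
    and eq_q: "lam * q = 1 + 2 * t + (be - 1) * q"
    and total: "k / lam + 2 * t + b0 * p + be * q = 1"
begin

definition s where "s = 1 / lam"

lemma s: "s > 0" "lam * s = 1" "k / lam = k * s"
  using lam by (auto simp: s_def)

text \<open>Row of a vertex of \<open>K_2\<close>, with \<open>p\<close> and \<open>q\<close>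
  eliminated through \<open>total\<close>.\<close>

lemma t_lam: "t * (lam + 2) = 2 - k * s"
  using eq_t total s(3) by (simp add: algebra_simps)

text \<open>By \<open>t_lam\<close>, \<open>lam * t\<close> stays below
  \<open>2 = lam * (2 * s)\<close>. In the layouts this makes four entries of size at least
  \<open>s\<close> outweigh two entries \<open>t\<close>.\<close>

lemma t_less: "t < 2 * s"
proof -
  have "k * s > 0" using k s by simp
  then have "lam * t < lam * (2 * s)" using t_lam s tpq by (simp add: algebra_simps)
  then show ?thesis using lam by simp
qed

lemma q_less: "q < 2 * s"
proof -
  have "k * s > 0" "b0 * p > 0" using k s b0 tpq by auto
  then have "lam * q < lam * (2 * s)" using eq_q total s tpq by (simp add: algebra_simps)
  then show ?thesis using lam by simp
qed

lemma p_greater: "s < p"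
proof -
  have "lam * s < lam * p" using eq_p s tpq by simp
  then show ?thesis using lam by simp
qed

lemma p_le_q: "p \<le> q"
proof -
  have "lam * p \<le> lam * q" using eq_p eq_q be tpq by simp
  then show ?thesis using lam by simp
qed

lemma s_le: "s \<le> t"
proof -
  have "b0 * p > 0" "be * q > 0" using b0 be tpq by auto
  then have "lam * s \<le> lam * t" using eq_t s by simp
  then show ?thesis using lam by simp
qed

text \<open>Sum of all rows: \<open>lam\<close> times the total entry 1, each class being replaced
  by its row equation.\<close>

lemma lam_eq: "lam = k + 2 * (1 + b0 * p + be * q) + b0 * (1 + 2 * t) + be * (1 + 2 * t + (be - 1) * q)"
proof -
  have "lam = lam * (k * s + 2 * t + b0 * p + be * q)" using total s by simp
  also have "\<dots> = k * (lam * s) + 2 * (lam * t) + b0 * (lam * p) + be * (lam * q)"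
    by (simp add: algebra_simps)
  finally show ?thesis unfolding eq_t eq_p eq_q s by simp
qed

lemma lam_ge: "lam \<ge> k + 2 + b0 + be"
proof -
  have "b0 * p > 0" "be * q > 0" "b0 * t > 0" "be * t > 0" "be * ((be - 1) * q) \<ge> 0"
    using b0 be tpq by auto
  then show ?thesis using lam_eq by (simp add: algebra_simps)
qed

lemma three_p_greater:
  assumes "b0 + be = 4"
  shows "2 * t < 3 * p"
proof -
  have be3: "be \<le> 3" using assms b0 by simp
  have ks: "k * s > 0" using k s by simp
  have b0': "b0 = 4 - be" using assms by simp
  have "be * q * be \<le> be * q * 3" using be3 be tpq by (intro mult_left_mono) auto
  moreover have "b0 * p > 0" using b0 tpq by simp
  moreover have "lam = k + 6 + 4 * (2 * t) + 2 * (b0 * p) + be * q + be * q * be"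
    using lam_eq unfolding b0' by (simp add: algebra_simps)
  moreover have "2 * t + b0 * p + be * q < 1" using total s ks by simp
  \<comment> \<open>With \<open>be <= 3\<close> the coefficients of \<open>2 * t\<close>,
    \<open>b0 * p\<close> and \<open>be * q\<close> are all at most 4, while these three add up to
    less than 1; hence \<open>6 + 4\<close>.\<close>
  ultimately have lam10: "lam \<le> k + 10" using tpq by linarith
  have lamk: "lam > k" using lam_ge b0 be by simp
  have "lam * (8 + k) \<le> lam * (18 + 2 * k - lam)" using lam10 lam by (intro mult_left_mono) auto
  moreover have "lam * (8 + k) = lam * 8 + lam * k" "lam * k > 0" using lam k by (auto simp: algebra_simps)
  ultimately have 1: "lam * (18 + 2 * k - lam) - 6 * k > 0" using k lamk by linarith
  \<comment> \<open>The factor \<open>lam * (lam + 2)\<close> clears the denominators of both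
    \<open>t\<close> (through \<open>t_lam\<close>) and \<open>s\<close>.\<close>
  have "lam * (10 * (t * (lam + 2)) + (2 * (k * s) - 1) * (lam + 2)) =
     10 * (2 * lam - k * (lam * s)) + (2 * (k * (lam * s)) - lam) * (lam + 2)"
    unfolding t_lam by (simp add: algebra_simps)
  also have "\<dots> = lam * (18 + 2 * k - lam) - 6 * k" unfolding s by (simp add: algebra_simps)
  finally have "lam * ((lam + 2) * (10 * t + 2 * (k * s) - 1)) > 0"
    using 1 by (simp add: algebra_simps)
  then have 2: "10 * t + 2 * (k * s) - 1 > 0" using lam by (simp add: zero_less_mult_iff)
  have "lam * (3 * p - 2 * t) = 10 * t + 2 * (k * s) - 1"
    using eq_p t_lam by (simp add: algebra_simps)
  then have "lam * (3 * p - 2 * t) > 0" using 2 by simp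
  then have "3 * p - 2 * t > 0" using lam zero_less_mult_pos by blast
  then show ?thesis by simp
qed

text \<open>The eigenvalue equation paired with the vector itself:
  \<open>lam * |x|^2 = (sum x)^2 + x N x\<close> with \<open>sum x = 1\<close>. It is the reason why
  the Perron vector has gain exactly 1 on its own graph.\<close>

lemma square_sum:
  "lam * (k * s\<^sup>2 + 2 * t\<^sup>2 + b0 * p\<^sup>2 + be * q\<^sup>2) =
   1 + 4 * t * (b0 * p + be * q) + be * (be - 1) * q\<^sup>2"
proof -
  have "lam * (k * s\<^sup>2 + 2 * t\<^sup>2 + b0 * p\<^sup>2 + be * q\<^sup>2) =
    k * s * (lam * s) + 2 * t * (lam * t) + b0 * p * (lam * p) + be * q * (lam * q)"
    by (simp add: algebra_simps power2_eq_square)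
  also have "\<dots> = (k * s + 2 * t + b0 * p + be * q) + 4 * t * (b0 * p + be * q) + be * (be - 1) * q\<^sup>2"
    unfolding eq_t eq_p eq_q s(2) by (simp add: algebra_simps power2_eq_square)
  finally show ?thesis using total s by simp
qed

text \<open>Here \<open>iA\<close> and \<open>iB\<close> count the members of \<open>I\<close> in
  the two sides, one of those in \<open>A\<close> carrying \<open>t\<close> and the others
  \<open>q\<close>; \<open>j\<close> members of \<open>I\<close> lie outside both. \<open>PA\<close>
  and \<open>PB\<close> collect the entries outside \<open>I\<close>, apart from the
  \<open>t\<close> on \<open>A\<close>. The three summands vanish for the extremal arrangement
  \<open>iA = 1\<close>, \<open>PA = 0\<close>, \<open>j = 0\<close>.\<close>

lemma layout_gain:
  assumes "PA + PB = b0 * p + j * s" "j = be - (iA - 1) - iB"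
  shows "2 - lam * (k * s\<^sup>2 + 2 * t\<^sup>2 + b0 * p\<^sup>2 + be * q\<^sup>2)
      + ((t + be * q)\<^sup>2 - (t\<^sup>2 + be * q\<^sup>2)
         + 2 * ((t + (iA - 1) * q) + (t + PA)) * (iB * q + PB) - 2 * (t + (iA - 1) * q) * (iB * q))
    = 1 + 2 * ((iA - 1) * q * (PB - t) + PA * (iB * q + PB - 2 * t) + j * t * (2 * s - q))"
proof -
  have b: "b0 * p = PA + PB - j * s" using assms by simp
  have be': "be = j + (iA - 1) + iB" using assms by simp
  show ?thesis unfolding square_sum b unfolding be'
    by (simp add: algebra_simps power2_eq_square)
qed

text \<open>For a side \<open>A\<close> disjoint from \<open>I\<close>, with \<open>i\<close>
  members of \<open>I\<close> in \<open>B\<close> and \<open>j\<close> outside. The entries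
  \<open>yB\<close> and \<open>yS\<close> are the stationary point of the gain in the clique
  coordinates when only the two entries \<open>t\<close> of \<open>A\<close> are taken into account:
  \<open>(lam + 1) * y = 1 + Sg\<close>, with \<open>2 * t\<close> more on \<open>B\<close>. Summing
  over the \<open>be + 1\<close> members of \<open>I\<close> gives
  \<open>nu * Sg = i * c + j\<close>, which explains \<open>nu = lam - be\<close>. The entries
  \<open>PA\<close> neglected here reappear in the last term of the second claim.\<close>

lemma split_clique_gain:
  fixes i j :: real and c nu Sg yB yS :: real
  assumes ij: "i + j = be + 1"
    and c: "c = 1 + 2 * t" and nu: "nu = lam - be"
    and Sg: "Sg = (be + 1 + 2 * t * i) / nu"
    and yB: "yB = (c + Sg) / (lam + 1)" and yS: "yS = (1 + Sg) / (lam + 1)"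
    and PB: "PA + PB = (b0 + be - i) * p"
  shows "i * yB + j * yS = Sg"
    and "(lam + 1) * (2 * (2 * t + i * yB + j * yS + (b0 + be - i) * p + (k - j) * s)
      - lam * (2 * t\<^sup>2 + i * yB\<^sup>2 + j * yS\<^sup>2 + (b0 + be - i) * p\<^sup>2 + (k - j) * s\<^sup>2)
      + (Sg\<^sup>2 - (i * yB\<^sup>2 + j * yS\<^sup>2) + 2 * (2 * t + PA) * (i * yB + PB)) - 1)
    = (((j - 1) * c\<^sup>2 - j) / lam + (i * c + j)\<^sup>2 / nu - (be * c)\<^sup>2 / (nu + 1))
      + 2 * (lam + 1) * PA * (i * yB + PB - 2 * t)"
proof -
  have nu0: "nu > 0" using nu lam_ge k b0 by simp
  have mu: "lam + 1 > 0" using lam by simp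
  have icj: "nu * Sg = i * c + j"
  proof -
    have "nu * Sg = i + j + 2 * t * i" using nu0 ij unfolding Sg by simp
    then show ?thesis unfolding c by (simp add: algebra_simps)
  qed
  have yB': "(lam + 1) * yB = c + Sg" and yS': "(lam + 1) * yS = 1 + Sg"
    using mu unfolding yB yS by auto
  have "(lam + 1) * (i * yB + j * yS) = i * ((lam + 1) * yB) + j * ((lam + 1) * yS)"
    by (simp add: algebra_simps)
  also have "\<dots> = (i * c + j) + (i + j) * Sg" unfolding yB' yS' by (simp add: algebra_simps)
  also have "\<dots> = (lam + 1) * Sg" unfolding icj[symmetric] ij nu by (simp add: algebra_simps)
  finally show sum: "i * yB + j * yS = Sg" using mu by simp
  define P where "P = (b0 + be - i) * p"
  define Q where "Q = i * yB\<^sup>2 + j * yS\<^sup>2"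
  have Q: "(lam + 1) * Q = i * c * yB + j * yS + Sg\<^sup>2"
  proof -
    have "(lam + 1) * Q = i * yB * ((lam + 1) * yB) + j * yS * ((lam + 1) * yS)"
      unfolding Q_def by (simp add: algebra_simps power2_eq_square)
    also have "\<dots> = i * c * yB + j * yS + (i * yB + j * yS) * Sg" unfolding yB' yS' by (simp add: algebra_simps)
    finally show ?thesis unfolding sum by (simp add: power2_eq_square)
  qed
  have C: "(lam + 1) * (i * c * yB + j * yS) = i * c\<^sup>2 + j + (i * c + j) * Sg"
  proof -
    have "(lam + 1) * (i * c * yB + j * yS) = i * c * ((lam + 1) * yB) + j * ((lam + 1) * yS)"
      by (simp add: algebra_simps)
    then show ?thesis unfolding yB' yS' by (simp add: algebra_simps power2_eq_square)
  qed
  have lp: "lam * p\<^sup>2 = c * p" using eq_p c by (simp add: power2_eq_square mult.assoc[symmetric])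
  have ls: "lam * s\<^sup>2 = s" using s(2) by (simp add: power2_eq_square mult.assoc[symmetric])
  have PB': "PB = P - PA" using PB unfolding P_def by simp
  have Pp: "(b0 + be - i) * p\<^sup>2 * lam = c * P" unfolding P_def using lp by (simp add: algebra_simps)
  let ?F = "2 * (2 * t + i * yB + j * yS + (b0 + be - i) * p + (k - j) * s)
      - lam * (2 * t\<^sup>2 + i * yB\<^sup>2 + j * yS\<^sup>2 + (b0 + be - i) * p\<^sup>2 + (k - j) * s\<^sup>2)
      + (Sg\<^sup>2 - (i * yB\<^sup>2 + j * yS\<^sup>2) + 2 * (2 * t + PA) * (i * yB + PB))"
  have "?F = 2 * (2 * t + (i * yB + j * yS) + P + (k - j) * s)
      - 2 * lam * t\<^sup>2 - c * P - (k - j) * (lam * s\<^sup>2)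
      + (Sg\<^sup>2 - (lam + 1) * Q) + 2 * (2 * t + PA) * (i * yB + PB)"
    unfolding P_def[symmetric] Q_def using Pp by (simp add: algebra_simps)
  also have "\<dots> = 4 * t - 2 * t * (lam * t) + c * P + (k - j) * s + (i * c * yB + j * yS)
      + 2 * PA * (i * yB + PB - 2 * t)"
    unfolding Q ls unfolding PB' c by (simp add: algebra_simps power2_eq_square)
  finally have F: "?F = 4 * t - 2 * t * (lam * t) + c * P + (k - j) * s + (i * c * yB + j * yS)
      + 2 * PA * (i * yB + PB - 2 * t)" .
  \<comment> \<open>The threshold 1 is expanded by the same equations as \<open>?F\<close>, so that
    the difference loses all terms free of \<open>i\<close> and \<open>j\<close>.\<close>
  have one: "1 = 4 * t - 2 * t * (lam * t) + c * (b0 * p + be * q) + k * s"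
    unfolding eq_t c using total s(3) by (simp add: algebra_simps)
  have "?F - 1 = (j - 1) * (c * p) - j * s + (i * c * yB + j * yS) - be * c * q
       + 2 * PA * (i * yB + PB - 2 * t)"
  proof -
    have "c * P = c * (b0 * p) + (j - 1) * (c * p)" 
    proof -
      have e: "b0 + be - i = b0 + (j - 1)" using ij by simp
      show ?thesis unfolding P_def e by (simp add: algebra_simps)
    qed
    then show ?thesis unfolding F by (subst one) (simp add: algebra_simps)
  qed
  then have "(lam + 1) * (?F - 1) = (lam + 1) * ((j - 1) * (c * p) - j * s + (i * c * yB + j * yS)
      - be * c * q + 2 * PA * (i * yB + PB - 2 * t))"
    by (rule arg_cong)
  also have "\<dots> = (lam + 1) * ((j - 1) * (c * p) - j * s)
      + (lam + 1) * (i * c * yB + j * yS) - be * c * ((lam + 1) * q)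
      + 2 * (lam + 1) * PA * (i * yB + PB - 2 * t)"
    by (simp add: algebra_simps)
  finally have "(lam + 1) * (?F - 1) = (lam + 1) * ((j - 1) * (c * p) - j * s)
      + (lam + 1) * (i * c * yB + j * yS) - be * c * ((lam + 1) * q)
      + 2 * (lam + 1) * PA * (i * yB + PB - 2 * t)" .
  moreover have "(lam + 1) * ((j - 1) * (c * p) - j * s) =
      ((j - 1) * c\<^sup>2 - j) + ((j - 1) * c\<^sup>2 - j) / lam"
  proof -
    have "p = c / lam" "s = 1 / lam" using eq_p c lam s_def by (auto simp: field_simps)
    then show ?thesis using lam by (simp add: field_simps power2_eq_square)
  qed
  moreover have "(lam + 1) * q = c + be * c / (nu + 1)"
  proof -
    have "q * (nu + 1) = c" using eq_q unfolding nu c by (simp add: algebra_simps)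
    then have "q = c / (nu + 1)" using nu0 by (simp add: field_simps)
    moreover have "lam = nu + be" using nu by simp
    ultimately show ?thesis using nu0 by (simp add: field_simps)
  qed
  moreover have "Sg = (i * c + j) / nu" using icj nu0 by (simp add: field_simps)
  ultimately have "(lam + 1) * (?F - 1) = (((j - 1) * c\<^sup>2 - j) + ((j - 1) * c\<^sup>2 - j) / lam)
      + (i * c\<^sup>2 + j + (i * c + j) * ((i * c + j) / nu)) - be * c * (c + be * c / (nu + 1))
      + 2 * (lam + 1) * PA * (i * yB + PB - 2 * t)"
    using C by simp
  also have "\<dots> = (((j - 1) * c\<^sup>2 - j) / lam + (i * c + j)\<^sup>2 / nu - (be * c)\<^sup>2 / (nu + 1))
      + 2 * (lam + 1) * PA * (i * yB + PB - 2 * t) + ((i + j - 1 - be) * c\<^sup>2)"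
    by (simp add: algebra_simps power2_eq_square)
  finally show "(lam + 1) * (?F - 1)
    = (((j - 1) * c\<^sup>2 - j) / lam + (i * c + j)\<^sup>2 / nu - (be * c)\<^sup>2 / (nu + 1))
      + 2 * (lam + 1) * PA * (i * yB + PB - 2 * t)" using ij by simp
qed

text \<open>In terms of \<open>d = 2 * t\<close>, \<open>J = j - 1\<close> and
  \<open>X = be * c\<close>, the two squares compare \<open>X + (1 - J * d)\<close> over
  \<open>nu\<close> with \<open>X\<close> over \<open>nu + 1\<close>. While
  \<open>J * d < 1 / 2\<close> the growth of the square pays for the possibly negative first term;
  for \<open>J * d\<close> between \<open>1 / 2\<close> and 1 that term is nonnegative. Only when
  \<open>J * d > 1\<close> does the square shrink, and then the size of \<open>lam\<close> has to be
  used.\<close>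

lemma split_clique_gain_positive:
  fixes i :: real and j :: nat
  assumes ij: "i + real j = be + 1" and i: "i \<ge> 0" and jk: "real j \<le> k"
    and c: "c = 1 + 2 * t" and nu: "nu = lam - be"
  shows "0 < ((real j - 1) * c\<^sup>2 - real j) / lam + (i * c + real j)\<^sup>2 / nu - (be * c)\<^sup>2 / (nu + 1)"
proof -
  define X where "X = be * c"
  define d where "d = 2 * t"
  define J where "J = real j - 1"
  have d0: "d > 0" unfolding d_def using tpq by simp
  have c': "c = 1 + d" unfolding c d_def by simp
  have nu0: "nu > 0" using nu lam_ge k b0 by simp
  have nul: "nu < lam" using nu be by simp
  have "be * 1 \<le> be * c" using be c' d0 by (intro mult_left_mono) auto
  then have Xbe: "X \<ge> be" unfolding X_def by simp
  then have X1: "X \<ge> 1" using be by simp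
  have "1 * c \<le> be * c" using be c' d0 by (intro mult_right_mono) auto
  then have Xc: "X \<ge> c" unfolding X_def by simp
  have icj: "i * c + real j = X + (1 - J * d)"
  proof -
    have i: "i = be - J" and j: "real j = J + 1" using ij unfolding J_def by auto
    show ?thesis unfolding X_def c' i j by (simp add: algebra_simps)
  qed
  have first: "(real j - 1) * c\<^sup>2 - real j = J * (2 * d + d\<^sup>2) - 1"
    unfolding J_def c' by (simp add: algebra_simps power2_eq_square)
  have Xnu: "X\<^sup>2 / nu > X\<^sup>2 / (nu + 1)" using X1 nu0 by (intro divide_strict_left_mono) auto
  have inv: "1 / lam < 1 / nu" using nul nu0 by (simp add: field_simps)
  have "0 < (J * (2 * d + d\<^sup>2) - 1) / lam + (X + (1 - J * d))\<^sup>2 / nu - X\<^sup>2 / (nu + 1)"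
  proof -
    consider "j = 0" | "j = 1" | "j \<ge> 2" "2 * (J * d) < 1"
      | "j \<ge> 2" "2 * (J * d) \<ge> 1" "J * d \<le> 1" | "j \<ge> 2" "J * d > 1" by linarith
    then show ?thesis
    proof cases
      case 1
      then have J: "J = -1" unfolding J_def by simp
      have "(J * (2 * d + d\<^sup>2) - 1) / lam = - (c\<^sup>2 / lam)"
        unfolding J c' minus_divide_left by (simp add: power2_eq_square algebra_simps)
      moreover have "(X + (1 - J * d))\<^sup>2 / nu = X\<^sup>2 / nu + 2 * X * c / nu + c\<^sup>2 / nu"
        unfolding J c' by (simp add: power2_eq_square algebra_simps add_divide_distrib)
      moreover have "c\<^sup>2 / lam \<le> c\<^sup>2 / nu" using nul nu0 by (intro divide_left_mono) auto
      moreover have "2 * X * c / nu > 0" using X1 nu0 c' d0 by simp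
      ultimately show ?thesis using Xnu by linarith
    next
      case 2
      then have J: "J = 0" unfolding J_def by simp
      have "(X + (1 - J * d))\<^sup>2 / nu = X\<^sup>2 / nu + 2 * X / nu + 1 / nu"
        unfolding J by (simp add: power2_eq_square algebra_simps add_divide_distrib)
      moreover have "2 * X / nu > 0" using X1 nu0 by simp
      moreover have "(J * (2 * d + d\<^sup>2) - 1) / lam = - (1 / lam)" unfolding J by simp
      ultimately show ?thesis using Xnu inv by linarith
    next
      case 3
      have J: "J \<ge> 1" using 3(1) unfolding J_def by simp
      define e where "e = 1 - J * d"
      have e: "e > 1 / 2" unfolding e_def using 3 by simp
      have "J * (2 * d + d\<^sup>2) \<ge> 0" using J d0 by simp
      then have f: "(J * (2 * d + d\<^sup>2) - 1) / lam \<ge> - (1 / lam)" using lam by (simp add: field_simps)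
      have "1 * 1 \<le> X * (2 * e)" using X1 e by (intro mult_mono) auto
      then have "1 / nu \<le> 2 * X * e / nu" using nu0 by (simp add: field_simps)
      moreover have "e\<^sup>2 / nu \<ge> 0" using nu0 by simp
      moreover have "(X + e)\<^sup>2 / nu = X\<^sup>2 / nu + 2 * X * e / nu + e\<^sup>2 / nu"
        by (simp add: power2_eq_square algebra_simps add_divide_distrib)
      ultimately show ?thesis unfolding e_def[symmetric] using f Xnu inv by linarith
    next
      case 4
      have J: "J \<ge> 1" using 4(1) unfolding J_def by simp
      have "J * d\<^sup>2 \<ge> 0" using J d0 by simp
      then have "J * (2 * d + d\<^sup>2) - 1 \<ge> 0" using 4 by (simp add: algebra_simps)
      then have "(J * (2 * d + d\<^sup>2) - 1) / lam \<ge> 0" using lam by simp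
      moreover have "X\<^sup>2 / nu \<le> (X + (1 - J * d))\<^sup>2 / nu"
        using X1 4 nu0 by (intro divide_right_mono power_mono) auto
      ultimately show ?thesis using Xnu by linarith
    next
      case 5
      have J: "J \<ge> 1" using 5(1) unfolding J_def by simp
      \<comment> \<open>The square shrinks from \<open>X\<close> to \<open>X - h\<close>. The
        smaller denominator \<open>nu\<close> compensates as soon as
        \<open>2 * h * (nu + 1) <= X\<close>, which is the target below.\<close>
      define h where "h = J * d - 1"
      have h: "h > 0" unfolding h_def using 5 by simp
      have Jbe: "J \<le> be" using ij i unfolding J_def by simp
      have JK: "J \<le> k" using jk unfolding J_def by simp
      \<comment> \<open>Both \<open>k >= J + 1\<close> (from \<open>j <= k\<close>) and
        \<open>be >= J\<close> (from \<open>i >= 0\<close>) enter \<open>lam_ge\<close>.\<close>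
      have lamJ: "lam \<ge> 2 * J + 4" using lam_ge ij i jk b0 unfolding J_def by simp
      have "J * d\<^sup>2 \<ge> 0" using J d0 by simp
      then have "J * (2 * d + d\<^sup>2) - 1 \<ge> 0" using 5 by (simp add: algebra_simps)
      then have f: "(J * (2 * d + d\<^sup>2) - 1) / lam \<ge> 0" using lam by simp
      \<comment> \<open>The quantity \<open>(lam - 2 * J)\<^sup>2 * (2 * lam - J)\<close> below is the leading part of the
        difference of the two sides; it is nonnegative because at least \<open>2 * J\<close> vertices exist.\<close>
      have lh: "lam * (lam + 2) * h \<le> 4 * J * lam - 2 * J\<^sup>2 - lam * (lam + 2)"
      proof -
        have "lam * (lam + 2) * d = lam * (2 * (t * (lam + 2)))" unfolding d_def by (simp add: algebra_simps)
        also have "\<dots> = 4 * lam - 2 * k * (lam * s)" unfolding t_lam by (simp add: algebra_simps)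
        also have "\<dots> = 4 * lam - 2 * k" unfolding s by simp
        finally have ld: "lam * (lam + 2) * d = 4 * lam - 2 * k" .
        have "lam * (lam + 2) * h = J * (lam * (lam + 2) * d) - lam * (lam + 2)"
          unfolding h_def by (simp add: algebra_simps)
        also have "\<dots> = J * (4 * lam - 2 * k) - lam * (lam + 2)" unfolding ld ..
        also have "\<dots> \<le> J * (4 * lam - 2 * J) - lam * (lam + 2)"
          using J JK by (intro diff_right_mono mult_left_mono) auto
        finally show ?thesis by (simp add: algebra_simps power2_eq_square)
      qed
      have "lam * (lam + 2) * (2 * h * (lam + 1 - J)) = 2 * (lam + 1 - J) * (lam * (lam + 2) * h)"
        by (simp add: algebra_simps)
      also have "\<dots> \<le> 2 * (lam + 1 - J) * (4 * J * lam - 2 * J\<^sup>2 - lam * (lam + 2))"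
        using lh lamJ J by (intro mult_left_mono) auto
      also have "\<dots> = lam * (lam + 2) * J
         - ((lam - 2 * J)\<^sup>2 * (2 * lam - J) + (6 * lam - 4 * J) * (lam - J) + 4 * lam)"
        by (simp add: algebra_simps power2_eq_square)
      also have "\<dots> \<le> lam * (lam + 2) * J"
      proof -
        have "(lam - 2 * J)\<^sup>2 * (2 * lam - J) \<ge> 0" "(6 * lam - 4 * J) * (lam - J) \<ge> 0"
          using lamJ J by (auto intro!: mult_nonneg_nonneg)
        then show ?thesis using lam by simp
      qed
      finally have hJ: "2 * h * (lam + 1 - J) \<le> J"
        using lam by (simp add: mult_le_cancel_left_pos)
      have "2 * h * (nu + 1) \<le> 2 * h * (lam + 1 - J)"
        using h Jbe unfolding nu by (intro mult_left_mono) auto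
      then have "2 * h * (nu + 1) \<le> X" using hJ Jbe Xbe by linarith
      then have "X * (2 * h * (nu + 1)) \<le> X * X" using X1 by (intro mult_left_mono) auto
      moreover have "h\<^sup>2 * (nu + 1) > 0" using h nu0 by simp
      ultimately have "(X - h)\<^sup>2 * (nu + 1) > X\<^sup>2 * nu"
        by (simp add: power2_eq_square algebra_simps)
      then have "(X - h)\<^sup>2 / nu > X\<^sup>2 / (nu + 1)" using nu0 by (simp add: divide_simps)
      moreover have "X + (1 - J * d) = X - h" unfolding h_def by simp
      ultimately show ?thesis using f by simp
    qed
  qed
  then show ?thesis unfolding icj first X_def .
qed

end

text \<open>
  Likewise for $K_k \vee ((K_1 \vee g K_1) \cup (K_1 \vee h K_1))$, with \<open>xi\<close>, \<open>eta\<close> on the two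
  centres and \<open>u\<close>, \<open>v\<close> on the independent vertices next to them.
\<close>

locale two_pendant_numbers =
  fixes k g h lam xi eta u v :: real
  assumes k: "k \<ge> 1" and g: "g \<ge> 1" and h: "h \<ge> 1"
    and lam: "lam > 0" and pos: "xi > 0" "eta > 0" "u > 0" "v > 0"
    and eq_xi: "lam * xi = 1 + eta + h * v"
    and eq_eta: "lam * eta = 1 + xi + g * u"
    and eq_u: "(lam + 1) * u = 1 + g * u + h * v + eta"
    and eq_v: "(lam + 1) * v = 1 + g * u + h * v + xi"
    and total: "k / lam + xi + eta + g * u + h * v = 1"
begin

definition s where "s = 1 / lam"

lemma s: "s > 0" "lam * s = 1" "k / lam = k * s"
  using lam by (auto simp: s_def)

lemma less:
  "xi < 2 * s" "eta < 2 * s" "u < 2 * s" "v < 2 * s"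
proof -
  have "k * s > 0" "g * u > 0" "h * v > 0" using k s g h pos by auto
  then have "lam * xi < lam * (2 * s)" "lam * eta < lam * (2 * s)"
    "lam * u < lam * (2 * s)" "lam * v < lam * (2 * s)"
    using eq_xi eq_eta eq_u eq_v total s pos by (auto simp: algebra_simps)
  then show "xi < 2 * s" "eta < 2 * s" "u < 2 * s" "v < 2 * s" using lam by auto
qed

lemma greater: "s < xi" "s < eta" "s < u" "s < v"
proof -
  have *: "g * u > 0" "h * v > 0" "g * u \<ge> u" "h * v \<ge> v" using g h pos by auto
  have "lam * u + u = 1 + g * u + h * v + eta" "lam * v + v = 1 + g * u + h * v + xi"
    using eq_u eq_v by (simp_all add: algebra_simps)
  then have "lam * xi > lam * s" "lam * eta > lam * s"  "lam * u > lam * s"  "lam * v > lam * s"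
    using * eq_xi eq_eta s(2) pos by linarith+
  then show "s < xi" "s < eta" "s < u" "s < v" using lam by auto
qed

text \<open>Twice one leaf row minus the other, with \<open>g * u + h * v\<close> eliminated by
  \<open>total\<close>, and \<open>(lam + 1) * (2 * s) = 2 + 2 * s\<close>. The first claim is used
  as \<open>2 * (v - s) <= u\<close>, the second as \<open>2 * (u - s) <= v\<close>.\<close>

lemma v_bound: "2 * v - u \<le> 2 * s" and u_bound: "2 * u - v \<le> 2 * s"
proof -
  have ks: "k * s \<ge> s" using k s by simp
  have "(lam + 1) * (2 * v - u) = 2 + xi - 2 * eta - k * s"
    using eq_u eq_v total s by (simp add: algebra_simps)
  also have "\<dots> \<le> 2 + 2 * s" using less(1) greater(2) ks s by linarith
  also have "\<dots> = (lam + 1) * (2 * s)" using s by (simp add: algebra_simps)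
  finally show "2 * v - u \<le> 2 * s" using lam by simp
  have "(lam + 1) * (2 * u - v) = 2 + eta - 2 * xi - k * s"
    using eq_u eq_v total s by (simp add: algebra_simps)
  also have "\<dots> \<le> 2 + 2 * s" using less(2) greater(1) ks s by linarith
  also have "\<dots> = (lam + 1) * (2 * s)" using s by (simp add: algebra_simps)
  finally show "2 * u - v \<le> 2 * s" using lam by simp
qed

lemma lam_ge: "lam \<ge> k + 2 + g + h"
proof -
  have "lam = lam * (k * s + xi + eta + g * u + h * v)" using total s by simp
  also have "\<dots> = k * (lam * s) + lam * xi + lam * eta + g * (lam * u) + h * (lam * v)"
    by (simp add: algebra_simps)
  also have "\<dots> \<ge> k * 1 + 1 + 1 + g * 1 + h * 1"
    using greater s lam g h k by (intro add_mono mult_left_mono) (auto simp: s_def field_simps)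
  finally show ?thesis by simp
qed

text \<open>The differences \<open>xi - eta\<close> and \<open>v - u\<close> determine each other
  through the row equations. Eliminating the second leaves
  \<open>((lam + 1)^2 - h) * (xi - eta) = (lam + 1) * (h - g) * u\<close>.\<close>

lemma eta_le_xi:
  assumes "g \<le> h"
  shows "eta \<le> xi"
proof -
  have 1: "(lam + 1) * (xi - eta) = h * v - g * u" using eq_xi eq_eta by (simp add: algebra_simps)
  have 2: "(lam + 1) * (v - u) = xi - eta" using eq_u eq_v by (simp add: algebra_simps)
  have "((lam + 1)\<^sup>2 - h) * (xi - eta) = (lam + 1) * ((lam + 1) * (xi - eta)) - h * (xi - eta)"
    by (simp add: algebra_simps power2_eq_square)
  also have "\<dots> = (lam + 1) * ((h - g) * u)"
    unfolding 1 unfolding 2[symmetric] by (simp add: algebra_simps)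
  also have "\<dots> \<ge> 0" using assms lam pos by simp
  finally have 3: "((lam + 1)\<^sup>2 - h) * (xi - eta) \<ge> 0" .
  have "lam + 1 > h" "lam + 1 \<ge> 1" using lam_ge k g lam by auto
  then have "(lam + 1) * (lam + 1) > h * 1" using h by (intro mult_strict_mono') auto
  then have "(lam + 1)\<^sup>2 - h > 0" by (simp add: power2_eq_square)
  then show ?thesis using 3 by (simp add: zero_le_mult_iff)
qed

lemma square_sum:
  "lam * (k * s\<^sup>2 + xi\<^sup>2 + eta\<^sup>2 + g * u\<^sup>2 + h * v\<^sup>2) =
   1 + 2 * xi * eta + 2 * (h * v) * xi + 2 * (g * u) * eta + (g * u + h * v)\<^sup>2 - g * u\<^sup>2 - h * v\<^sup>2"
proof -
  have "lam * (k * s\<^sup>2 + xi\<^sup>2 + eta\<^sup>2 + g * u\<^sup>2 + h * v\<^sup>2) =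
    k * s * (lam * s) + xi * (lam * xi) + eta * (lam * eta) + g * u * ((lam + 1) * u) + h * v * ((lam + 1) * v)
      - g * u\<^sup>2 - h * v\<^sup>2"
    by (simp add: algebra_simps power2_eq_square)
  also have "\<dots> = (k * s + xi + eta + g * u + h * v) + 2 * xi * eta + 2 * (h * v) * xi
      + 2 * (g * u) * eta + (g * u + h * v)\<^sup>2 - g * u\<^sup>2 - h * v\<^sup>2"
    unfolding eq_xi eq_eta eq_u eq_v s(2) by (simp add: algebra_simps power2_eq_square)
  finally show ?thesis using total s by simp
qed

text \<open>Here \<open>x\<close> entries \<open>u\<close> and \<open>y\<close> entries
  \<open>v\<close> of \<open>I\<close> have moved out of the sides, and as many entries
  \<open>s\<close> fill the gaps. Moving one \<open>v\<close> out costs only its pair with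
  \<open>xi\<close>, since its pairs inside \<open>I\<close> remain; the \<open>s\<close> in its
  place gains \<open>s * (iA * u + xi)\<close>. Two new entries on opposite sides add
  \<open>s^2\<close>.\<close>

lemma layout_gain:
  assumes "g = iA + x" "h = iB + y"
  shows "2 - lam * (k * s\<^sup>2 + xi\<^sup>2 + eta\<^sup>2 + g * u\<^sup>2 + h * v\<^sup>2)
      + ((g * u + h * v)\<^sup>2 - (g * u\<^sup>2 + h * v\<^sup>2)
         + 2 * (iA * u + xi + x * s) * (iB * v + eta + y * s) - 2 * (iA * u) * (iB * v))
    = 1 + 2 * (y * (s * iA * u + s * xi - xi * v) + x * (s * iB * v + s * eta - eta * u) + x * y * s\<^sup>2)"
  unfolding square_sum unfolding assms by (simp add: algebra_simps power2_eq_square)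

text \<open>Here \<open>d\<close> entries \<open>u\<close> sit in \<open>B\<close> instead of
  \<open>A\<close>. Pairs inside \<open>I\<close> are unaffected; each displaced entry meets the
  centre \<open>xi\<close> instead of \<open>eta\<close>.\<close>

lemma unbalanced_gain:
  assumes "g = iA + d"
  shows "2 - lam * (k * s\<^sup>2 + xi\<^sup>2 + eta\<^sup>2 + g * u\<^sup>2 + h * v\<^sup>2)
      + ((g * u + h * v)\<^sup>2 - (g * u\<^sup>2 + h * v\<^sup>2)
         + 2 * (iA * u + xi) * (d * u + h * v + eta) - 2 * (iA * u) * (d * u + h * v))
    = 1 + 2 * (d * u * (xi - eta))"
  unfolding square_sum unfolding assms by (simp add: algebra_simps power2_eq_square)

text \<open>The loss \<open>xi * (v - s)\<close> is below \<open>2 * s * (v - s)\<close>, hence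
  below \<open>s * u\<close> by \<open>v_bound\<close>; a single leaf left on the side pays for it.
  The other side is symmetric.\<close>

lemma move_gain_positive:
  "iA \<ge> 1 \<Longrightarrow> s * iA * u + s * xi - xi * v > 0"
  "iB \<ge> 1 \<Longrightarrow> s * iB * v + s * eta - eta * u > 0"
proof -
  have "xi * (v - s) < (2 * s) * (v - s)" using less(1) greater(4) by (intro mult_strict_right_mono) auto
  also have "\<dots> = s * (2 * v - 2 * s)" by (simp add: algebra_simps)
  also have "\<dots> \<le> s * u" using v_bound s by (intro mult_left_mono) auto
  finally have 1: "xi * (v - s) < s * u" .
  assume "iA \<ge> 1"
  then have "s * u * 1 \<le> s * u * iA" using s pos by (intro mult_left_mono) auto
  then show "s * iA * u + s * xi - xi * v > 0" using 1 by (simp add: algebra_simps)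
next
  have "eta * (u - s) < (2 * s) * (u - s)" using less(2) greater(3) by (intro mult_strict_right_mono) auto
  also have "\<dots> = s * (2 * u - 2 * s)" by (simp add: algebra_simps)
  also have "\<dots> \<le> s * v" using u_bound s by (intro mult_left_mono) auto
  finally have 1: "eta * (u - s) < s * v" .
  assume "iB \<ge> 1"
  then have "s * v * 1 \<le> s * v * iB" using s pos by (intro mult_left_mono) auto
  then show "s * iB * v + s * eta - eta * u > 0" using 1 by (simp add: algebra_simps)
qed

text \<open>Bounds the loss when no leaf is left on side \<open>A\<close>; two cross terms
  \<open>s^2\<close> suffice to cover it.\<close>

lemma move_gain_lower: "s * xi - xi * v > - 2 * s\<^sup>2"
proof -
  have "xi * (v - s) < (2 * s) * (v - s)" using less(1) greater(4) by (intro mult_strict_right_mono) auto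
  also have "\<dots> \<le> 2 * s * s" using less(4) s by (intro mult_left_mono) auto
  finally show ?thesis by (simp add: algebra_simps power2_eq_square)
qed

text \<open>A star with one leaf is a \<open>K_2\<close>, so centre and leaf carry the same entry
  \<open>t = xi\<close>, and the other star is the case \<open>b0 = 1\<close>. This lets the
  \<open>K_2\<close> computations serve the balanced problem as well.\<close>

lemma pendant_pair_numbers:
  assumes "g = 1"
  shows "u = xi" "pendant_pair_numbers k 1 h lam xi eta v"
proof -
  have "lam * u = lam * xi" using eq_u eq_xi assms by (simp add: algebra_simps)
  then show u: "u = xi" using lam by simp
  show "pendant_pair_numbers k 1 h lam xi eta v"
    using k h lam pos eq_xi eq_eta eq_v total unfolding assms u
    by unfold_locales (auto simp: algebra_simps)
qed

end

section \<open>Matrices of cut configurations\<close>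

definition cut_nonadj :: "'a set \<Rightarrow> 'a set \<Rightarrow> 'a set \<Rightarrow> 'a \<Rightarrow> 'a \<Rightarrow> bool" where
  "cut_nonadj A B I u v \<longleftrightarrow> (u \<in> I \<and> v \<in> I) \<or> (u \<in> A \<and> v \<in> B) \<or> (u \<in> B \<and> v \<in> A)"

definition cut_matrix :: "'a set \<Rightarrow> 'a set \<Rightarrow> 'a set \<Rightarrow> 'a \<Rightarrow> 'a \<Rightarrow> real" where
  "cut_matrix A B I u v = (if u = v then 0 else if cut_nonadj A B I u v then 2 else 1)"

lemma cut_matrix_sym: "cut_matrix A B I u v = cut_matrix A B I v u"
  unfolding cut_matrix_def cut_nonadj_def by auto

lemma cut_matrix_swap: "cut_matrix B A I = cut_matrix A B I"
  unfolding cut_matrix_def cut_nonadj_def by (intro ext) auto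

lemma sum_constant_on:
  fixes f :: "'a \<Rightarrow> real"
  assumes "\<And>u. u \<in> X \<Longrightarrow> f u = c"
  shows "sum f X = real (card X) * c"
  using assms by simp

lemma sum_split:
  fixes f :: "'a \<Rightarrow> real"
  assumes "finite X" "X = Y \<union> W" "Y \<inter> W = {}"
  shows "sum f X = sum f Y + sum f W"
  using assms by (simp add: sum.union_disjoint)

lemma card_split:
  assumes "finite X" "X = Y \<union> W" "Y \<inter> W = {}"
  shows "card X = card Y + card W"
  using assms by (simp add: card_Un_disjoint)

text \<open>\<open>D\<close> stays abstract because it is instantiated both by the distances of
  \<open>G\<close> and by \<open>cut_matrix\<close> itself, when numbers are read off an extremal or
  intermediate graph. \<open>I\<close> may leave \<open>A \<union> B\<close>: the separator can
  contain members of it.\<close>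

locale cut_config =
  fixes V A B I :: "'a set" and D :: "'a \<Rightarrow> 'a \<Rightarrow> real" and r :: real
  assumes fin: "finite V" and ne: "V \<noteq> {}"
    and sub: "A \<subseteq> V" "B \<subseteq> V" "I \<subseteq> V" and disj: "A \<inter> B = {}"
    and Dsym: "\<And>u v. u \<in> V \<Longrightarrow> v \<in> V \<Longrightarrow> D u v = D v u"
    and Dge: "\<And>u v. u \<in> V \<Longrightarrow> v \<in> V \<Longrightarrow> cut_matrix A B I u v \<le> D u v"
    and top: "top_eigenvalue V D r"
begin

text \<open>The final bracket is \<open>z N z\<close> by inclusion-exclusion: pairs inside
  \<open>I\<close> that also join \<open>A\<close> to \<open>B\<close> would otherwise count
  twice.\<close>

definition gain :: "real \<Rightarrow> ('a \<Rightarrow> real) \<Rightarrow> real" where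
  "gain lam z = 2 * sum z V - lam * (\<Sum>u\<in>V. (z u)\<^sup>2)
     + ((sum z I)\<^sup>2 - (\<Sum>u\<in>I. (z u)\<^sup>2) + 2 * sum z A * sum z B - 2 * sum z (A \<inter> I) * sum z (B \<inter> I))"

lemma finite_sub: "finite A" "finite B" "finite I"
  using fin sub by (auto intro: finite_subset)

lemma quad_form_cut_matrix:
  "quad_form V (cut_matrix A B I) z = (sum z V)\<^sup>2 - (\<Sum>u\<in>V. (z u)\<^sup>2)
     + ((sum z I)\<^sup>2 - (\<Sum>u\<in>I. (z u)\<^sup>2) + 2 * sum z A * sum z B - 2 * sum z (A \<inter> I) * sum z (B \<inter> I))"
proof -
  \<comment> \<open>Cutting \<open>z\<close> off outside a set turns each block of the matrix into a
    product of two one-variable functions. The entrywise identity is then a finite check on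
    memberships.\<close>
  define ind where "ind = (\<lambda>X u. if u \<in> X then z u else 0)"
  have ind: "sum (ind X) V = sum z X" if "X \<subseteq> V" for X
    unfolding ind_def using fin that by (simp add: sum.If_cases Int_absorb1 Int_commute)
  have prod: "(\<Sum>u\<in>V. \<Sum>v\<in>V. ind X u * ind Y v) = sum z X * sum z Y" if "X \<subseteq> V" "Y \<subseteq> V" for X Y
    unfolding ind[OF that(1), symmetric] ind[OF that(2), symmetric] sum_product ..
  have diag: "(\<Sum>u\<in>V. \<Sum>v\<in>V. if u = v then ind X u * ind X u else 0) = (\<Sum>u\<in>X. (z u)\<^sup>2)"
    if "X \<subseteq> V" for X
  proof -
    have "(\<Sum>u\<in>V. \<Sum>v\<in>V. if u = v then ind X u * ind X u else 0) = (\<Sum>u\<in>V. ind X u * ind X u)"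
      using fin by simp
    also have "\<dots> = (\<Sum>u\<in>V. if u \<in> X then (z u)\<^sup>2 else 0)"
      unfolding ind_def by (intro sum.cong) (auto simp: power2_eq_square)
    finally show ?thesis using fin that by (simp add: sum.If_cases Int_absorb1 Int_commute)
  qed
  have "quad_form V (cut_matrix A B I) z = (\<Sum>u\<in>V. \<Sum>v\<in>V.
      ind V u * ind V v - (if u = v then ind V u * ind V u else 0)
      + ind I u * ind I v - (if u = v then ind I u * ind I u else 0)
      + ind A u * ind B v + ind B u * ind A v
      - ind (A \<inter> I) u * ind (B \<inter> I) v - ind (B \<inter> I) u * ind (A \<inter> I) v)"
    unfolding quad_form_def
  proof (intro sum.cong refl)
    fix u v assume uv: "u \<in> V" "v \<in> V"
    have "\<not> (u \<in> A \<and> u \<in> B)" "\<not> (v \<in> A \<and> v \<in> B)" using disj by auto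
    then show "cut_matrix A B I u v * z u * z v =
      ind V u * ind V v - (if u = v then ind V u * ind V u else 0)
      + ind I u * ind I v - (if u = v then ind I u * ind I u else 0)
      + ind A u * ind B v + ind B u * ind A v
      - ind (A \<inter> I) u * ind (B \<inter> I) v - ind (B \<inter> I) u * ind (A \<inter> I) v"
      using uv unfolding cut_matrix_def cut_nonadj_def ind_def
      by (cases "u \<in> A"; cases "u \<in> B"; cases "v \<in> A"; cases "v \<in> B"; cases "u \<in> I"; cases "v \<in> I"; auto)
  qed
  also have "\<dots> = sum z V * sum z V - (\<Sum>u\<in>V. (z u)\<^sup>2) + sum z I * sum z I - (\<Sum>u\<in>I. (z u)\<^sup>2)
      + sum z A * sum z B + sum z B * sum z A - sum z (A \<inter> I) * sum z (B \<inter> I)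
      - sum z (B \<inter> I) * sum z (A \<inter> I)"
  proof -
    have s: "A \<inter> I \<subseteq> V" "B \<inter> I \<subseteq> V" "V \<subseteq> V" using sub by auto
    show ?thesis unfolding sum.distrib sum_subtractf
      by (simp only: prod diag sub s)
  qed
  finally show ?thesis by (simp add: power2_eq_square)
qed

lemma quad_form_cut_matrix_le:
  assumes "\<And>u. u \<in> V \<Longrightarrow> z u \<ge> 0"
  shows "quad_form V (cut_matrix A B I) z \<le> quad_form V D z"
  unfolding quad_form_def mult.assoc
  using assms Dge by (intro sum_mono mult_right_mono) auto

lemma gain_le:
  assumes "\<And>u. u \<in> V \<Longrightarrow> z u \<ge> 0"
  shows "gain lam z - 1 \<le> (r - (lam - 1)) * (\<Sum>u\<in>V. (z u)\<^sup>2)"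
proof -
  let ?Q = "\<Sum>u\<in>V. (z u)\<^sup>2"
  have "0 \<le> (sum z V - 1)\<^sup>2" by simp
  then have "gain lam z - 1 \<le> quad_form V (cut_matrix A B I) z - (lam - 1) * ?Q"
    unfolding quad_form_cut_matrix gain_def by (simp add: power2_eq_square algebra_simps)
  also have "\<dots> \<le> r * ?Q - (lam - 1) * ?Q"
  proof -
    have "quad_form V D z \<le> r * ?Q" using top unfolding top_eigenvalue_def by blast
    then show ?thesis using quad_form_cut_matrix_le[of z, OF assms] by linarith
  qed
  finally show ?thesis by (simp add: algebra_simps)
qed

lemma gain_greater:
  assumes "\<And>u. u \<in> V \<Longrightarrow> z u \<ge> 0" "gain lam z > 1"
  shows "r > lam - 1"
proof (rule ccontr)
  assume "\<not> ?thesis"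
  then have "(r - (lam - 1)) * (\<Sum>u\<in>V. (z u)\<^sup>2) \<le> 0"
    by (intro mult_nonpos_nonneg sum_nonneg) auto
  then show False using gain_le[of z lam, OF assms(1)] assms(2) by auto
qed

lemma sum_squares_positive:
  assumes "\<And>u. u \<in> V \<Longrightarrow> z u > (0::real)"
  shows "(\<Sum>u\<in>V. (z u)\<^sup>2) > 0"
  using fin ne assms by (intro sum_pos) force+

lemma gain_ge:
  assumes "\<And>u. u \<in> V \<Longrightarrow> z u > 0" "gain lam z \<ge> 1"
  shows "r \<ge> lam - 1"
proof (rule ccontr)
  assume "\<not> ?thesis"
  then have "(r - (lam - 1)) * (\<Sum>u\<in>V. (z u)\<^sup>2) < 0"
    using sum_squares_positive[OF assms(1)] by (intro mult_neg_pos) auto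
  then show False using gain_le[of z lam] assms by (force intro: less_imp_le)
qed

text \<open>The bound \<open>gain_le\<close> chains the tangent inequality, the domination of
  \<open>cut_matrix\<close> by \<open>D\<close> and the Rayleigh bound. With sum 1 the tangent is
  exact, and \<open>r = lam - 1\<close> forces equality in the other two. Rayleigh equality makes
  \<open>z\<close> an eigenvector; positive entries of \<open>z\<close> turn equality of the forms
  into equality of all matrix entries.\<close>

lemma gain_equality:
  assumes z: "\<And>u. u \<in> V \<Longrightarrow> z u > 0" and g: "gain lam z \<ge> 1" and T: "sum z V = 1"
    and r: "r = lam - 1"
  shows "gain lam z = 1" "eigen_on V D r z"
    and "\<And>u v. u \<in> V \<Longrightarrow> v \<in> V \<Longrightarrow> D u v = cut_matrix A B I u v"
proof -
  let ?Q = "\<Sum>u\<in>V. (z u)\<^sup>2"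
  have z0: "\<And>u. u \<in> V \<Longrightarrow> z u \<ge> 0" using z less_imp_le by blast
  show "gain lam z = 1" using gain_le[of z lam, OF z0] g r by simp
  then have "quad_form V (cut_matrix A B I) z = r * ?Q"
    unfolding quad_form_cut_matrix gain_def r using T by (simp add: algebra_simps)
  then have eq: "quad_form V D z = r * ?Q" "quad_form V (cut_matrix A B I) z = quad_form V D z"
  proof -
    have "quad_form V D z \<le> r * ?Q" using top unfolding top_eigenvalue_def by blast
    moreover have "quad_form V (cut_matrix A B I) z \<le> quad_form V D z"
      by (rule quad_form_cut_matrix_le[of z, OF z0])
    moreover assume "quad_form V (cut_matrix A B I) z = r * ?Q"
    ultimately show "quad_form V D z = r * ?Q" "quad_form V (cut_matrix A B I) z = quad_form V D z"
      by linarith+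
  qed
  show "eigen_on V D r z"
    using top eq(1) unfolding top_eigenvalue_def by (intro quad_form_maximizer_eigen fin Dsym) auto
  fix u v assume uv: "u \<in> V" "v \<in> V"
  have le: "cut_matrix A B I a b * z a * z b \<le> D a b * z a * z b" if "a \<in> V" "b \<in> V" for a b
    using that Dge z0 by (intro mult_right_mono) auto
  have "(\<Sum>a\<in>V. (\<Sum>b\<in>V. D a b * z a * z b) - (\<Sum>b\<in>V. cut_matrix A B I a b * z a * z b)) = 0"
    using eq(2) unfolding quad_form_def sum_subtractf by simp
  then have "\<forall>a\<in>V. (\<Sum>b\<in>V. D a b * z a * z b) - (\<Sum>b\<in>V. cut_matrix A B I a b * z a * z b) = 0"
    using fin le by (subst (asm) sum_nonneg_eq_0_iff) (auto intro: sum_mono)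
  then have "(\<Sum>b\<in>V. D u b * z u * z b - cut_matrix A B I u b * z u * z b) = 0"
    using uv unfolding sum_subtractf by simp
  then have "\<forall>b\<in>V. D u b * z u * z b - cut_matrix A B I u b * z u * z b = 0"
    using fin le uv by (subst (asm) sum_nonneg_eq_0_iff) auto
  then have "D u v * z u * z v - cut_matrix A B I u v * z u * z v = 0" using uv by blast
  then have "(D u v - cut_matrix A B I u v) * (z u * z v) = 0" by (simp add: algebra_simps)
  then show "D u v = cut_matrix A B I u v" using z uv by (simp add: less_imp_neq[symmetric])
qed

lemma swap: "cut_config V B A I D r"
  using fin ne sub disj Dsym Dge top by unfold_locales (auto simp: cut_matrix_swap)

end

section \<open>Perron vectors of cut matrices and their row equations\<close>

lemma eigen_on_cut_matrix_row:
  assumes fin: "finite V" and ev: "eigen_on V (cut_matrix A B I) r x" and u: "u \<in> V"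
  shows "(r + 1) * x u = sum x V + sum x {v \<in> V. v \<noteq> u \<and> cut_nonadj A B I u v}"
proof -
  have "r * x u = (\<Sum>v\<in>V. cut_matrix A B I u v * x v)" using ev u unfolding eigen_on_def by simp
  also have "\<dots> = (\<Sum>v\<in>V. x v - (if v = u then x u else 0)
      + (if v \<noteq> u \<and> cut_nonadj A B I u v then x v else 0))"
    unfolding cut_matrix_def by (intro sum.cong) auto
  also have "\<dots> = sum x V - x u + sum x {v \<in> V. v \<noteq> u \<and> cut_nonadj A B I u v}"
    using fin u by (simp add: sum.distrib sum_subtractf sum.inter_filter[symmetric])
  finally show ?thesis by (simp add: algebra_simps)
qed

text \<open>All vertices of a class satisfy one and the same scalar equation once the class sums are
  regarded as known, so the Perron vector is constant on classes without any symmetrisation.\<close>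

lemma two_pendant_numbers_exist:
  assumes conf: "cut_config V A B I (cut_matrix A B I) r" and IAB: "I \<subseteq> A \<union> B"
    and A: "A - I = {a}" and B: "B - I = {b}"
    and cards: "card (A \<inter> I) = g" "card (B \<inter> I) = h" "card V = k + 2 + g + h"
    and pos: "g \<ge> 1" "h \<ge> 1" "k \<ge> 1"
  shows "\<exists>xi eta u v. two_pendant_numbers (real k) (real g) (real h) (r + 1) xi eta u v"
proof -
  interpret cut_config V A B I "cut_matrix A B I" r by fact
  obtain x where x: "\<forall>u\<in>V. x u > 0" "sum x V = 1" "eigen_on V (cut_matrix A B I) r x"
  proof -
    have "\<exists>x. (\<forall>u\<in>V. x u > 0) \<and> sum x V = 1 \<and> eigen_on V (cut_matrix A B I) r x"
      by (rule perron_vector[OF fin Dsym _ _ top]) (auto simp: cut_matrix_def)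
    then show ?thesis using that by blast
  qed
  note row = eigen_on_cut_matrix_row[OF fin x(3), unfolded x(2)]
  let ?N = "\<lambda>u. {v \<in> V. v \<noteq> u \<and> cut_nonadj A B I u v}"
  have aA: "a \<in> A" "a \<notin> I" "a \<in> V" "a \<notin> B" and bB: "b \<in> B" "b \<notin> I" "b \<in> V" "b \<notin> A"
    using A B sub disj by auto
  have Aeq: "A = insert a (A \<inter> I)" and Beq: "B = insert b (B \<inter> I)" using A B by auto
  have ab: "a \<noteq> b" using aA bB by auto
  have fAI: "finite (A \<inter> I)" and fBI: "finite (B \<inter> I)" using finite_sub by auto
  \<comment> \<open>\<open>u\<close> and \<open>v\<close> are the solutions of the leaf equations,
    fixed before the leaf entries are known to agree. A leaf is missing from its own row sum over
    \<open>I\<close>; moving its entry to the left turns \<open>r + 1\<close> into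
    \<open>r + 2\<close>.\<close>
  define xi eta u v where "xi = x a" and "eta = x b"
    and "u = (1 + sum x I + eta) / (r + 2)" and "v = (1 + sum x I + xi) / (r + 2)"
  have sAe: "sum x A = xi + sum x (A \<inter> I)" and sBe: "sum x B = eta + sum x (B \<inter> I)"
    using sum_split[of A "{a}" "A \<inter> I" x] sum_split[of B "{b}" "B \<inter> I" x] finite_sub aA bB Aeq Beq
    unfolding xi_def eta_def by auto
  have lamxi: "(r + 1) * xi = 1 + eta + sum x (B \<inter> I)"
  proof -
    have "?N a = B" using aA sub disj unfolding cut_nonadj_def by auto
    then have "sum x (?N a) = eta + sum x (B \<inter> I)" using sBe by simp
    then show ?thesis using row[OF aA(3)] unfolding xi_def by simp
  qed
  have lameta: "(r + 1) * eta = 1 + xi + sum x (A \<inter> I)"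
  proof -
    have "?N b = A" using bB sub disj unfolding cut_nonadj_def by auto
    then have "sum x (?N b) = xi + sum x (A \<inter> I)" using sAe by simp
    then show ?thesis using row[OF bB(3)] unfolding eta_def by simp
  qed
  have "0 < (r + 1) * xi"
    unfolding lamxi eta_def using x(1) sub bB by (intro add_pos_nonneg sum_nonneg) (auto intro: less_imp_le)
  then have lam: "r + 1 > 0" using x(1) aA unfolding xi_def by (metis zero_less_mult_pos2)
  have xu: "x w = u" if "w \<in> A \<inter> I" for w
  proof -
    have "?N w = insert b (I - {w})" using that bB sub disj Beq unfolding cut_nonadj_def by auto
    then have "sum x (?N w) = eta + (sum x I - x w)"
      using finite_sub that bB by (simp add: eta_def sum_diff1)
    moreover have "w \<in> V" using that sub by auto
    ultimately have "(r + 2) * x w = 1 + sum x I + eta" using row[of w] by (simp add: algebra_simps)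
    then show ?thesis unfolding u_def using lam by (simp add: field_simps)
  qed
  have xv: "x w = v" if "w \<in> B \<inter> I" for w
  proof -
    have "?N w = insert a (I - {w})" using that aA sub disj Aeq unfolding cut_nonadj_def by auto
    then have "sum x (?N w) = xi + (sum x I - x w)"
      using finite_sub that aA by (simp add: xi_def sum_diff1)
    moreover have "w \<in> V" using that sub by auto
    ultimately have "(r + 2) * x w = 1 + sum x I + xi" using row[of w] by (simp add: algebra_simps)
    then show ?thesis unfolding v_def using lam by (simp add: field_simps)
  qed
  have sA: "sum x (A \<inter> I) = g * u" and sB: "sum x (B \<inter> I) = h * v"
    using sum_constant_on[of "A \<inter> I" x, OF xu] sum_constant_on[of "B \<inter> I" x, OF xv] cards by auto
  have sI: "sum x I = g * u + h * v"
  proof -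
    have "sum x I = sum x (A \<inter> I) + sum x (B \<inter> I)"
      using IAB disj finite_sub by (intro sum_split) auto
    then show ?thesis using sA sB by simp
  qed
  have xs: "x w = 1 / (r + 1)" if "w \<in> V - (A \<union> B)" for w
  proof -
    have "?N w = {}" using that IAB unfolding cut_nonadj_def by auto
    then have "(r + 1) * x w = 1" using row[of w] that by (metis DiffD1 add.right_neutral sum.empty)
    then show ?thesis using lam by (simp add: field_simps)
  qed
  have cA: "card A = g + 1" using Aeq aA fAI cards by (metis IntD2 Suc_eq_plus1 card_insert_disjoint)
  have cB: "card B = h + 1" using Beq bB fBI cards by (metis IntD2 Suc_eq_plus1 card_insert_disjoint)
  have cAB: "card (A \<union> B) = g + h + 2" using finite_sub disj cA cB by (simp add: card_Un_disjoint)
  have "card (V - (A \<union> B)) = k"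
    using card_Diff_subset[of "A \<union> B" V] finite_sub sub cards cAB by simp
  then have sV: "sum x (V - (A \<union> B)) = k / (r + 1)"
    using sum_constant_on[of "V - (A \<union> B)" x, OF xs] by simp
  have sAx: "sum x A = xi + g * u" using sAe sA by simp
  have sBx: "sum x B = eta + h * v" using sBe sB by simp
  have "sum x V = sum x (A \<union> B) + sum x (V - (A \<union> B))" using fin sub by (intro sum_split) auto
  also have "sum x (A \<union> B) = sum x A + sum x B" using finite_sub disj by (intro sum_split) auto
  finally have total: "1 = xi + g * u + (eta + h * v) + k / (r + 1)"
    unfolding x(2) sAx sBx sV .
  obtain w1 w2 where "w1 \<in> A \<inter> I" "w2 \<in> B \<inter> I" using pos cards fAI fBI
    by (metis card.empty ex_in_conv not_one_le_zero)
  then have uv: "u > 0" "v > 0" using x(1) xu xv sub by (metis IntD1 subsetD)+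
  have "(r + 2) * u = 1 + sum x I + eta" "(r + 2) * v = 1 + sum x I + xi"
    unfolding u_def v_def using lam by auto
  then have lu: "(r + 1 + 1) * u = 1 + g * u + h * v + eta" and lv: "(r + 1 + 1) * v = 1 + g * u + h * v + xi"
    by (simp_all add: sI add_ac)
  have "xi > 0" "eta > 0" unfolding xi_def eta_def using x(1) aA bB by auto
  moreover have "real k \<ge> 1" "real g \<ge> 1" "real h \<ge> 1" using pos by auto
  moreover have "real k / (r + 1) + xi + eta + g * u + h * v = 1" using total by simp
  ultimately have "two_pendant_numbers (real k) (real g) (real h) (r + 1) xi eta u v"
    using lam uv lamxi[unfolded sB] lameta[unfolded sA] lu lv by (intro two_pendant_numbers.intro) auto
  then show ?thesis by blast
qed

text \<open>Both \<open>a\<close> and \<open>w\<close> have exactly \<open>B\<close> as set of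
  non-neighbours, the rest of \<open>I\<close> lying in \<open>B\<close>, so they share the entry
  \<open>t\<close> although only \<open>w\<close> belongs to \<open>I\<close>.\<close>

lemma pendant_pair_numbers_exist:
  assumes conf: "cut_config V A B I (cut_matrix A B I) r" and IAB: "I \<subseteq> A \<union> B"
    and A: "A = {a, w}" "a \<notin> I" "w \<in> I"
    and cards: "card (B - I) = b0" "card (B \<inter> I) = be" "card V = k + 2 + b0 + be"
    and pos: "b0 \<ge> 1" "be \<ge> 1" "k \<ge> 1"
  shows "\<exists>t p q. pendant_pair_numbers (real k) (real b0) (real be) (r + 1) t p q"
proof -
  interpret cut_config V A B I "cut_matrix A B I" r by fact
  obtain x where x: "\<forall>u\<in>V. x u > 0" "sum x V = 1" "eigen_on V (cut_matrix A B I) r x"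
  proof -
    have "\<exists>x. (\<forall>u\<in>V. x u > 0) \<and> sum x V = 1 \<and> eigen_on V (cut_matrix A B I) r x"
      by (rule perron_vector[OF fin Dsym _ _ top]) (auto simp: cut_matrix_def)
    then show ?thesis using that by blast
  qed
  note row = eigen_on_cut_matrix_row[OF fin x(3), unfolded x(2)]
  let ?N = "\<lambda>u. {v \<in> V. v \<noteq> u \<and> cut_nonadj A B I u v}"
  have aw: "a \<in> V" "w \<in> V" "a \<notin> B" "w \<notin> B" "a \<noteq> w" using A sub disj by auto
  have Ieq: "I = insert w (B \<inter> I)" using IAB A by auto
  have fBI: "finite (B \<inter> I)" "finite (B - I)" using finite_sub by auto
  define t p q where "t = x a" and "p = (1 + sum x A) / (r + 1)"
    and "q = (1 + sum x A + sum x (B \<inter> I)) / (r + 2)"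
  have lt: "(r + 1) * t = 1 + sum x B"
  proof -
    have "?N a = B" using aw A sub disj unfolding cut_nonadj_def by auto
    then show ?thesis using row[OF aw(1)] unfolding t_def by simp
  qed
  have lw: "(r + 1) * x w = 1 + sum x B"
  proof -
    have "?N w = B" using aw A sub disj IAB unfolding cut_nonadj_def by auto
    then show ?thesis using row[OF aw(2)] unfolding t_def by simp
  qed
  have "0 < (r + 1) * t"
    unfolding lt using x(1) sub by (intro add_pos_nonneg sum_nonneg) (auto intro: less_imp_le)
  then have lam: "r + 1 > 0" using x(1) aw unfolding t_def by (metis zero_less_mult_pos2)
  have xw: "x w = t" using lt lw lam by (metis less_numeral_extra(3) mult_cancel_left)
  have sA: "sum x A = 2 * t" using aw xw unfolding A t_def by simp
  have xp: "x y = p" if "y \<in> B - I" for y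
  proof -
    have "?N y = A" using that sub disj unfolding cut_nonadj_def by auto
    moreover have "y \<in> V" using that sub by auto
    ultimately have "(r + 1) * x y = 1 + sum x A" using row[of y] by simp
    then show ?thesis unfolding p_def using lam by (simp add: field_simps)
  qed
  have xq: "x y = q" if "y \<in> B \<inter> I" for y
  proof -
    have "?N y = A \<union> (B \<inter> I - {y})" using that sub disj Ieq A unfolding cut_nonadj_def by auto
    moreover have "sum x (A \<union> (B \<inter> I - {y})) = sum x A + sum x (B \<inter> I - {y})"
      using finite_sub disj by (intro sum_split) auto
    ultimately have "sum x (?N y) = sum x A + (sum x (B \<inter> I) - x y)"
      using fBI that by (simp add: sum_diff1)
    moreover have "y \<in> V" using that sub by auto
    ultimately have "(r + 2) * x y = 1 + sum x A + sum x (B \<inter> I)" using row[of y] by (simp add: algebra_simps)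
    then show ?thesis unfolding q_def using lam by (simp add: field_simps)
  qed
  have sp: "sum x (B - I) = b0 * p" and sq: "sum x (B \<inter> I) = be * q"
    using sum_constant_on[of "B - I" x, OF xp] sum_constant_on[of "B \<inter> I" x, OF xq] cards by auto
  have sB: "sum x B = b0 * p + be * q"
    using sum_split[of B "B - I" "B \<inter> I" x] finite_sub sp sq by auto
  have cB: "card B = b0 + be" using card_split[of B "B - I" "B \<inter> I"] finite_sub cards by auto
  have xs: "x y = 1 / (r + 1)" if "y \<in> V - (A \<union> B)" for y
  proof -
    have "?N y = {}" using that IAB unfolding cut_nonadj_def by auto
    then have "(r + 1) * x y = 1" using row[of y] that by (metis DiffD1 add.right_neutral sum.empty)
    then show ?thesis using lam by (simp add: field_simps)
  qed
  have cAB: "card (A \<union> B) = b0 + be + 2"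
    using finite_sub disj cB aw by (simp add: card_Un_disjoint A)
  have "card (V - (A \<union> B)) = k"
    using card_Diff_subset[of "A \<union> B" V] finite_sub sub cards cAB by simp
  then have sV: "sum x (V - (A \<union> B)) = k / (r + 1)"
    using sum_constant_on[of "V - (A \<union> B)" x, OF xs] by simp
  have "sum x V = sum x (A \<union> B) + sum x (V - (A \<union> B))" using fin sub by (intro sum_split) auto
  also have "sum x (A \<union> B) = sum x A + sum x B" using finite_sub disj by (intro sum_split) auto
  finally have total: "1 = 2 * t + (b0 * p + be * q) + k / (r + 1)"
    unfolding x(2) sA sB sV .
  obtain w1 w2 where "w1 \<in> B - I" "w2 \<in> B \<inter> I" using pos cards fBI
    by (metis card.empty ex_in_conv not_one_le_zero)
  then have pq: "p > 0" "q > 0" using x(1) xp xq sub by (metis Int_iff Diff_iff subsetD)+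
  have "(r + 2) * q = 1 + sum x A + sum x (B \<inter> I)" unfolding q_def using lam by simp
  then have lq: "(r + 2) * q = 1 + 2 * t + be * q" using sA sq by simp
  have lp: "(r + 1) * p = 1 + 2 * t" unfolding p_def sA using lam by simp
  have "t > 0" unfolding t_def using x(1) aw by auto
  moreover have "real k \<ge> 1" "real b0 \<ge> 1" "real be \<ge> 1" using pos by auto
  moreover have "real k / (r + 1) + 2 * t + b0 * p + be * q = 1" using total by simp
  moreover have "(r + 1) * q = 1 + 2 * t + (real be - 1) * q" using lq by (simp add: algebra_simps)
  moreover have "(r + 1) * t = 1 + b0 * p + be * q" using lt sB by simp
  ultimately have "pendant_pair_numbers (real k) (real b0) (real be) (r + 1) t p q"
    using lam pq lp by (intro pendant_pair_numbers.intro) auto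
  then show ?thesis by blast
qed

section \<open>Test vectors\<close>

lemma sum_const_comp:
  fixes phi :: "real \<Rightarrow> real"
  assumes "\<And>u. u \<in> X \<Longrightarrow> z u = c"
  shows "(\<Sum>u\<in>X. phi (z u)) = real (card X) * phi c"
  using assms by simp

lemma obtain_two:
  assumes "card X \<ge> 2"
  obtains a b where "a \<in> X" "b \<in> X" "a \<noteq> b"
  by (meson assms card_2_iff' obtain_subset_with_card_n subset_iff)

context cut_config
begin

text \<open>The two entries \<open>t\<close> go to \<open>u0\<close> and \<open>w0\<close> in
  \<open>A\<close>, outside and inside \<open>I\<close>; the rest of \<open>I\<close> gets
  \<open>q\<close>. Of the other vertices of \<open>A \<union> B\<close> outside \<open>I\<close>,
  \<open>b0\<close> get \<open>p\<close>, two of them in \<open>B\<close>; everything else gets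
  \<open>s\<close>. The two entries \<open>p\<close> in \<open>B\<close> exceed \<open>t\<close>,
  and \<open>cond\<close> makes the total on \<open>B\<close> exceed \<open>2 * t\<close> whenever
  \<open>A\<close> has a second vertex outside \<open>I\<close>.\<close>

lemma layout_mixed:
  assumes nums: "pendant_pair_numbers (real k) (real b0) (real be) lam t p q"
    and cards: "card I = be + 1" "card (A \<union> B) = b0 + be + 2" "card V = k + card (A \<union> B)"
    and b0: "b0 \<ge> 2" and AI: "A \<inter> I \<noteq> {}" "A - I \<noteq> {}" and BI: "card (B - I) \<ge> 2"
    and cond: "card (A - I) = 1 \<or> card B \<ge> 4 \<or> b0 + be = 4 \<and> B \<inter> I \<noteq> {}"
  shows "r \<ge> lam - 1"
    and "r = lam - 1 \<Longrightarrow> card A = 2 \<and> card (A \<inter> I) = 1 \<and> I \<subseteq> A \<union> B \<and>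
      (\<forall>u\<in>V. \<forall>v\<in>V. D u v = cut_matrix A B I u v)"
proof -
  interpret N: pendant_pair_numbers "real k" "real b0" "real be" lam t p q by fact
  note finite_sub[simp] fin[simp]
  obtain u0 w0 where u0: "u0 \<in> A" "u0 \<notin> I" and w0: "w0 \<in> A" "w0 \<in> I" using AI by auto
  obtain b1 b2 where b12: "b1 \<in> B - I" "b2 \<in> B - I" "b1 \<noteq> b2" using BI by (rule obtain_two)
  define W where "W = (A \<union> B) - I - {u0}"
  define J where "J = I - (A \<union> B)"
  have [simp]: "finite W" "finite J" unfolding W_def J_def by auto
  have cI: "card I = card (A \<inter> I) + card (B \<inter> I) + card J"
  proof -
    have "card I = card ((A \<union> B) \<inter> I) + card J" unfolding J_def by (rule card_split) auto
    moreover have "card ((A \<union> B) \<inter> I) = card (A \<inter> I) + card (B \<inter> I)"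
      using disj by (intro card_split) auto
    ultimately show ?thesis by simp
  qed
  have cW: "card W = b0 + card J"
  proof -
    have "card (A \<union> B) = card ((A \<union> B) \<inter> I) + card ((A \<union> B) - I)" by (rule card_split) auto
    moreover have "card ((A \<union> B) \<inter> I) = card (A \<inter> I) + card (B \<inter> I)"
      using disj by (intro card_split) auto
    moreover have "card ((A \<union> B) - I) = Suc (card W)" unfolding W_def
      using u0 by (intro card.remove) auto
    ultimately show ?thesis using cI cards by simp
  qed
  \<comment> \<open>\<open>W\<close> has one vertex more than the entries \<open>p\<close> can fill
    for each member of \<open>I\<close> outside the sides; \<open>b1\<close> and \<open>b2\<close>
    are secured an entry \<open>p\<close> before the others are chosen.\<close>
  have bW: "{b1, b2} \<subseteq> W" using b12 u0 disj unfolding W_def by auto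
  have "card (W - {b1, b2}) = b0 + card J - 2"
    using cW bW b12 by (subst card_Diff_subset) auto
  then obtain P' where P': "P' \<subseteq> W - {b1, b2}" "card P' = b0 - 2"
    by (metis b0 diff_le_mono le_add1 obtain_subset_with_card_n)
  define P where "P = P' \<union> {b1, b2}"
  have PW: "P \<subseteq> W" using P' bW unfolding P_def by auto
  then have [simp]: "finite P" by (rule finite_subset) simp
  have cP: "card P = b0"
  proof -
    have "finite P'" using P' by (meson \<open>finite W\<close> finite_Diff finite_subset)
    then have "card P = card P' + card {b1, b2}" unfolding P_def
      using P' by (intro card_Un_disjoint) auto
    then show ?thesis using P'(2) b12 b0 by simp
  qed
  define Q where "Q = V - I - {u0} - P"
  have [simp]: "finite Q" unfolding Q_def by simp
  have PQ: "P \<inter> I = {}" "u0 \<notin> P" "P \<subseteq> V" using PW sub unfolding W_def by auto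
  have cQ: "card Q = k"
  proof -
    have "card V = card I + card (V - I)" using sub by (intro card_split) auto
    moreover have "card (V - I) = Suc (card (V - I - {u0}))"
      using u0 sub by (intro card.remove) auto
    moreover have "card (V - I - {u0}) = card P + card Q"
      using PQ unfolding Q_def by (intro card_split) auto
    ultimately show ?thesis using cards cP by simp
  qed
  define z where "z = (\<lambda>y. if y = u0 \<or> y = w0 then t else if y \<in> I then q else if y \<in> P then p else N.s)"
  have zI: "z y = q" if "y \<in> I - {w0}" for y using that u0 unfolding z_def by auto
  have zu: "z u0 = t" "z w0 = t" unfolding z_def by auto
  have zP: "z y = p" if "y \<in> P" for y using that PQ w0 unfolding z_def by auto
  have zQ: "z y = N.s" if "y \<in> Q" for y using that w0 unfolding z_def Q_def by auto
  have zpos: "z y > 0" for y unfolding z_def using N.tpq N.s by auto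
  have sumI: "(\<Sum>y\<in>I. phi (z y)) = phi t + be * phi q" for phi :: "real \<Rightarrow> real"
  proof -
    have "(\<Sum>y\<in>I. phi (z y)) = phi (z w0) + (\<Sum>y\<in>I - {w0}. phi (z y))"
      using w0 by (intro sum.remove) auto
    moreover have "(\<Sum>y\<in>I - {w0}. phi (z y)) = card (I - {w0}) * phi q"
      by (rule sum_const_comp) (rule zI)
    ultimately show ?thesis using zu w0 cards by simp
  qed
  have sumV: "(\<Sum>y\<in>V. phi (z y)) = 2 * phi t + be * phi q + b0 * phi p + k * phi N.s" for phi :: "real \<Rightarrow> real"
  proof -
    have "(\<Sum>y\<in>V. phi (z y)) = (\<Sum>y\<in>I. phi (z y)) + (\<Sum>y\<in>V - I. phi (z y))"
      using sub by (intro sum_split) auto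
    moreover have "(\<Sum>y\<in>V - I. phi (z y)) = phi (z u0) + (\<Sum>y\<in>V - I - {u0}. phi (z y))"
      using u0 sub by (intro sum.remove) auto
    moreover have "(\<Sum>y\<in>V - I - {u0}. phi (z y)) = (\<Sum>y\<in>P. phi (z y)) + (\<Sum>y\<in>Q. phi (z y))"
      using PQ unfolding Q_def by (intro sum_split) auto
    moreover have "(\<Sum>y\<in>P. phi (z y)) = card P * phi p" by (rule sum_const_comp) (rule zP)
    moreover have "(\<Sum>y\<in>Q. phi (z y)) = card Q * phi N.s" by (rule sum_const_comp) (rule zQ)
    ultimately show ?thesis using sumI zu cP cQ by simp
  qed
  define iA iB j where "iA = real (card (A \<inter> I))" and "iB = real (card (B \<inter> I))" and "j = real (card J)"
  define PA PB where "PA = sum z (A - I - {u0})" and "PB = sum z (B - I)"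
  have iA1: "iA \<ge> 1"
    unfolding iA_def using AI by (simp add: Suc_leI card_gt_0_iff)
  have iB0: "iB \<ge> 0" and j0: "j \<ge> 0" unfolding iB_def j_def by auto
  have sAI: "sum z (A \<inter> I) = t + (iA - 1) * q"
  proof -
    have "sum z (A \<inter> I) = z w0 + sum z (A \<inter> I - {w0})" using w0 by (intro sum.remove) auto
    moreover have "sum z (A \<inter> I - {w0}) = card (A \<inter> I - {w0}) * q"
      using zI by (intro sum_constant_on) auto
    ultimately show ?thesis using zu w0 iA1 unfolding iA_def by (simp add: of_nat_diff)
  qed
  have sBI: "sum z (B \<inter> I) = iB * q"
    unfolding iB_def using zI disj w0 by (intro sum_constant_on) auto
  have sA: "sum z A = (t + (iA - 1) * q) + (t + PA)"
  proof -
    have "sum z A = sum z (A \<inter> I) + sum z (A - I)" by (rule sum_split) auto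
    moreover have "sum z (A - I) = z u0 + PA" unfolding PA_def using u0 by (intro sum.remove) auto
    ultimately show ?thesis using sAI zu by simp
  qed
  have sB: "sum z B = iB * q + PB"
    unfolding PB_def sBI[symmetric] by (rule sum_split) auto
  have PAB: "PA + PB = b0 * p + j * N.s"
  proof -
    have "sum z W = PA + PB" unfolding PA_def PB_def using disj u0
      by (intro sum_split) (auto simp: W_def)
    moreover have "sum z W = sum z P + sum z (W - P)" using PW by (intro sum_split) auto
    moreover have "sum z P = card P * p" by (rule sum_constant_on) (rule zP)
    moreover have "sum z (W - P) = card (W - P) * N.s"
      using sub zQ by (intro sum_constant_on) (auto simp: W_def Q_def)
    moreover have "card (W - P) = card J" using cW cP PW by (simp add: card_Diff_subset)
    ultimately show ?thesis using cP unfolding j_def by simp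
  qed
  have jb: "j = be - (iA - 1) - iB" using cI cards unfolding j_def iA_def iB_def by simp
  have gain: "gain lam z = 1 + 2 * ((iA - 1) * q * (PB - t) + PA * (iB * q + PB - 2 * t) + j * t * (2 * N.s - q))"
  proof -
    have 1: "sum z V = 1" using sumV[of "\<lambda>x. x"] N.total N.s(3) by simp
    show ?thesis unfolding gain_def 1 sumV[of "\<lambda>x. x\<^sup>2"] sumI[of "\<lambda>x. x\<^sup>2"] sumI[of "\<lambda>x. x"] sA sB sAI sBI
      using N.layout_gain[OF PAB jb] by (simp add: algebra_simps)
  qed
  have PB2: "PB \<ge> 2 * p"
  proof -
    have "sum z {b1, b2} \<le> PB" unfolding PB_def
      using b12 zpos by (intro sum_mono2) (auto intro: less_imp_le)
    moreover have "z b1 = p" "z b2 = p" using zP unfolding P_def by auto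
    ultimately show ?thesis using b12 by simp
  qed
  have PBt: "PB > t" using PB2 N.p_greater N.t_less by linarith
  have PA0: "PA \<ge> 0" unfolding PA_def using zpos by (intro sum_nonneg) (auto intro: less_imp_le)
  have PApos: "PA > 0" if "card (A - I) \<noteq> 1"
  proof -
    have "A - I - {u0} \<noteq> {}"
    proof
      assume "A - I - {u0} = {}"
      then have "A - I = {u0}" using u0 by auto
      then show False using that by simp
    qed
    then show ?thesis unfolding PA_def using zpos by (intro sum_pos) auto
  qed
  have Bt: "iB * q + PB > 2 * t" if ne1: "card (A - I) \<noteq> 1"
  proof (cases "card B \<ge> 4")
    case True
    have "sum (\<lambda>_. N.s) B \<le> sum z B"
      using N.p_greater N.p_le_q N.s_le unfolding z_def by (intro sum_mono) auto
    moreover have "4 * N.s \<le> card B * N.s" using True N.s by (intro mult_right_mono) auto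
    ultimately show ?thesis using sB N.t_less by simp
  next
    case False
    then have *: "b0 + be = 4" "B \<inter> I \<noteq> {}" using cond ne1 by auto
    then have "iB \<ge> 1" unfolding iB_def by (simp add: Suc_leI card_gt_0_iff)
    then have "iB * q \<ge> 1 * q" using N.tpq by (intro mult_right_mono) auto
    moreover have "3 * p > 2 * t" using * by (intro N.three_p_greater) simp
    ultimately show ?thesis using PB2 N.p_le_q by linarith
  qed
  have T1: "(iA - 1) * q * (PB - t) \<ge> 0" using iA1 N.tpq PBt by simp
  have T2: "PA * (iB * q + PB - 2 * t) \<ge> 0"
  proof (cases "card (A - I) = 1")
    case True
    then have "A - I = {u0}" using u0 by (metis DiffI card_1_singletonE singletonD)
    then have "PA = 0" unfolding PA_def by simp
    then show ?thesis by simp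
  next
    case False
    then show ?thesis using PA0 Bt by simp
  qed
  have T3: "j * t * (2 * N.s - q) \<ge> 0" using j0 N.tpq N.q_less by simp
  have g1: "gain lam z \<ge> 1" unfolding gain using T1 T2 T3 by simp
  show "r \<ge> lam - 1" using gain_ge[OF zpos g1] .
  assume r: "r = lam - 1"
  have sV: "sum z V = 1" using sumV[of "\<lambda>x. x"] N.total N.s(3) by simp
  note eq = gain_equality[OF zpos g1 sV r]
  have zero: "a = 0 \<and> b = 0 \<and> c = 0" if "1 + 2 * (a + b + c) \<le> 1" "a \<ge> 0" "b \<ge> 0" "c \<ge> 0" for a b c :: real
    using that by auto
  \<comment> \<open>Three nonnegative terms add up to zero. Their second factors or entries are
    positive, which fixes \<open>iA\<close>, \<open>j\<close> and the size of \<open>A - I\<close>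
    in turn.\<close>
  have E: "(iA - 1) * q * (PB - t) = 0 \<and> PA * (iB * q + PB - 2 * t) = 0 \<and> j * t * (2 * N.s - q) = 0"
    by (rule zero[OF eq_refl[OF eq(1)[unfolded gain]] T1 T2 T3])
  have "iA = 1" using E N.tpq PBt by auto
  moreover have "j = 0" using E N.tpq N.q_less by auto
  moreover have "card (A - I) = 1" using E PApos Bt by (metis diff_gt_0_iff_gt mult_pos_pos less_irrefl)
  moreover have "card A = card (A \<inter> I) + card (A - I)" by (rule card_split) auto
  ultimately show "card A = 2 \<and> card (A \<inter> I) = 1 \<and> I \<subseteq> A \<union> B \<and>
      (\<forall>u\<in>V. \<forall>v\<in>V. D u v = cut_matrix A B I u v)"
    using eq(3) unfolding iA_def j_def J_def by auto
qed

text \<open>With \<open>A\<close> disjoint from \<open>I\<close>, the vertex of \<open>K_2\<close>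
  that belongs to the independent set has no counterpart in \<open>A\<close>. Two vertices of
  \<open>A\<close> still get \<open>t\<close>, the others of \<open>A \<union> B\<close> outside
  \<open>I\<close> get \<open>p\<close>, and \<open>I\<close> gets the stationary entries of
  \<open>split_clique_gain\<close>. The remaining condition is again that \<open>B\<close> outweighs
  \<open>2 * t\<close> if \<open>A\<close> has a third vertex.\<close>

lemma layout_split:
  assumes nums: "pendant_pair_numbers (real k) (real b0) (real be) lam t p q"
    and cards: "card I = be + 1" "card (A \<union> B) = b0 + be + 2" "card V = k + card (A \<union> B)"
    and AI: "A \<inter> I = {}" and A2: "card A \<ge> 2"
    and cond: "card A = 2 \<or> card B \<ge> 4 \<or> b0 + be = 4 \<and> card B \<ge> 3"
  shows "r > lam - 1"
proof -
  interpret N: pendant_pair_numbers "real k" "real b0" "real be" lam t p q by fact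
  note finite_sub[simp] fin[simp]
  obtain a1 a2 where a12: "a1 \<in> A" "a2 \<in> A" "a1 \<noteq> a2" using A2 by (rule obtain_two)
  have aI: "a1 \<notin> I" "a2 \<notin> I" "a1 \<notin> B" "a2 \<notin> B" using a12 AI disj by auto
  define i j where "i = card (B \<inter> I)" and "j = card (I - B)"
  define R where "R = (A \<union> B) - I - {a1, a2}"
  define Q where "Q = V - (I \<union> A \<union> B)"
  have [simp]: "finite R" "finite Q" unfolding R_def Q_def by auto
  have ij: "i + j = be + 1"
  proof -
    have "card I = card (B \<inter> I) + card (I - B)" by (rule card_split) auto
    then show ?thesis using cards unfolding i_def j_def by simp
  qed
  have cABI: "card (A \<union> B) = i + (card R + 2)"
  proof -
    have "card (A \<union> B) = card (B \<inter> I) + card ((A \<union> B) - I)" using AI by (intro card_split) auto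
    moreover have "card ((A \<union> B) - I) = card R + card {a1, a2}"
      using a12 aI unfolding R_def by (intro card_split) auto
    ultimately show ?thesis using a12 unfolding i_def by simp
  qed
  have cVQ: "card V = card (A \<union> B) + (j + card Q)"
  proof -
    have "card V = card (A \<union> B) + card (V - (A \<union> B))" using sub by (intro card_split) auto
    moreover have "card (V - (A \<union> B)) = card (I - B) + card Q"
      using sub AI unfolding Q_def by (intro card_split) auto
    ultimately show ?thesis unfolding j_def by simp
  qed
  have cQ: "real (card Q) = real k - real j" and jk: "j \<le> k" using cVQ cards by auto
  have cR: "real (card R) = real b0 + real be - real i" using cABI cards by auto
  define c nu Sg yB yS where "c = 1 + 2 * t" and "nu = lam - be"
    and "Sg = (real be + 1 + 2 * t * i) / nu"
    and "yB = (c + Sg) / (lam + 1)" and "yS = (1 + Sg) / (lam + 1)"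
  define z where "z = (\<lambda>y. if y = a1 \<or> y = a2 then t else if y \<in> I then (if y \<in> B then yB else yS)
     else if y \<in> A \<union> B then p else N.s)"
  have zB: "z y = yB" if "y \<in> B \<inter> I" for y using that aI unfolding z_def by auto
  have zS: "z y = yS" if "y \<in> I - B" for y using that aI unfolding z_def by auto
  have za: "z a1 = t" "z a2 = t" unfolding z_def by auto
  have zR: "z y = p" if "y \<in> R" for y using that unfolding z_def R_def by auto
  have zQ: "z y = N.s" if "y \<in> Q" for y using that a12 unfolding z_def Q_def by auto
  have "nu > 0" unfolding nu_def using N.lam_ge N.k N.b0 by simp
  then have Sg0: "Sg > 0" unfolding Sg_def using N.tpq by (simp add: add_pos_nonneg)
  have y0: "yB > 0" "yS > 0" unfolding yB_def yS_def c_def using Sg0 N.lam N.tpq by auto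
  have zpos: "z y > 0" for y unfolding z_def using N.tpq N.s y0 by auto
  have sumI: "(\<Sum>y\<in>I. phi (z y)) = i * phi yB + j * phi yS" for phi :: "real \<Rightarrow> real"
  proof -
    have "(\<Sum>y\<in>I. phi (z y)) = (\<Sum>y\<in>B \<inter> I. phi (z y)) + (\<Sum>y\<in>I - B. phi (z y))"
      by (rule sum_split) auto
    moreover have "(\<Sum>y\<in>B \<inter> I. phi (z y)) = card (B \<inter> I) * phi yB" by (rule sum_const_comp) (rule zB)
    moreover have "(\<Sum>y\<in>I - B. phi (z y)) = card (I - B) * phi yS" by (rule sum_const_comp) (rule zS)
    ultimately show ?thesis unfolding i_def j_def by simp
  qed
  have sumV: "(\<Sum>y\<in>V. phi (z y)) = 2 * phi t + i * phi yB + j * phi yS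
      + (real b0 + real be - real i) * phi p + (real k - real j) * phi N.s" for phi :: "real \<Rightarrow> real"
  proof -
    have "(\<Sum>y\<in>V. phi (z y)) = (\<Sum>y\<in>I. phi (z y)) + (\<Sum>y\<in>V - I. phi (z y))"
      using sub by (intro sum_split) auto
    moreover have "(\<Sum>y\<in>V - I. phi (z y)) = (\<Sum>y\<in>{a1, a2}. phi (z y)) + (\<Sum>y\<in>V - I - {a1, a2}. phi (z y))"
      using a12 aI sub by (intro sum_split) auto
    moreover have "(\<Sum>y\<in>{a1, a2}. phi (z y)) = 2 * phi t" using za a12 by simp
    moreover have "(\<Sum>y\<in>V - I - {a1, a2}. phi (z y)) = (\<Sum>y\<in>R. phi (z y)) + (\<Sum>y\<in>Q. phi (z y))"
      using a12 sub unfolding Q_def R_def by (intro sum_split) auto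
    moreover have "(\<Sum>y\<in>R. phi (z y)) = card R * phi p" by (rule sum_const_comp) (rule zR)
    moreover have "(\<Sum>y\<in>Q. phi (z y)) = card Q * phi N.s" by (rule sum_const_comp) (rule zQ)
    ultimately show ?thesis using sumI cR cQ by simp
  qed
  define PA PB where "PA = sum z (A - {a1, a2})" and "PB = sum z (B - I)"
  have sA: "sum z A = 2 * t + PA"
  proof -
    have "sum z A = sum z {a1, a2} + PA" unfolding PA_def using a12 by (intro sum_split) auto
    then show ?thesis using za a12 by simp
  qed
  have sB: "sum z B = i * yB + PB"
  proof -
    have "sum z B = sum z (B \<inter> I) + PB" unfolding PB_def by (rule sum_split) auto
    moreover have "sum z (B \<inter> I) = card (B \<inter> I) * yB" by (rule sum_constant_on) (rule zB)
    ultimately show ?thesis unfolding i_def by simp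
  qed
  have PAB: "PA + PB = (real b0 + real be - real i) * p"
  proof -
    have "sum z R = PA + PB" unfolding PA_def PB_def using disj aI AI
      by (intro sum_split) (auto simp: R_def)
    moreover have "sum z R = card R * p" by (rule sum_constant_on) (rule zR)
    ultimately show ?thesis using cR by simp
  qed
  have ijr: "real i + real j = real be + 1" using ij by simp
  note G = N.split_clique_gain[OF ijr c_def nu_def Sg_def yB_def yS_def PAB]
  have 0: "0 < ((real j - 1) * c\<^sup>2 - real j) / lam + (i * c + real j)\<^sup>2 / nu - (be * c)\<^sup>2 / (nu + 1)"
    using N.split_clique_gain_positive[OF ijr _ _ c_def nu_def] jk by simp
  \<comment> \<open>For a member of \<open>I\<close> in \<open>B\<close>, its entry is part of
    \<open>Sg\<close>, so \<open>(lam + 1) * yB = c + Sg\<close> yields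
    \<open>lam * yB >= c = lam * p\<close>.\<close>
  have zBp: "z y \<ge> p" if "y \<in> B" for y
  proof (cases "y \<in> I")
    case True
    then have "card (B \<inter> I) > 0" using that by (auto simp: card_gt_0_iff)
    then have "real i \<ge> 1" unfolding i_def by simp
    then have "i * yB \<ge> 1 * yB" using y0 by (intro mult_right_mono) auto
    moreover have "j * yS \<ge> 0" using y0 by simp
    ultimately have "Sg \<ge> yB" using G(1) by linarith
    moreover have "(lam + 1) * yB = c + Sg" unfolding yB_def using N.lam by simp
    ultimately have "lam * yB \<ge> lam * p" using N.eq_p unfolding c_def by (simp add: algebra_simps)
    then show ?thesis using N.lam zB that True by simp
  next
    case False
    then show ?thesis using that aI unfolding z_def by auto
  qed
  have PAt: "PA * (i * yB + PB - 2 * t) \<ge> 0"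
  proof (cases "card A = 2")
    case True
    then have "A = {a1, a2}" using a12 by (metis \<open>finite A\<close> card_2_iff card_subset_eq empty_subsetI insert_subset)
    then have "PA = 0" unfolding PA_def by simp
    then show ?thesis by simp
  next
    case False
    have "sum (\<lambda>_. p) B \<le> sum z B" using zBp by (intro sum_mono) auto
    then have Bp: "card B * p \<le> i * yB + PB" using sB by simp
    have "2 * t \<le> card B * p"
    proof (cases "card B \<ge> 4")
      case True
      then have "4 * p \<le> card B * p" using N.tpq by (intro mult_right_mono) auto
      then show ?thesis using N.p_greater N.t_less by linarith
    next
      case F: False
      then have *: "b0 + be = 4" "card B \<ge> 3" using cond False by auto
      then have "3 * p \<le> card B * p" using N.tpq by (intro mult_right_mono) auto
      moreover have "3 * p > 2 * t" using * by (intro N.three_p_greater) simp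
      ultimately show ?thesis by linarith
    qed
    moreover have "PA \<ge> 0" unfolding PA_def using zpos by (intro sum_nonneg) (auto intro: less_imp_le)
    ultimately show ?thesis using Bp by simp
  qed
  have "sum z (A \<inter> I) = 0" using AI by simp
  then have gain: "gain lam z = 2 * (2 * t + i * yB + j * yS + (real b0 + real be - real i) * p + (k - real j) * N.s)
      - lam * (2 * t\<^sup>2 + i * yB\<^sup>2 + j * yS\<^sup>2 + (real b0 + real be - real i) * p\<^sup>2 + (k - real j) * N.s\<^sup>2)
      + (Sg\<^sup>2 - (i * yB\<^sup>2 + j * yS\<^sup>2) + 2 * (2 * t + PA) * (i * yB + PB))"
    unfolding gain_def sumV[of "\<lambda>x. x\<^sup>2"] sumV[of "\<lambda>x. x"] sumI[of "\<lambda>x. x\<^sup>2"] sumI[of "\<lambda>x. x"] sA sB G(1)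
    by simp
  have "0 \<le> 2 * (lam + 1) * PA * (i * yB + PB - 2 * t)"
    using mult_nonneg_nonneg[OF _ PAt, of "2 * (lam + 1)"] N.lam by (simp add: mult.assoc)
  then have "(lam + 1) * (gain lam z - 1) > 0" unfolding gain G(2) using 0 by linarith
  then have "gain lam z > 1" using N.lam by (simp add: zero_less_mult_iff)
  then show ?thesis using gain_greater zpos less_imp_le by blast
qed

text \<open>If \<open>A\<close> has too few members of \<open>I\<close>, the missing entries
  \<open>u\<close> are placed on members of \<open>I\<close> in \<open>B\<close>. The gain is
  nonnegative because the centre with fewer leaves has the larger entry.\<close>

lemma layout_unbalanced:
  assumes nums: "two_pendant_numbers (real k) (real g) (real h) lam xi eta u v"
    and gh: "g \<le> h" and IAB: "I \<subseteq> A \<union> B" and A: "A - I = {a}" and B: "B - I = {b}"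
    and iA: "card (A \<inter> I) \<le> g" and iAB: "card (A \<inter> I) + card (B \<inter> I) = g + h"
    and cV: "card V = k + 2 + g + h"
  shows "r \<ge> lam - 1"
    and "r = lam - 1 \<Longrightarrow> card (A \<inter> I) = g \<and> (\<forall>u\<in>V. \<forall>v\<in>V. D u v = cut_matrix A B I u v)"
proof -
  interpret N: two_pendant_numbers "real k" "real g" "real h" lam xi eta u v by fact
  note finite_sub[simp] fin[simp]
  have aA: "a \<in> A" "a \<notin> I" "a \<in> V" "a \<notin> B" and bB: "b \<in> B" "b \<notin> I" "b \<in> V" "b \<notin> A"
    using A B sub disj by auto
  then have ab: "a \<noteq> b" by auto
  define d where "d = g - card (A \<inter> I)"
  have "d \<le> card (B \<inter> I)" using iA iAB gh unfolding d_def by simp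
  then obtain X where X: "X \<subseteq> B \<inter> I" "card X = d"
    by (metis obtain_subset_with_card_n)
  have [simp]: "finite X" using X(1) by (rule finite_subset) simp
  have cBX: "card (B \<inter> I - X) = h" using X iA iAB by (simp add: card_Diff_subset d_def)
  have gd: "real g = real (card (A \<inter> I)) + real d" using iA unfolding d_def by simp
  define Q where "Q = V - (A \<union> B)"
  have cQ: "card Q = k"
  proof -
    have "card V = card (A \<union> B) + card Q" using sub unfolding Q_def by (intro card_split) auto
    moreover have "card (A \<union> B) = card A + card B" using disj by (intro card_split) auto
    moreover have "card A = card (A \<inter> I) + card (A - I)" "card B = card (B \<inter> I) + card (B - I)"
      by (auto intro!: card_split)
    ultimately show ?thesis using cV iAB A B by simp
  qed
  define z where "z = (\<lambda>y. if y = a then xi else if y = b then eta else if y \<in> (A \<inter> I) \<union> X then u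
     else if y \<in> B \<inter> I then v else N.s)"
  have zA: "z y = u" if "y \<in> A \<inter> I" for y using that aA bB unfolding z_def by auto
  have zX: "z y = u" if "y \<in> X" for y using that aA bB X unfolding z_def by auto
  have zB: "z y = v" if "y \<in> B \<inter> I - X" for y using that aA bB disj unfolding z_def by auto
  have zab: "z a = xi" "z b = eta" using ab unfolding z_def by auto
  have zQ: "z y = N.s" if "y \<in> Q" for y using that aA bB X unfolding z_def Q_def by auto
  have zpos: "z y > 0" for y unfolding z_def using N.pos N.s by auto
  have sumAI: "(\<Sum>y\<in>A \<inter> I. phi (z y)) = card (A \<inter> I) * phi u" for phi :: "real \<Rightarrow> real"
    by (rule sum_const_comp) (rule zA)
  have sumBI: "(\<Sum>y\<in>B \<inter> I. phi (z y)) = d * phi u + h * phi v" for phi :: "real \<Rightarrow> real"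
  proof -
    have "(\<Sum>y\<in>B \<inter> I. phi (z y)) = (\<Sum>y\<in>X. phi (z y)) + (\<Sum>y\<in>B \<inter> I - X. phi (z y))"
      using X by (intro sum_split) auto
    moreover have "(\<Sum>y\<in>X. phi (z y)) = card X * phi u" by (rule sum_const_comp) (rule zX)
    moreover have "(\<Sum>y\<in>B \<inter> I - X. phi (z y)) = card (B \<inter> I - X) * phi v" by (rule sum_const_comp) (rule zB)
    ultimately show ?thesis using X cBX by simp
  qed
  have sumI: "(\<Sum>y\<in>I. phi (z y)) = g * phi u + h * phi v" for phi :: "real \<Rightarrow> real"
  proof -
    have "(\<Sum>y\<in>I. phi (z y)) = (\<Sum>y\<in>A \<inter> I. phi (z y)) + (\<Sum>y\<in>B \<inter> I. phi (z y))"
      using IAB disj by (intro sum_split) auto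
    then show ?thesis unfolding sumAI sumBI gd by (simp add: algebra_simps)
  qed
  have sumA: "(\<Sum>y\<in>A. phi (z y)) = card (A \<inter> I) * phi u + phi xi" for phi :: "real \<Rightarrow> real"
  proof -
    have "(\<Sum>y\<in>A. phi (z y)) = (\<Sum>y\<in>A \<inter> I. phi (z y)) + (\<Sum>y\<in>A - I. phi (z y))"
      by (rule sum_split) auto
    then show ?thesis unfolding sumAI A using zab by simp
  qed
  have sumB: "(\<Sum>y\<in>B. phi (z y)) = d * phi u + h * phi v + phi eta" for phi :: "real \<Rightarrow> real"
  proof -
    have "(\<Sum>y\<in>B. phi (z y)) = (\<Sum>y\<in>B \<inter> I. phi (z y)) + (\<Sum>y\<in>B - I. phi (z y))"
      by (rule sum_split) auto
    then show ?thesis unfolding sumBI B using zab by simp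
  qed
  have sumV: "(\<Sum>y\<in>V. phi (z y)) = k * phi N.s + phi xi + phi eta + g * phi u + h * phi v"
    for phi :: "real \<Rightarrow> real"
  proof -
    have "(\<Sum>y\<in>V. phi (z y)) = (\<Sum>y\<in>A \<union> B. phi (z y)) + (\<Sum>y\<in>Q. phi (z y))"
      using sub unfolding Q_def by (intro sum_split) auto
    moreover have "(\<Sum>y\<in>A \<union> B. phi (z y)) = (\<Sum>y\<in>A. phi (z y)) + (\<Sum>y\<in>B. phi (z y))"
      using disj by (intro sum_split) auto
    moreover have "(\<Sum>y\<in>Q. phi (z y)) = card Q * phi N.s" by (rule sum_const_comp) (rule zQ)
    ultimately show ?thesis unfolding sumA sumB gd using cQ by (simp add: algebra_simps)
  qed
  have sV: "sum z V = 1" using sumV[of "\<lambda>x. x"] N.total N.s(3) by simp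
  have gain: "gain lam z = 1 + 2 * (d * u * (xi - eta))"
    unfolding gain_def sV sumV[of "\<lambda>x. x\<^sup>2"] sumI[of "\<lambda>x. x\<^sup>2"] sumI[of "\<lambda>x. x"]
      sumA[of "\<lambda>x. x"] sumB[of "\<lambda>x. x"] sumAI[of "\<lambda>x. x"] sumBI[of "\<lambda>x. x"]
    using N.unbalanced_gain[OF gd] by (simp add: algebra_simps)
  have "xi \<ge> eta" using N.eta_le_xi gh by simp
  then have g1: "gain lam z \<ge> 1" unfolding gain using N.pos by simp
  show "r \<ge> lam - 1" using gain_ge[OF zpos g1] .
  assume r: "r = lam - 1"
  note eq = gain_equality[OF zpos g1 sV r]
  \<comment> \<open>The gain may vanish although \<open>d > 0\<close>; but then the test vector would be an eigenvector,
    which fails in row \<open>a\<close>.\<close>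
  have "eigen_on V (cut_matrix A B I) r z"
    using eq(2,3) unfolding eigen_on_def by simp
  from eigen_on_cut_matrix_row[OF fin this aA(3)]
  have row: "lam * xi = 1 + sum z {v \<in> V. v \<noteq> a \<and> cut_nonadj A B I a v}" using zab sV r by simp
  have "{v \<in> V. v \<noteq> a \<and> cut_nonadj A B I a v} = B" using aA sub disj unfolding cut_nonadj_def by auto
  then have "lam * xi = 1 + (d * u + h * v + eta)" using row sumB[of "\<lambda>x. x"] by simp
  then have "d * u = 0" using N.eq_xi by simp
  then have "d = 0" using N.pos by simp
  then show "card (A \<inter> I) = g \<and> (\<forall>u\<in>V. \<forall>v\<in>V. D u v = cut_matrix A B I u v)"
    using eq(3) iA unfolding d_def by auto
qed

text \<open>The members of \<open>I\<close> outside both sides receive the \<open>x\<close> entries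
  \<open>u\<close> and \<open>y\<close> entries \<open>v\<close> missing from \<open>A\<close> and
  \<open>B\<close>, and the surplus vertices of the sides receive \<open>s\<close>. In the second
  alternative of \<open>cond\<close> the side \<open>A\<close> may miss \<open>I\<close>; its loss
  of less than \<open>2 * s^2\<close> is covered by \<open>x * y * s^2\<close>.\<close>

lemma layout_moved:
  assumes nums: "two_pendant_numbers (real k) (real g) (real h) lam xi eta u v"
    and A: "card (A - I) = x + 1" and B: "card (B - I) = y + 1"
    and g: "g = card (A \<inter> I) + x" and h: "h = card (B \<inter> I) + y"
    and J: "card (I - (A \<union> B)) = x + y" and cV: "card V = k + 2 + g + h"
    and xy: "x + y \<ge> 1"
    and cond: "((y = 0 \<or> A \<inter> I \<noteq> {}) \<and> (x = 0 \<or> B \<inter> I \<noteq> {})) \<or> (B \<inter> I \<noteq> {} \<and> y = 1 \<and> x \<ge> 2)"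
  shows "r > lam - 1"
proof -
  interpret N: two_pendant_numbers "real k" "real g" "real h" lam xi eta u v by fact
  note finite_sub[simp] fin[simp]
  obtain a where "a \<in> A - I" using A by (metis Suc_eq_plus1 card.empty ex_in_conv nat.simps(3))
  moreover obtain b where "b \<in> B - I" using B by (metis Suc_eq_plus1 card.empty ex_in_conv nat.simps(3))
  ultimately have aA: "a \<in> A" "a \<notin> I" "a \<in> V" "a \<notin> B" and bB: "b \<in> B" "b \<notin> I" "b \<in> V" "b \<notin> A"
    using sub disj by auto
  then have ab: "a \<noteq> b" by auto
  obtain X where X: "X \<subseteq> I - (A \<union> B)" "card X = x"
    using J by (metis le_add1 obtain_subset_with_card_n)
  define Y where "Y = I - (A \<union> B) - X"
  have [simp]: "finite X" "finite Y" using X(1) unfolding Y_def by (auto intro: finite_subset)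
  have cY: "card Y = y" unfolding Y_def using X J by (simp add: card_Diff_subset)
  define Q where "Q = V - I - {a, b}"
  have cI: "card I = g + h"
  proof -
    have "card I = card ((A \<union> B) \<inter> I) + card (I - (A \<union> B))" by (rule card_split) auto
    moreover have "card ((A \<union> B) \<inter> I) = card (A \<inter> I) + card (B \<inter> I)" using disj by (intro card_split) auto
    ultimately show ?thesis using J g h by simp
  qed
  have cQ: "card Q = k"
  proof -
    have "card V = card I + card (V - I)" using sub by (intro card_split) auto
    moreover have "card (V - I) = card {a, b} + card Q" using aA bB unfolding Q_def by (intro card_split) auto
    ultimately show ?thesis using cV cI ab by simp
  qed
  define z where "z = (\<lambda>y. if y = a then xi else if y = b then eta else if y \<in> (A \<inter> I) \<union> X then u
     else if y \<in> I then v else N.s)"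
  have zA: "z y = u" if "y \<in> A \<inter> I" for y using that aA bB unfolding z_def by auto
  have zX: "z y = u" if "y \<in> X" for y using that aA bB X unfolding z_def by auto
  have zB: "z y = v" if "y \<in> B \<inter> I" for y using that aA bB disj X unfolding z_def by auto
  have zY: "z y = v" if "y \<in> Y" for y using that aA bB disj X unfolding z_def Y_def by auto
  have zab: "z a = xi" "z b = eta" using ab unfolding z_def by auto
  have zQ: "z y = N.s" if "y \<in> Q" for y using that aA bB X unfolding z_def Q_def by auto
  have zpos: "z y > 0" for y unfolding z_def using N.pos N.s by auto
  have sumAI: "(\<Sum>y\<in>A \<inter> I. phi (z y)) = card (A \<inter> I) * phi u" for phi :: "real \<Rightarrow> real"
    by (rule sum_const_comp) (rule zA)
  have sumBI: "(\<Sum>y\<in>B \<inter> I. phi (z y)) = card (B \<inter> I) * phi v" for phi :: "real \<Rightarrow> real"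
    by (rule sum_const_comp) (rule zB)
  have sumI: "(\<Sum>y\<in>I. phi (z y)) = g * phi u + h * phi v" for phi :: "real \<Rightarrow> real"
  proof -
    have "(\<Sum>y\<in>I. phi (z y)) = (\<Sum>y\<in>(A \<union> B) \<inter> I. phi (z y)) + (\<Sum>y\<in>I - (A \<union> B). phi (z y))"
      by (rule sum_split) auto
    moreover have "(\<Sum>y\<in>(A \<union> B) \<inter> I. phi (z y)) = (\<Sum>y\<in>A \<inter> I. phi (z y)) + (\<Sum>y\<in>B \<inter> I. phi (z y))"
      using disj by (intro sum_split) auto
    moreover have "(\<Sum>y\<in>I - (A \<union> B). phi (z y)) = (\<Sum>y\<in>X. phi (z y)) + (\<Sum>y\<in>Y. phi (z y))"
      using X unfolding Y_def by (intro sum_split) auto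
    moreover have "(\<Sum>y\<in>X. phi (z y)) = card X * phi u" by (rule sum_const_comp) (rule zX)
    moreover have "(\<Sum>y\<in>Y. phi (z y)) = card Y * phi v" by (rule sum_const_comp) (rule zY)
    ultimately show ?thesis unfolding sumAI sumBI g h using X cY by (simp add: algebra_simps)
  qed
  have sA: "sum z A = card (A \<inter> I) * u + xi + x * N.s"
  proof -
    have "sum z A = sum z (A \<inter> I) + sum z (A - I)" by (rule sum_split) auto
    moreover have "sum z (A - I) = z a + sum z (A - I - {a})" using aA by (intro sum.remove) auto
    moreover have "sum z (A - I - {a}) = card (A - I - {a}) * N.s"
      using zQ bB sub by (intro sum_constant_on) (auto simp: Q_def)
    ultimately show ?thesis using sumAI[of "\<lambda>x. x"] zab A aA by simp
  qed
  have sB: "sum z B = card (B \<inter> I) * v + eta + y * N.s"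
  proof -
    have "sum z B = sum z (B \<inter> I) + sum z (B - I)" by (rule sum_split) auto
    moreover have "sum z (B - I) = z b + sum z (B - I - {b})" using bB by (intro sum.remove) auto
    moreover have "sum z (B - I - {b}) = card (B - I - {b}) * N.s"
      using zQ aA sub by (intro sum_constant_on) (auto simp: Q_def)
    ultimately show ?thesis using sumBI[of "\<lambda>x. x"] zab B bB by simp
  qed
  have sumV: "(\<Sum>y\<in>V. phi (z y)) = k * phi N.s + phi xi + phi eta + g * phi u + h * phi v"
    for phi :: "real \<Rightarrow> real"
  proof -
    have "(\<Sum>y\<in>V. phi (z y)) = (\<Sum>y\<in>I. phi (z y)) + (\<Sum>y\<in>V - I. phi (z y))"
      using sub by (intro sum_split) auto
    moreover have "(\<Sum>y\<in>V - I. phi (z y)) = (\<Sum>y\<in>{a, b}. phi (z y)) + (\<Sum>y\<in>Q. phi (z y))"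
      using aA bB unfolding Q_def by (intro sum_split) auto
    moreover have "(\<Sum>y\<in>Q. phi (z y)) = card Q * phi N.s" by (rule sum_const_comp) (rule zQ)
    ultimately show ?thesis unfolding sumI using cQ zab ab by simp
  qed
  have sV: "sum z V = 1" using sumV[of "\<lambda>x. x"] N.total N.s(3) by simp
  define iA iB where "iA = real (card (A \<inter> I))" and "iB = real (card (B \<inter> I))"
  have gr: "real g = iA + real x" "real h = iB + real y" using g h unfolding iA_def iB_def by auto
  define GA where "GA = N.s * iA * u + N.s * xi - xi * v"
  define GB where "GB = N.s * iB * v + N.s * eta - eta * u"
  have gain: "gain lam z = 1 + 2 * (y * GA + x * GB + x * y * N.s\<^sup>2)"
    unfolding gain_def sV sumV[of "\<lambda>x. x\<^sup>2"] sumI[of "\<lambda>x. x\<^sup>2"] sumI[of "\<lambda>x. x"]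
      sA sB sumAI[of "\<lambda>x. x"] sumBI[of "\<lambda>x. x"]
    using N.layout_gain[OF gr] unfolding GA_def GB_def iA_def iB_def by (simp add: algebra_simps)
  have GApos: "GA > 0" if "A \<inter> I \<noteq> {}"
  proof -
    have "iA \<ge> 1" unfolding iA_def using that by (simp add: Suc_leI card_gt_0_iff)
    then show ?thesis unfolding GA_def by (rule N.move_gain_positive)
  qed
  have GBpos: "GB > 0" if "B \<inter> I \<noteq> {}"
  proof -
    have "iB \<ge> 1" unfolding iB_def using that by (simp add: Suc_leI card_gt_0_iff)
    then show ?thesis unfolding GB_def by (rule N.move_gain_positive)
  qed
  have "y * GA + x * GB + x * y * N.s\<^sup>2 > 0"
    using cond
  proof
    assume c: "(y = 0 \<or> A \<inter> I \<noteq> {}) \<and> (x = 0 \<or> B \<inter> I \<noteq> {})"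
    then have "y = 0 \<or> GA > 0" "x = 0 \<or> GB > 0" using GApos GBpos by blast+
    then have "y * GA \<ge> 0" "x * GB \<ge> 0" "y * GA > 0 \<or> x * GB > 0"
      using xy by (cases "y = 0"; cases "x = 0"; auto)+
    moreover have "x * y * N.s\<^sup>2 \<ge> 0" by simp
    ultimately show ?thesis by linarith
  next
    assume c: "B \<inter> I \<noteq> {} \<and> y = 1 \<and> x \<ge> 2"
    have "N.s * iA * u \<ge> 0" unfolding iA_def using N.s N.pos by simp
    then have "GA > - 2 * N.s\<^sup>2" unfolding GA_def using N.move_gain_lower by linarith
    moreover have "x * GB > 0" using c GBpos by simp
    moreover have "2 * N.s\<^sup>2 \<le> x * N.s\<^sup>2" using c by (intro mult_right_mono) auto
    ultimately show ?thesis using c by simp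
  qed
  then have "gain lam z > 1" unfolding gain by simp
  then show ?thesis using gain_greater zpos less_imp_le by blast
qed

text \<open>Up to exchanging the sides, their sizes and their intersections with \<open>I\<close>
  select the test vector. If no side has two vertices or at least four, both have three, and
  \<open>b0 + be = 4\<close>.\<close>

lemma pendant_pair_bound:
  assumes nums: "pendant_pair_numbers (real k) (real b0) (real be) lam t p q"
    and cards: "card I = be + 1" "card (A \<union> B) = b0 + be + 2" "card V = k + card (A \<union> B)"
    and b0: "b0 \<ge> 2" and ne: "A - I \<noteq> {}" "B - I \<noteq> {}" and AB2: "card A \<ge> 2" "card B \<ge> 2"
  shows "r \<ge> lam - 1"
    and "r = lam - 1 \<Longrightarrow> I \<subseteq> A \<union> B \<and> (\<forall>u\<in>V. \<forall>v\<in>V. D u v = cut_matrix A B I u v) \<and>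
      (card A = 2 \<and> card (A \<inter> I) = 1 \<or> card B = 2 \<and> card (B \<inter> I) = 1)"
proof -
  interpret S: cut_config V B A I D r by (rule swap)
  define iA iB nA nB where "iA = card (A \<inter> I)" and "iB = card (B \<inter> I)"
    and "nA = card (A - I)" and "nB = card (B - I)"
  have c: "card A = iA + nA" "card B = iB + nB"
    unfolding iA_def iB_def nA_def nB_def using finite_sub by (auto intro!: card_split)
  have cAB: "card A + card B = b0 + be + 2"
    using card_Un_disjoint[of A B] finite_sub disj cards by simp
  have "card ((A \<inter> I) \<union> (B \<inter> I)) = iA + iB"
    unfolding iA_def iB_def using finite_sub disj by (intro card_Un_disjoint) auto
  moreover have "card ((A \<inter> I) \<union> (B \<inter> I)) \<le> card I" using finite_sub by (intro card_mono) auto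
  ultimately have cI: "iA + iB \<le> be + 1" using cards by simp
  have n: "nA \<ge> 1" "nB \<ge> 1" unfolding nA_def nB_def using ne finite_sub
    by (auto simp: Suc_le_eq card_gt_0_iff)
  have zero: "iA \<ge> 1 \<longleftrightarrow> A \<inter> I \<noteq> {}" "iB \<ge> 1 \<longleftrightarrow> B \<inter> I \<noteq> {}"
    unfolding iA_def iB_def using finite_sub by (auto simp: Suc_le_eq card_gt_0_iff)
  have cards': "card (B \<union> A) = b0 + be + 2" "card V = k + card (B \<union> A)"
    using cards by (simp_all add: Un_commute)
  define concl where "concl \<longleftrightarrow> r \<ge> lam - 1 \<and> (r = lam - 1 \<longrightarrow> I \<subseteq> A \<union> B \<and>
      (\<forall>u\<in>V. \<forall>v\<in>V. D u v = cut_matrix A B I u v) \<and>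
      (card A = 2 \<and> card (A \<inter> I) = 1 \<or> card B = 2 \<and> card (B \<inter> I) = 1))"
  have cases: "iA \<ge> 1 \<and> nB \<ge> 2 \<and> (nA = 1 \<or> card B \<ge> 4 \<or> b0 + be = 4 \<and> iB \<ge> 1)
    \<or> iB \<ge> 1 \<and> nA \<ge> 2 \<and> (nB = 1 \<or> card A \<ge> 4 \<or> b0 + be = 4 \<and> iA \<ge> 1)
    \<or> \<not> iA \<ge> 1 \<and> (card A = 2 \<or> card B \<ge> 4 \<or> b0 + be = 4 \<and> card B \<ge> 3)
    \<or> \<not> iB \<ge> 1 \<and> (card B = 2 \<or> card A \<ge> 4 \<or> b0 + be = 4 \<and> card A \<ge> 3)"
  proof -
    have size: "card A = 2 \<or> card B = 2 \<or> card A \<ge> 4 \<or> card B \<ge> 4 \<or> card A = 3 \<and> card B = 3 \<and> b0 + be = 4"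
      using AB2 cAB by linarith
    \<comment> \<open>The sides contain at least \<open>b0 + 1 >= 3\<close> vertices outside
      \<open>I\<close>; this is where \<open>b0 >= 2\<close> decides.\<close>
    have nn: "nA \<ge> 2 \<or> nB \<ge> 2" using c cAB cI b0 by linarith
    consider "\<not> iA \<ge> 1" "\<not> iB \<ge> 1" | "iA \<ge> 1" "\<not> iB \<ge> 1" | "\<not> iA \<ge> 1" "iB \<ge> 1" | "iA \<ge> 1" "iB \<ge> 1"
      by blast
    then show ?thesis
    proof cases
      case 1
      then show ?thesis using size by auto
    next
      case 2
      then have "nB \<ge> 2" "card A = 2 \<Longrightarrow> nA = 1" using c AB2 n by linarith+
      then show ?thesis using 2 size by auto
    next
      case 3
      then have "nA \<ge> 2" "card B = 2 \<Longrightarrow> nB = 1" using c AB2 n by linarith+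
      then show ?thesis using 3 size by auto
    next
      case 4
      then have "card A = 2 \<Longrightarrow> nA = 1" "card B = 2 \<Longrightarrow> nB = 1" "nA = 1 \<or> nA \<ge> 2" "nB = 1 \<or> nB \<ge> 2"
        using c AB2 n by linarith+
      then show ?thesis using 4 size nn by auto
    qed
  qed
  from cases consider
      "iA \<ge> 1" "nB \<ge> 2" "nA = 1 \<or> card B \<ge> 4 \<or> b0 + be = 4 \<and> iB \<ge> 1"
    | "iB \<ge> 1" "nA \<ge> 2" "nB = 1 \<or> card A \<ge> 4 \<or> b0 + be = 4 \<and> iA \<ge> 1"
    | "\<not> iA \<ge> 1" "card A = 2 \<or> card B \<ge> 4 \<or> b0 + be = 4 \<and> card B \<ge> 3"
    | "\<not> iB \<ge> 1" "card B = 2 \<or> card A \<ge> 4 \<or> b0 + be = 4 \<and> card A \<ge> 3"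
    by blast
  then have concl
  proof cases
    case 1
    have "A \<inter> I \<noteq> {}" "card (B - I) \<ge> 2"
      "card (A - I) = 1 \<or> card B \<ge> 4 \<or> b0 + be = 4 \<and> B \<inter> I \<noteq> {}"
      using 1 zero unfolding nA_def nB_def by auto
    from layout_mixed[OF nums cards b0 this(1) ne(1) this(2,3)] show ?thesis unfolding concl_def by blast
  next
    case 2
    have "B \<inter> I \<noteq> {}" "card (A - I) \<ge> 2"
      "card (B - I) = 1 \<or> card A \<ge> 4 \<or> b0 + be = 4 \<and> A \<inter> I \<noteq> {}"
      using 2 zero unfolding nA_def nB_def by auto
    from S.layout_mixed[OF nums cards(1) cards' b0 this(1) ne(2) this(2,3)] show ?thesis
      unfolding concl_def cut_matrix_swap[of B A I] by blast
  next
    case 3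
    have "A \<inter> I = {}" using 3(1) zero by auto
    from layout_split[OF nums cards this AB2(1) 3(2)] show ?thesis unfolding concl_def by simp
  next
    case 4
    have "B \<inter> I = {}" using 4(1) zero by auto
    from S.layout_split[OF nums cards(1) cards' this AB2(2) 4(2)] show ?thesis unfolding concl_def by simp
  qed
  then show "r \<ge> lam - 1" "r = lam - 1 \<Longrightarrow> I \<subseteq> A \<union> B \<and> (\<forall>u\<in>V. \<forall>v\<in>V. D u v = cut_matrix A B I u v) \<and>
      (card A = 2 \<and> card (A \<inter> I) = 1 \<or> card B = 2 \<and> card (B \<inter> I) = 1)"
    unfolding concl_def by auto
qed

text \<open>As \<open>h <= g + 1\<close>, the two sides cannot both have more than \<open>g\<close>
  members of \<open>I\<close>; the side with at most \<open>g\<close> takes the part of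
  \<open>A\<close> in \<open>layout_unbalanced\<close>.\<close>

lemma two_pendant_bound_inside:
  assumes nums: "two_pendant_numbers (real k) (real g) (real h) lam xi eta u v"
    and gh: "g \<le> h" "h \<le> Suc g" and IAB: "I \<subseteq> A \<union> B" and A: "A - I = {a}" and B: "B - I = {b}"
    and iAB: "card (A \<inter> I) + card (B \<inter> I) = g + h" and cV: "card V = k + 2 + g + h"
  shows "r \<ge> lam - 1"
    and "r = lam - 1 \<Longrightarrow> (card (A \<inter> I) = g \<or> card (B \<inter> I) = g) \<and>
      (\<forall>u\<in>V. \<forall>v\<in>V. D u v = cut_matrix A B I u v)"
proof -
  interpret S: cut_config V B A I D r by (rule swap)
  have IBA: "I \<subseteq> B \<union> A" and iBA: "card (B \<inter> I) + card (A \<inter> I) = g + h"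
    using IAB iAB by auto
  consider "card (A \<inter> I) \<le> g" | "card (B \<inter> I) \<le> g" using iAB gh by linarith
  then have "r \<ge> lam - 1 \<and> (r = lam - 1 \<longrightarrow> (card (A \<inter> I) = g \<or> card (B \<inter> I) = g) \<and>
      (\<forall>u\<in>V. \<forall>v\<in>V. D u v = cut_matrix A B I u v))"
  proof cases
    case 1
    from layout_unbalanced[OF nums gh(1) IAB A B 1 iAB cV] show ?thesis by blast
  next
    case 2
    from S.layout_unbalanced[OF nums gh(1) IBA B A 2 iBA cV] show ?thesis
      unfolding cut_matrix_swap[of B A I] by blast
  qed
  then show "r \<ge> lam - 1" "r = lam - 1 \<Longrightarrow> (card (A \<inter> I) = g \<or> card (B \<inter> I) = g) \<and>
      (\<forall>u\<in>V. \<forall>v\<in>V. D u v = cut_matrix A B I u v)" by auto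
qed

end

text \<open>Balancing minimises: any other split of the leaves has at least the spectral radius of
  the balanced one. The intermediate matrix lives on the same vertex set, with an arbitrary centre
  chosen in each side and all other vertices of the sides put into \<open>I\<close>; the bound for
  \<open>I\<close> inside the sides is applied to that matrix itself.\<close>

lemma intermediate_numbers:
  assumes fin: "finite V" and nums: "two_pendant_numbers (real k) (real g) (real h) lam xi eta u v"
    and gh: "g \<le> h" "h \<le> Suc g" and sub: "A \<subseteq> V" "B \<subseteq> V" and disj: "A \<inter> B = {}"
    and cards: "card A = g' + 1" "card B = h' + 1" "g' + h' = g + h" "card V = k + 2 + g + h"
    and pos: "g' \<ge> 1" "h' \<ge> 1" "k \<ge> 1"
  shows "\<exists>lam' xi' eta' u' v'. lam \<le> lam' \<and>
    two_pendant_numbers (real k) (real g') (real h') lam' xi' eta' u' v'"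
proof -
  have f: "finite A" "finite B" using fin sub by (auto intro: finite_subset)
  obtain a where a: "a \<in> A" using cards by (metis Suc_eq_plus1 card.empty ex_in_conv nat.simps(3))
  obtain b where b: "b \<in> B" using cards by (metis Suc_eq_plus1 card.empty ex_in_conv nat.simps(3))
  define I where "I = A \<union> B - {a, b}"
  have ne: "V \<noteq> {}" using a sub by auto
  have "\<exists>r. top_eigenvalue V (cut_matrix A B I) r"
    by (rule top_eigenvalue_exists[OF fin ne]) (rule cut_matrix_sym)
  then obtain r where r: "top_eigenvalue V (cut_matrix A B I) r" ..
  have conf: "cut_config V A B I (cut_matrix A B I) r"
    using fin ne sub disj r by unfold_locales (auto simp: I_def cut_matrix_sym)
  have I: "I \<subseteq> A \<union> B" "A - I = {a}" "B - I = {b}" "A \<inter> I = A - {a}" "B \<inter> I = B - {b}"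
    using a b disj unfolding I_def by auto
  have c: "card (A \<inter> I) = g'" "card (B \<inter> I) = h'" unfolding I using a b f cards by auto
  have "r \<ge> lam - 1"
    using cut_config.two_pendant_bound_inside(1)[OF conf nums gh I(1-3)] c cards by simp
  moreover have "\<exists>xi eta u v. two_pendant_numbers (real k) (real g') (real h') (r + 1) xi eta u v"
    using two_pendant_numbers_exist[OF conf I(1-3) c _ pos] cards by simp
  ultimately show ?thesis by (metis diff_le_eq)
qed

text \<open>When \<open>I\<close> leaves the sides, an intermediate matrix is beaten strictly: one
  with the same side sizes through \<open>layout_moved\<close>, or one with a side of two vertices
  through \<open>layout_split\<close>. Equality is thus confined to \<open>I\<close> inside the
  sides.\<close>

lemma (in cut_config) two_pendant_bound:
  assumes nums: "two_pendant_numbers (real k) (real g) (real h) lam xi eta u v"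
    and gh: "g \<le> h" "h \<le> Suc g"
    and cards: "card I = g + h" "card (A \<union> B) = g + h + 2" "card V = k + 2 + g + h"
    and pos: "g \<ge> 1" "k \<ge> 1" and ne: "A - I \<noteq> {}" "B - I \<noteq> {}" and AB2: "card A \<ge> 2" "card B \<ge> 2"
  shows "r \<ge> lam - 1"
    and "r = lam - 1 \<Longrightarrow> I \<subseteq> A \<union> B \<and> card (A - I) = 1 \<and> card (B - I) = 1 \<and>
      (card (A \<inter> I) = g \<or> card (B \<inter> I) = g) \<and> (\<forall>u\<in>V. \<forall>v\<in>V. D u v = cut_matrix A B I u v)"
proof -
  interpret S: cut_config V B A I D r by (rule swap)
  define iA iB nA nB j where "iA = card (A \<inter> I)" and "iB = card (B \<inter> I)"
    and "nA = card (A - I)" and "nB = card (B - I)" and "j = card (I - (A \<union> B))"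
  have c: "card A = iA + nA" "card B = iB + nB"
    unfolding iA_def iB_def nA_def nB_def using finite_sub by (auto intro!: card_split)
  have cAB: "card A + card B = g + h + 2"
    using card_Un_disjoint[of A B] finite_sub disj cards by simp
  have "card ((A \<inter> I) \<union> (B \<inter> I)) = iA + iB"
    unfolding iA_def iB_def using finite_sub disj by (intro card_Un_disjoint) auto
  moreover have "card I = card ((A \<inter> I) \<union> (B \<inter> I)) + j"
    unfolding j_def using finite_sub by (intro card_split) auto
  ultimately have cI: "iA + iB + j = g + h" using cards by simp
  have n: "nA \<ge> 1" "nB \<ge> 1" unfolding nA_def nB_def using ne finite_sub
    by (auto simp: Suc_le_eq card_gt_0_iff)
  have zero: "iA \<ge> 1 \<longleftrightarrow> A \<inter> I \<noteq> {}" "iB \<ge> 1 \<longleftrightarrow> B \<inter> I \<noteq> {}"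
    unfolding iA_def iB_def using finite_sub by (auto simp: Suc_le_eq card_gt_0_iff)
  have cBA: "card (B \<union> A) = g + h + 2" using cards by (simp add: Un_commute)
  have jj: "nA + nB = j + 2" using c cAB cI by simp
  define concl where "concl \<longleftrightarrow> r \<ge> lam - 1 \<and> (r = lam - 1 \<longrightarrow> I \<subseteq> A \<union> B \<and>
      card (A - I) = 1 \<and> card (B - I) = 1 \<and> (card (A \<inter> I) = g \<or> card (B \<inter> I) = g) \<and>
      (\<forall>u\<in>V. \<forall>v\<in>V. D u v = cut_matrix A B I u v))"
  have strict: concl if "r > lam' - 1" "lam \<le> lam'" for lam'
    using that unfolding concl_def by simp
  have moved: concl if j: "j \<ge> 1"
    and cond: "((nB = 1 \<or> iA \<ge> 1) \<and> (nA = 1 \<or> iB \<ge> 1)) \<or> (iB \<ge> 1 \<and> nB = 2 \<and> nA \<ge> 3)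
       \<or> (iA \<ge> 1 \<and> nA = 2 \<and> nB \<ge> 3)"
  proof -
    have ca: "card A = (card A - 1) + 1" "card B = (card B - 1) + 1" "(card A - 1) + (card B - 1) = g + h"
      "card A - 1 \<ge> 1" "card B - 1 \<ge> 1" using AB2 cAB by auto
    obtain lam' xi' eta' u' v' where L: "lam \<le> lam'"
      "two_pendant_numbers (real k) (real (card A - 1)) (real (card B - 1)) lam' xi' eta' u' v'"
      using intermediate_numbers[OF fin nums gh sub(1,2) disj ca(1,2,3) cards(3) ca(4,5) pos(2)] by blast
    have ca': "card B = (card B - 1) + 1" "card A = (card A - 1) + 1" "(card B - 1) + (card A - 1) = g + h"
      using ca by auto
    \<comment> \<open>The same sizes in exchanged order, for applying \<open>layout_moved\<close> in
      the swapped configuration.\<close>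
    obtain lam2 xi2 eta2 u2 v2 where L2: "lam \<le> lam2"
      "two_pendant_numbers (real k) (real (card B - 1)) (real (card A - 1)) lam2 xi2 eta2 u2 v2"
      using intermediate_numbers[OF fin nums gh sub(2,1) _ ca'(1,2,3) cards(3) ca(5,4) pos(2)] disj by blast
    have x: "card (A - I) = (nA - 1) + 1" "card (B - I) = (nB - 1) + 1"
      "card A - 1 = card (A \<inter> I) + (nA - 1)" "card B - 1 = card (B \<inter> I) + (nB - 1)"
      "card (I - (A \<union> B)) = (nA - 1) + (nB - 1)" "card V = k + 2 + (card A - 1) + (card B - 1)"
      "(nA - 1) + (nB - 1) \<ge> 1"
      using n c jj j cards ca unfolding iA_def[symmetric] iB_def[symmetric] nA_def[symmetric] nB_def[symmetric] j_def[symmetric] by auto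
    have y: "card (I - (B \<union> A)) = (nB - 1) + (nA - 1)" "card V = k + 2 + (card B - 1) + (card A - 1)"
      "(nB - 1) + (nA - 1) \<ge> 1"
      using x by (simp_all add: Un_commute)
    consider "((nB - 1 = 0 \<or> A \<inter> I \<noteq> {}) \<and> (nA - 1 = 0 \<or> B \<inter> I \<noteq> {})) \<or> (B \<inter> I \<noteq> {} \<and> nB - 1 = 1 \<and> nA - 1 \<ge> 2)"
      | "((nA - 1 = 0 \<or> B \<inter> I \<noteq> {}) \<and> (nB - 1 = 0 \<or> A \<inter> I \<noteq> {})) \<or> (A \<inter> I \<noteq> {} \<and> nA - 1 = 1 \<and> nB - 1 \<ge> 2)"
      using cond n unfolding zero by force
    then show concl
    proof cases
      case 1
      from layout_moved[OF L(2) x 1] L(1) show ?thesis by (rule strict)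
    next
      case 2
      from S.layout_moved[OF L2(2) x(2,1,4,3) y 2] L2(1) show ?thesis by (rule strict)
    qed
  qed
  have split: concl
    if "\<not> iA \<ge> 1 \<and> (card A = 2 \<or> card B \<ge> 4 \<or> g + h = 4 \<and> card B \<ge> 3) \<or>
        \<not> iB \<ge> 1 \<and> (card B = 2 \<or> card A \<ge> 4 \<or> g + h = 4 \<and> card A \<ge> 3)"
  proof -
    \<comment> \<open>Any two vertices serve, whatever side they come from: the intermediate numbers
      depend on cardinalities only, here 2 and \<open>g + h\<close>.\<close>
    obtain A' where A': "A' \<subseteq> A \<union> B" "card A' = 2"
      using cards by (metis le_add2 obtain_subset_with_card_n)
    define B' where "B' = A \<union> B - A'"
    have "finite A'" using A'(1) finite_sub by (auto intro: finite_subset)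
    then have cB': "card B' = g + h" unfolding B'_def using A' cards by (simp add: card_Diff_subset)
    have sub': "A' \<subseteq> V" "B' \<subseteq> V" "A' \<inter> B' = {}" using A' sub unfolding B'_def by auto
    have h1: "g + h - 1 \<ge> 1" "1 + (g + h - 1) = g + h" "card A' = 1 + 1" "card B' = (g + h - 1) + 1"
      using pos gh A' cB' by auto
    obtain lam' xi' eta' u' v' where L: "lam \<le> lam'"
      "two_pendant_numbers (real k) (real 1) (real (g + h - 1)) lam' xi' eta' u' v'"
      using intermediate_numbers[OF fin nums gh sub' h1(3,4,2) cards(3) _ h1(1) pos(2)] by auto
    have P: "pendant_pair_numbers (real k) (real 1) (real (g + h - 1)) lam' xi' eta' v'"
      using two_pendant_numbers.pendant_pair_numbers(2)[OF L(2)] by simp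
    have cc: "card I = (g + h - 1) + 1" "card (A \<union> B) = 1 + (g + h - 1) + 2"
      "card V = k + card (A \<union> B)" "card (B \<union> A) = 1 + (g + h - 1) + 2" "card V = k + card (B \<union> A)"
      "1 + (g + h - 1) = g + h"
      using cards cBA h1 by auto
    from that show ?thesis
    proof
      assume a: "\<not> iA \<ge> 1 \<and> (card A = 2 \<or> card B \<ge> 4 \<or> g + h = 4 \<and> card B \<ge> 3)"
      then have "A \<inter> I = {}" using zero by auto
      from layout_split[OF P cc(1-3) this AB2(1)] a L(1) show ?thesis
        unfolding cc(6) by (intro strict) auto
    next
      assume a: "\<not> iB \<ge> 1 \<and> (card B = 2 \<or> card A \<ge> 4 \<or> g + h = 4 \<and> card A \<ge> 3)"
      then have "B \<inter> I = {}" using zero by auto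
      from S.layout_split[OF P cc(1) cc(4,5) this AB2(2)] a L(1) show ?thesis
        unfolding cc(6) by (intro strict) auto
    qed
  qed
  have concl
  proof (cases "j = 0")
    case True
    then have n1: "nA = 1" "nB = 1" using jj n by auto
    then obtain a b where ab: "A - I = {a}" "B - I = {b}"
      unfolding nA_def nB_def by (meson card_1_singletonE)
    have IAB: "I \<subseteq> A \<union> B" using True finite_sub unfolding j_def by auto
    have i: "card (A \<inter> I) + card (B \<inter> I) = g + h" using cI True unfolding iA_def iB_def by simp
    from two_pendant_bound_inside[OF nums gh IAB ab i cards(3)] show ?thesis
      unfolding concl_def using IAB n1 nA_def nB_def by auto
  next
    case False
    then have "j \<ge> 1" by simp
    moreover have "((nB = 1 \<or> iA \<ge> 1) \<and> (nA = 1 \<or> iB \<ge> 1)) \<or> (iB \<ge> 1 \<and> nB = 2 \<and> nA \<ge> 3)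
       \<or> (iA \<ge> 1 \<and> nA = 2 \<and> nB \<ge> 3) \<or>
       (\<not> iA \<ge> 1 \<and> (card A = 2 \<or> card B \<ge> 4 \<or> g + h = 4 \<and> card B \<ge> 3) \<or>
        \<not> iB \<ge> 1 \<and> (card B = 2 \<or> card A \<ge> 4 \<or> g + h = 4 \<and> card A \<ge> 3))"
    proof (cases "iA \<ge> 1 \<longleftrightarrow> iB \<ge> 1")
      case True
      then consider "iA \<ge> 1" "iB \<ge> 1" | "\<not> iA \<ge> 1" "\<not> iB \<ge> 1" by blast
      then show ?thesis
      proof cases
        case 2
        \<comment> \<open>In the last case the sizes add up to 6, so \<open>g + h = 4\<close> and
          the exceptional clause applies.\<close>
        then consider "card A = 2" | "card B = 2" | "card A \<ge> 4" | "card B \<ge> 4" | "card A = 3" "card B = 3"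
          using AB2 by linarith
        then show ?thesis using 2 cAB by cases auto
      qed blast
    next
      case False
      then consider "\<not> iA \<ge> 1" "iB \<ge> 1" | "\<not> iB \<ge> 1" "iA \<ge> 1" by blast
      then show ?thesis
      proof cases
        case 1
        \<comment> \<open>A side \<open>B\<close> that meets \<open>I\<close> and has at most three
          vertices has at most two outside \<open>I\<close>; \<open>A\<close> misses
          \<open>I\<close>, so \<open>nA\<close> is its full size.\<close>
        then consider "nB = 1" | "card A = 2" | "card B \<ge> 4" | "nB = 2" "nA \<ge> 3"
          using AB2 n c by linarith
        then show ?thesis using 1 by cases blast+
      next
        case 2
        then consider "nA = 1" | "card B = 2" | "card A \<ge> 4" | "nA = 2" "nB \<ge> 3"
          using AB2 n c by linarith
        then show ?thesis using 2 by cases blast+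
      qed
    qed
    ultimately show ?thesis using moved split by blast
  qed
  then show "r \<ge> lam - 1" "r = lam - 1 \<Longrightarrow> I \<subseteq> A \<union> B \<and> card (A - I) = 1 \<and> card (B - I) = 1 \<and>
      (card (A \<inter> I) = g \<or> card (B \<inter> I) = g) \<and> (\<forall>u\<in>V. \<forall>v\<in>V. D u v = cut_matrix A B I u v)"
    unfolding concl_def by auto
qed

section \<open>Distances and isomorphisms\<close>

lemma graph_dist_self:
  assumes "u \<in> pverts G"
  shows "graph_dist G u u = 0"
  unfolding graph_dist_def
proof (rule Least_equality)
  show "\<exists>p. pre_digraph.apath (with_proj G) u p u \<and> length p = 0"
    using assms by (intro exI[of _ "[]"]) (simp add: pre_digraph.apath_def pre_digraph.awalk_def
      pre_digraph.cas.simps pre_digraph.awalk_verts.simps)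
qed simp

text \<open>The \<open>LEAST\<close> in \<open>graph_dist\<close> is attained only if a path exists.
  Connectedness provides one, because symmetric arcs make it strong connectedness.\<close>

lemma graph_dist_apath:
  assumes "pair_graph G" and "Digraph_Component.connected (with_proj G)"
    and "u \<in> pverts G" "v \<in> pverts G"
  obtains p where "pre_digraph.apath (with_proj G) u p v" "length p = graph_dist G u v"
proof -
  interpret pair_graph G by fact
  have "u \<rightarrow>\<^sup>*\<^bsub>with_proj G\<^esub> v"
    using symmetric_connected_imp_strongly_connected[OF _ assms(2)] assms(3,4) sym_arcs
    unfolding strongly_connected_def by simp
  then have "\<exists>l p. apath u p v \<and> length p = l" using reachable_apath by blast
  then have "\<exists>p. pre_digraph.apath (with_proj G) u p v \<and> length p = graph_dist G u v"
    unfolding graph_dist_def by (rule LeastI_ex)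
  then show ?thesis using that by blast
qed

lemma graph_dist_pos:
  assumes "pair_graph G" "Digraph_Component.connected (with_proj G)"
    and "u \<in> pverts G" "v \<in> pverts G" "u \<noteq> v"
  shows "graph_dist G u v \<ge> 1"
proof -
  interpret pair_graph G by fact
  obtain p where p: "apath u p v" "length p = graph_dist G u v"
    using graph_dist_apath[OF assms(1-4)] by blast
  have "p \<noteq> []" using p(1) assms(5) by (auto simp: apath_Nil_iff)
  then show ?thesis using p(2) by (cases p) auto
qed

lemma graph_dist_nonadjacent:
  assumes "pair_graph G" "Digraph_Component.connected (with_proj G)"
    and "u \<in> pverts G" "v \<in> pverts G" "u \<noteq> v" "(u, v) \<notin> parcs G"
  shows "graph_dist G u v \<ge> 2"
proof -
  interpret pair_graph G by fact
  obtain p where p: "apath u p v" "length p = graph_dist G u v"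
    using graph_dist_apath[OF assms(1-4)] by blast
  consider "p = []" | e where "p = [e]" | e e' p' where "p = e # e' # p'"
    by (metis list.exhaust)
  then show ?thesis
  proof cases
    case 1
    then show ?thesis using p(1) assms(5) by (simp add: apath_Nil_iff)
  next
    case 2
    then have "e = (u, v)" "e \<in> parcs G" using p(1) by (auto simp: apath_Cons_iff apath_Nil_iff)
    then show ?thesis using assms(6) by simp
  next
    case 3
    then show ?thesis using p(2) by simp
  qed
qed

lemma graph_dist_adjacent:
  assumes "pair_graph G" and "(u, v) \<in> parcs G"
  shows "graph_dist G u v = 1"
  unfolding graph_dist_def
proof (rule Least_equality)
  interpret pair_graph G by fact
  have uv: "u \<in> pverts G" "v \<in> pverts G" "u \<noteq> v"
    using in_arcsD1[OF assms(2)] in_arcsD2[OF assms(2)] pair_no_loops[OF assms(2)] by auto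
  then show "\<exists>p. pre_digraph.apath (with_proj G) u p v \<and> length p = 1"
    using assms(2) by (intro exI[of _ "[(u, v)]"]) (auto simp: apath_Cons_iff apath_Nil_iff)
  fix l assume "\<exists>p. pre_digraph.apath (with_proj G) u p v \<and> length p = l"
  then show "1 \<le> l" using uv by (cases l) (auto simp: apath_Nil_iff)
qed

lemma graph_dist_common_neighbour:
  assumes "pair_graph G" and "(u, w) \<in> parcs G" "(w, v) \<in> parcs G" "u \<noteq> v" "(u, v) \<notin> parcs G"
  shows "graph_dist G u v = 2"
  unfolding graph_dist_def
proof (rule Least_equality)
  interpret pair_graph G by fact
  have uv: "u \<in> pverts G" "v \<in> pverts G" "w \<in> pverts G" "u \<noteq> w" "w \<noteq> v"
    using in_arcsD1[OF assms(2)] in_arcsD2[OF assms(2)] pair_no_loops[OF assms(2)]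
      in_arcsD2[OF assms(3)] pair_no_loops[OF assms(3)] by auto
  then show "\<exists>p. pre_digraph.apath (with_proj G) u p v \<and> length p = 2"
    using assms by (intro exI[of _ "[(u, w), (w, v)]"]) (auto simp: apath_Cons_iff apath_Nil_iff)
  fix l assume "\<exists>p. pre_digraph.apath (with_proj G) u p v \<and> length p = l"
  then obtain p where p: "apath u p v" "length p = l" by blast
  show "2 \<le> l"
  proof (rule ccontr)
    assume "\<not> ?thesis"
    then consider "p = []" | e where "p = [e]" using p(2)
      by (metis One_nat_def length_0_conv length_Suc_conv less_2_cases not_le)
    then show False using p(1) assms by cases (auto simp: apath_Cons_iff apath_Nil_iff)
  qed
qed

lemma length_rev_path: "length (rev_path p) = length p"
  by (induct p) auto

lemma graph_dist_sym:
  assumes "pair_graph G"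
  shows "graph_dist G u v = graph_dist G v u"
proof -
  interpret pair_graph G by fact
  have "(\<exists>p. apath u p v \<and> length p = l) \<longleftrightarrow> (\<exists>p. apath v p u \<and> length p = l)" for l
    by (metis apath_rev_path length_rev_path)
  then show ?thesis unfolding graph_dist_def by simp
qed

lemma digraph_iso_apath:
  assumes "wf_digraph G" and f: "pre_digraph.digraph_isomorphism G f"
    and p: "pre_digraph.apath G u p v"
  shows "pre_digraph.apath (app_iso f G) (iso_verts f u) (map (iso_arcs f) p) (iso_verts f v)"
proof -
  interpret wf_digraph G by fact
  have aw: "awalk u p v" using p by (simp add: awalkI_apath)
  then have "set (awalk_verts u p) \<subseteq> verts G" by auto
  then have "inj_on (iso_verts f) (set (awalk_verts u p))"
    using digraph_isomorphism_inj_on_verts[OF f] by (rule inj_on_subset[rotated])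
  then show ?thesis
    using awalk_app_isoI[OF aw f] awalk_verts_app_iso_eq[OF f aw] p
    unfolding pre_digraph.apath_def by (simp add: distinct_map)
qed

lemma graph_dist_iso:
  assumes "pair_graph G" and f: "pre_digraph.digraph_isomorphism (with_proj G) f"
    and H: "with_proj H = app_iso f (with_proj G)" and uv: "u \<in> pverts G" "v \<in> pverts G"
  shows "graph_dist H (iso_verts f u) (iso_verts f v) = graph_dist G u v"
proof -
  interpret G: pair_graph G by fact
  let ?g = "pre_digraph.inv_iso (with_proj G) f"
  have wfG: "wf_digraph (with_proj G)" and wfH: "wf_digraph (with_proj H)"
    unfolding H by (rule G.wf_digraph_axioms G.wf_digraphI_app_iso[OF f])+
  have g: "pre_digraph.digraph_isomorphism (with_proj H) ?g"
    unfolding H by (rule G.digraph_isomorphism_invI[OF f])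
  have inverse: "app_iso ?g (with_proj H) = with_proj G" unfolding H by (rule G.app_iso_inv[OF f])
  have inv: "iso_verts ?g (iso_verts f w) = w" if "w \<in> pverts G" for w
    using G.iso_verts_inv_iso[OF f, of w] that by simp
  have "(\<exists>p. pre_digraph.apath (with_proj H) (iso_verts f u) p (iso_verts f v) \<and> length p = l) \<longleftrightarrow>
        (\<exists>p. pre_digraph.apath (with_proj G) u p v \<and> length p = l)" for l
  proof
    assume "\<exists>p. pre_digraph.apath (with_proj G) u p v \<and> length p = l"
    then show "\<exists>p. pre_digraph.apath (with_proj H) (iso_verts f u) p (iso_verts f v) \<and> length p = l"
      using digraph_iso_apath[OF wfG f] unfolding H[symmetric] by (metis length_map)
  next
    assume "\<exists>p. pre_digraph.apath (with_proj H) (iso_verts f u) p (iso_verts f v) \<and> length p = l"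
    then show "\<exists>p. pre_digraph.apath (with_proj G) u p v \<and> length p = l"
      using digraph_iso_apath[OF wfH g] inv[OF uv(1)] inv[OF uv(2)] unfolding inverse by (metis length_map)
  qed
  then show ?thesis unfolding graph_dist_def by simp
qed

section \<open>Isomorphism invariance of the distance spectral radius\<close>

lemma top_eigenvalue_unique:
  assumes "finite V" "top_eigenvalue V M r" "top_eigenvalue V M r'"
  shows "r = r'"
proof -
  have "a \<le> b" if a: "top_eigenvalue V M a" and b: "top_eigenvalue V M b" for a b
  proof -
    obtain z u where z: "u \<in> V" "z u \<noteq> 0" "eigen_on V M a z"
      using a unfolding top_eigenvalue_def by blast
    have "a * (\<Sum>u\<in>V. (z u)\<^sup>2) \<le> b * (\<Sum>u\<in>V. (z u)\<^sup>2)"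
      using b unfolding top_eigenvalue_def quad_form_eigen[OF z(3), symmetric] by blast
    moreover have "(\<Sum>u\<in>V. (z u)\<^sup>2) > 0" using assms(1) z by (intro sum_pos2[of _ u]) auto
    ultimately show ?thesis by simp
  qed
  then show ?thesis using assms antisym by blast
qed

lemma top_eigenvalue_reindex:
  assumes f: "bij_betw f V W" and M: "\<And>u v. u \<in> V \<Longrightarrow> v \<in> V \<Longrightarrow> M' (f u) (f v) = M u v"
    and top: "top_eigenvalue V M r"
  shows "top_eigenvalue W M' r"
proof -
  have re: "sum F W = (\<Sum>u\<in>V. F (f u))" for F :: "'b \<Rightarrow> real"
    using sum.reindex_bij_betw[OF f, of F] by simp
  obtain z w where z: "w \<in> V" "z w \<noteq> 0" "eigen_on V M r z" using top unfolding top_eigenvalue_def by blast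
  define g where "g = inv_into V f"
  have g: "g (f u) = u" if "u \<in> V" for u
    using f that unfolding g_def bij_betw_def by simp
  have "quad_form W M' x \<le> r * (\<Sum>u\<in>W. (x u)\<^sup>2)" for x
  proof -
    have "quad_form W M' x = quad_form V M (\<lambda>u. x (f u))"
      unfolding quad_form_def re using M by (intro sum.cong) auto
    then show ?thesis using top unfolding top_eigenvalue_def re by metis
  qed
  moreover have "eigen_on W M' r (\<lambda>y. z (g y))"
    unfolding eigen_on_def
  proof
    fix y assume "y \<in> W"
    then obtain u where u: "u \<in> V" "y = f u" using f unfolding bij_betw_def by auto
    have "(\<Sum>v\<in>W. M' y v * z (g v)) = (\<Sum>v\<in>V. M u v * z v)"
      unfolding re using u M g by (intro sum.cong) auto
    then show "(\<Sum>v\<in>W. M' y v * z (g v)) = r * z (g y)" using z(3) u g unfolding eigen_on_def by simp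
  qed
  moreover have "f w \<in> W" "z (g (f w)) \<noteq> 0" using z f g unfolding bij_betw_def by auto
  ultimately show ?thesis unfolding top_eigenvalue_def
    by (intro conjI allI exI[of _ "\<lambda>y. z (g y)"] bexI[of _ "f w"])
qed

text \<open>Supplies the converse half of both equality clauses. The graphs live on different vertex
  types, so the top eigenvalue is carried over along the vertex bijection and identified by
  uniqueness.\<close>

lemma distance_spectral_radius_iso:
  assumes G: "pair_graph G" "pverts G \<noteq> {}" and H: "pair_graph H"
    and iso: "digraph_iso (with_proj G) (with_proj H)"
  shows "distance_spectral_radius G = distance_spectral_radius H"
proof -
  interpret G: pair_graph G by fact
  interpret H: pair_graph H by fact
  obtain f where f: "pre_digraph.digraph_isomorphism (with_proj G) f"
    "with_proj H = app_iso f (with_proj G)"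
    using iso unfolding digraph_iso_def by blast
  have "verts (with_proj H) = iso_verts f ` verts (with_proj G)" unfolding f(2) by simp
  then have VH: "pverts H = iso_verts f ` pverts G" by simp
  then have bij: "bij_betw (iso_verts f) (pverts G) (pverts H)"
    using G.digraph_isomorphism_inj_on_verts[OF f(1)] unfolding bij_betw_def by simp
  have "top_eigenvalue (pverts H) (\<lambda>u v. real (graph_dist H u v)) (distance_spectral_radius G)"
    using graph_dist_iso[OF G(1) f]
    by (intro top_eigenvalue_reindex[OF bij _ distance_spectral_radius_top])
       (auto simp: G.pair_finite_verts G graph_dist_sym)
  moreover have "top_eigenvalue (pverts H) (\<lambda>u v. real (graph_dist H u v)) (distance_spectral_radius H)"
    using G(2) VH by (intro distance_spectral_radius_top) (auto simp: H.pair_finite_verts H graph_dist_sym)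
  ultimately show ?thesis using top_eigenvalue_unique H.pair_finite_verts by blast
qed

section \<open>Graphs determined by a cut configuration\<close>

lemma bij_betw_labelled:
  assumes fin: "finite V" "finite W"
    and cards: "\<And>l. card {x \<in> V. c x = l} = card {y \<in> W. d y = l}"
  obtains f where "bij_betw f V W" "\<And>x. x \<in> V \<Longrightarrow> d (f x) = c x"
proof -
  have "\<forall>l. \<exists>f. bij_betw f {x \<in> V. c x = l} {y \<in> W. d y = l}"
    using cards fin by (intro allI finite_same_card_bij) auto
  then obtain F where F: "\<And>l. bij_betw (F l) {x \<in> V. c x = l} {y \<in> W. d y = l}" by metis
  define f where "f = (\<lambda>x. F (c x) x)"
  have fW: "f x \<in> W" "d (f x) = c x" if "x \<in> V" for x
    using F[of "c x"] that unfolding f_def bij_betw_def by blast+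
  have "inj_on f V"
  proof (rule inj_onI)
    fix x y assume xy: "x \<in> V" "y \<in> V" "f x = f y"
    then have "c x = c y" using fW by metis
    then show "x = y" using F[of "c x"] xy unfolding f_def bij_betw_def inj_on_def by auto
  qed
  moreover have "f ` V = W"
  proof
    show "f ` V \<subseteq> W" using fW by auto
    show "W \<subseteq> f ` V"
    proof
      fix y assume "y \<in> W"
      then have "y \<in> F (d y) ` {x \<in> V. c x = d y}" using F[of "d y"] unfolding bij_betw_def by auto
      then obtain x where "x \<in> V" "c x = d y" "y = F (d y) x" by auto
      then show "y \<in> f ` V" unfolding f_def by (intro image_eqI[of _ _ x]) auto
    qed
  qed
  ultimately show ?thesis using fW(2) by (intro that) (auto simp: bij_betw_def)
qed

text \<open>The graphs that can attain equality. The clause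
  \<open>I \<subseteq> A \<union> B\<close> makes every vertex outside the sides adjacent to all
  others.\<close>

definition cut_graph :: "'a pair_pre_digraph \<Rightarrow> 'a set \<Rightarrow> 'a set \<Rightarrow> 'a set \<Rightarrow> bool" where
  "cut_graph G A B I \<longleftrightarrow> finite (pverts G) \<and> A \<subseteq> pverts G \<and> B \<subseteq> pverts G \<and> A \<inter> B = {} \<and> I \<subseteq> A \<union> B \<and>
     parcs G = {(u, v). u \<in> pverts G \<and> v \<in> pverts G \<and> u \<noteq> v \<and> \<not> cut_nonadj A B I u v}"

lemma cut_nonadj_swap: "cut_nonadj B A I u v = cut_nonadj A B I u v"
  unfolding cut_nonadj_def by auto

lemma cut_graph_swap: "cut_graph G A B I \<Longrightarrow> cut_graph G B A I"
  unfolding cut_graph_def cut_nonadj_swap[of B A] by (auto simp: Un_commute Int_commute)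

lemma cut_graph_pair_graph:
  assumes "cut_graph G A B I"
  shows "pair_graph G"
proof
  have "parcs G \<subseteq> pverts G \<times> pverts G" "finite (pverts G \<times> pverts G)"
    using assms unfolding cut_graph_def by auto
  then show "finite (parcs G)" by (rule finite_subset)
qed (use assms in \<open>auto simp: cut_graph_def cut_nonadj_def Digraph.symmetric_def sym_def\<close>)

text \<open>The vertex \<open>c\<close> is a common neighbour of any two vertices of the sides, so
  no distance exceeds 2.\<close>

lemma cut_graph_dist:
  assumes G: "cut_graph G A B I" and c: "c \<in> pverts G" "c \<notin> A \<union> B"
    and uv: "u \<in> pverts G" "v \<in> pverts G"
  shows "real (graph_dist G u v) = cut_matrix A B I u v"
proof -
  note P = cut_graph_pair_graph[OF G]
  have arc: "(x, y) \<in> parcs G \<longleftrightarrow> x \<in> pverts G \<and> y \<in> pverts G \<and> x \<noteq> y \<and> \<not> cut_nonadj A B I x y" for x y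
    using G unfolding cut_graph_def by auto
  have IAB: "I \<subseteq> A \<union> B" using G unfolding cut_graph_def by auto
  consider "u = v" | "(u, v) \<in> parcs G" | "u \<noteq> v" "cut_nonadj A B I u v" using arc uv by auto
  then show ?thesis
  proof cases
    case 1
    then show ?thesis using graph_dist_self[OF uv(1)] by (simp add: cut_matrix_def)
  next
    case 2
    then show ?thesis using graph_dist_adjacent[OF P] arc by (auto simp: cut_matrix_def)
  next
    case 3
    have "u \<in> A \<union> B" "v \<in> A \<union> B" using 3 IAB unfolding cut_nonadj_def by auto
    then have "(u, c) \<in> parcs G" "(c, v) \<in> parcs G"
      using c uv IAB unfolding arc cut_nonadj_def by auto
    moreover have "(u, v) \<notin> parcs G" using 3 arc by auto
    ultimately show ?thesis using graph_dist_common_neighbour[OF P] 3 by (simp add: cut_matrix_def)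
  qed
qed

lemma cut_graph_config:
  assumes G: "cut_graph G A B I" and c: "c \<in> pverts G" "c \<notin> A \<union> B"
  shows "cut_config (pverts G) A B I (cut_matrix A B I) (distance_spectral_radius G)"
proof -
  have "top_eigenvalue (pverts G) (\<lambda>u v. real (graph_dist G u v)) (distance_spectral_radius G)"
    using G c cut_graph_pair_graph[OF G] graph_dist_sym
    by (intro distance_spectral_radius_top) (auto simp: cut_graph_def)
  then have "top_eigenvalue (pverts G) (cut_matrix A B I) (distance_spectral_radius G)"
    by (rule top_eigenvalue_reindex[OF bij_betw_id, rotated]) (simp add: cut_graph_dist[OF G c])
  then show ?thesis using G c unfolding cut_graph_def
    by (intro cut_config.intro) (auto intro: cut_matrix_sym)
qed

lemma card_outside:
  assumes "finite V" "A \<subseteq> V" "B \<subseteq> V" "A \<inter> B = {}"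
  shows "card (V - (A \<union> B)) = card V - (card (A \<inter> I) + card (A - I) + (card (B \<inter> I) + card (B - I)))"
proof -
  have f: "finite A" "finite B" using assms by (auto intro: finite_subset)
  have "card (V - (A \<union> B)) = card V - card (A \<union> B)" using assms f by (simp add: card_Diff_subset)
  moreover have "card (A \<union> B) = card A + card B" using assms f by (simp add: card_Un_disjoint)
  moreover have "card A = card (A \<inter> I) + card (A - I)" by (rule card_split) (use f in auto)
  moreover have "card B = card (B \<inter> I) + card (B - I)" by (rule card_split) (use f in auto)
  ultimately show ?thesis by simp
qed

lemma cut_class_cases:
  assumes "A \<subseteq> V" "B \<subseteq> V" "A \<inter> B = {}" "I \<subseteq> A \<union> B"
  shows "{x \<in> V. (x \<in> A, x \<in> B, x \<in> I) = (a, b, i)} =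
     (if a then (if b then {} else if i then A \<inter> I else A - I)
      else if b then (if i then B \<inter> I else B - I) else if i then {} else V - (A \<union> B))"
  using assms by (cases a; cases b; cases i) auto

lemma digraph_iso_bijI:
  assumes "pair_graph G" "pair_graph H" and f: "bij_betw f (pverts G) (pverts H)"
    and arcs: "\<And>u v. u \<in> pverts G \<Longrightarrow> v \<in> pverts G \<Longrightarrow> (u, v) \<in> parcs G \<longleftrightarrow> (f u, f v) \<in> parcs H"
  shows "digraph_iso (with_proj G) (with_proj H)"
proof -
  interpret G: pair_graph G by fact
  interpret H: pair_graph H by fact
  have inj: "inj_on f (pverts G)" and im: "f ` pverts G = pverts H" using f unfolding bij_betw_def by auto
  define hom where "hom = \<lparr>iso_verts = f, iso_arcs = map_prod f f, iso_head = snd, iso_tail = fst\<rparr>"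
  have "inj_on (map_prod f f) (parcs G)"
  proof (rule inj_onI)
    fix x y assume x: "x \<in> parcs G" and y: "y \<in> parcs G" and e: "map_prod f f x = map_prod f f y"
    have "fst x \<in> pverts G" "snd x \<in> pverts G" "fst y \<in> pverts G" "snd y \<in> pverts G"
      using x y G.arc_fst_in_verts G.arc_snd_in_verts by auto
    moreover have "f (fst x) = f (fst y)" "f (snd x) = f (snd y)"
      using arg_cong[OF e, of fst] arg_cong[OF e, of snd] by auto
    ultimately show "x = y" using inj by (simp add: inj_on_eq_iff prod_eq_iff)
  qed
  then have "pre_digraph.digraph_isomorphism (with_proj G) hom"
    using inj G.wf_digraph_axioms unfolding pre_digraph.digraph_isomorphism_def hom_def by auto
  moreover have "map_prod f f ` parcs G = parcs H"
  proof
    show "map_prod f f ` parcs G \<subseteq> parcs H"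
    proof
      fix e assume "e \<in> map_prod f f ` parcs G"
      then obtain u v where uv: "(u, v) \<in> parcs G" "e = (f u, f v)" by auto
      then show "e \<in> parcs H" using arcs[OF G.in_arcsD1[OF uv(1)] G.in_arcsD2[OF uv(1)]] by simp
    qed
    show "parcs H \<subseteq> map_prod f f ` parcs G"
    proof
      fix e assume e: "e \<in> parcs H"
      then have "fst e \<in> f ` pverts G" "snd e \<in> f ` pverts G"
        unfolding im using H.arc_fst_in_verts H.arc_snd_in_verts by auto
      then obtain u v where uv: "u \<in> pverts G" "v \<in> pverts G" "e = (f u, f v)"
        by (metis imageE prod.collapse)
      then have "(u, v) \<in> parcs G" using arcs e by blast
      then show "e \<in> map_prod f f ` parcs G" using uv(3) by (intro image_eqI[of _ _ "(u, v)"]) auto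
    qed
  qed
  then have "with_proj H = app_iso hom (with_proj G)"
    using im unfolding app_iso_def hom_def by (intro pre_digraph.equality) auto
  ultimately show ?thesis unfolding digraph_iso_def by blast
qed

text \<open>Adjacency of distinct vertices depends only on their memberships in the three sets, so
  any bijection respecting memberships is an isomorphism. Only five membership patterns can occur,
  and their sizes agree.\<close>

lemma cut_graph_iso:
  assumes G: "cut_graph G A B I" and H: "cut_graph H A' B' I'"
    and cards: "card (A \<inter> I) = card (A' \<inter> I')" "card (A - I) = card (A' - I')"
      "card (B \<inter> I) = card (B' \<inter> I')" "card (B - I) = card (B' - I')" "card (pverts G) = card (pverts H)"
  shows "digraph_iso (with_proj G) (with_proj H)"
proof -
  have g: "finite (pverts G)" "A \<subseteq> pverts G" "B \<subseteq> pverts G" "A \<inter> B = {}" "I \<subseteq> A \<union> B"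
    and h: "finite (pverts H)" "A' \<subseteq> pverts H" "B' \<subseteq> pverts H" "A' \<inter> B' = {}" "I' \<subseteq> A' \<union> B'"
    using G H unfolding cut_graph_def by auto
  have "card {x \<in> pverts G. (x \<in> A, x \<in> B, x \<in> I) = l} =
      card {y \<in> pverts H. (y \<in> A', y \<in> B', y \<in> I') = l}" for l
  proof -
    obtain a b i where l: "l = (a, b, i)" by (cases l) auto
    show ?thesis unfolding l cut_class_cases[OF g(2-5)] cut_class_cases[OF h(2-5)]
      using cards card_outside[OF g(1-4), of I] card_outside[OF h(1-4), of I'] by simp
  qed
  then obtain f where f: "bij_betw f (pverts G) (pverts H)"
    "\<And>x. x \<in> pverts G \<Longrightarrow> (f x \<in> A', f x \<in> B', f x \<in> I') = (x \<in> A, x \<in> B, x \<in> I)"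
    using bij_betw_labelled[OF g(1) h(1), of "\<lambda>x. (x \<in> A, x \<in> B, x \<in> I)"
      "\<lambda>y. (y \<in> A', y \<in> B', y \<in> I')"] by blast
  show ?thesis
  proof (rule digraph_iso_bijI[OF cut_graph_pair_graph[OF G] cut_graph_pair_graph[OF H] f(1)])
    fix u v assume uv: "u \<in> pverts G" "v \<in> pverts G"
    have "f u \<in> pverts H" "f v \<in> pverts H" "f u = f v \<longleftrightarrow> u = v"
      using f(1) uv unfolding bij_betw_def by (auto simp: inj_on_eq_iff)
    moreover have "cut_nonadj A' B' I' (f u) (f v) = cut_nonadj A B I u v"
      using f(2)[OF uv(1)] f(2)[OF uv(2)] unfolding cut_nonadj_def by simp
    ultimately show "(u, v) \<in> parcs G \<longleftrightarrow> (f u, f v) \<in> parcs H"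
      using G H uv unfolding cut_graph_def by simp
  qed
qed

section \<open>Extremal graphs and essential cuts\<close>

lemma graph_union_verts_iff:
  "Inl x \<in> pverts (G \<union>\<^sub>G H) \<longleftrightarrow> x \<in> pverts G" "Inr y \<in> pverts (G \<union>\<^sub>G H) \<longleftrightarrow> y \<in> pverts H"
  unfolding graph_union_def by auto

lemma graph_union_arcs_iff:
  "(Inl x, Inl x') \<in> parcs (G \<union>\<^sub>G H) \<longleftrightarrow> (x, x') \<in> parcs G"
  "(Inr y, Inr y') \<in> parcs (G \<union>\<^sub>G H) \<longleftrightarrow> (y, y') \<in> parcs H"
  "(Inl x, Inr y) \<notin> parcs (G \<union>\<^sub>G H)" "(Inr y, Inl x) \<notin> parcs (G \<union>\<^sub>G H)"
  unfolding graph_union_def by (auto simp: map_prod_def image_iff split: prod.splits)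

lemma graph_join_verts_iff:
  "Inl x \<in> pverts (G \<or>\<^sub>G H) \<longleftrightarrow> x \<in> pverts G" "Inr y \<in> pverts (G \<or>\<^sub>G H) \<longleftrightarrow> y \<in> pverts H"
  unfolding graph_join_def by (simp_all add: graph_union_verts_iff)

lemma graph_join_arcs_iff:
  "(Inl x, Inl x') \<in> parcs (G \<or>\<^sub>G H) \<longleftrightarrow> (x, x') \<in> parcs G"
  "(Inr y, Inr y') \<in> parcs (G \<or>\<^sub>G H) \<longleftrightarrow> (y, y') \<in> parcs H"
  "(Inl x, Inr y) \<in> parcs (G \<or>\<^sub>G H) \<longleftrightarrow> x \<in> pverts G \<and> y \<in> pverts H"
  "(Inr y, Inl x) \<in> parcs (G \<or>\<^sub>G H) \<longleftrightarrow> x \<in> pverts G \<and> y \<in> pverts H"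
  unfolding graph_join_def by (auto simp: graph_union_arcs_iff)

lemma basic_graph_iff:
  "x \<in> pverts (complete_graph m) \<longleftrightarrow> x < m" "x \<in> pverts (edgeless_graph m) \<longleftrightarrow> x < m"
  "(x, y) \<in> parcs (complete_graph m) \<longleftrightarrow> x < m \<and> y < m \<and> x \<noteq> y" "(x, y) \<notin> parcs (edgeless_graph m)"
  unfolding complete_graph_def edgeless_graph_def by auto

lemmas graph_iff = graph_union_verts_iff graph_union_arcs_iff graph_join_verts_iff graph_join_arcs_iff
  basic_graph_iff

lemma finite_card_graphs:
  "finite (pverts (complete_graph m))" "card (pverts (complete_graph m)) = m"
  "finite (pverts (edgeless_graph m))" "card (pverts (edgeless_graph m)) = m"
  unfolding complete_graph_def edgeless_graph_def by auto

lemma finite_card_union_join: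
  assumes "finite (pverts G)" "finite (pverts H)"
  shows "finite (pverts (G \<union>\<^sub>G H))" "card (pverts (G \<union>\<^sub>G H)) = card (pverts G) + card (pverts H)"
    "finite (pverts (G \<or>\<^sub>G H))" "card (pverts (G \<or>\<^sub>G H)) = card (pverts G) + card (pverts H)"
  using assms unfolding graph_join_def graph_union_def by (simp_all add: card_Plus)

lemma cut_graphI:
  assumes "finite (pverts G)" "A \<subseteq> pverts G" "B \<subseteq> pverts G" "A \<inter> B = {}" "I \<subseteq> A \<union> B"
    and "\<And>u v. (u, v) \<in> parcs G \<longleftrightarrow> u \<in> pverts G \<and> v \<in> pverts G \<and> u \<noteq> v \<and> \<not> cut_nonadj A B I u v"
  shows "cut_graph G A B I"
  unfolding cut_graph_def using assms by auto

lemma extremal_graph_cut_graph: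
  fixes n k \<alpha> :: nat
  assumes "\<alpha> \<ge> 1" "k \<ge> 1" "n \<ge> k + \<alpha> + 2"
  obtains A B I a w where "cut_graph (extremal_graph n k \<alpha>) A B I" "card (pverts (extremal_graph n k \<alpha>)) = n"
    "Inl 0 \<in> pverts (extremal_graph n k \<alpha>)" "Inl 0 \<notin> A \<union> B"
    "A = {a, w}" "a \<notin> I" "w \<in> I" "a \<noteq> w" "card (B \<inter> I) = \<alpha> - 1" "card (B - I) = n - k - \<alpha> - 1"
proof -
  let ?G = "extremal_graph n k \<alpha>"
  \<comment> \<open>The \<open>\<alpha> - 1\<close> edgeless vertices are completed to
    \<open>I\<close> by one vertex of \<open>K_2\<close>, which makes the non-edges exactly those of
    a cut configuration. \<open>Inl 0\<close> lies in \<open>K_k\<close> and is the universal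
    vertex.\<close>
  define A B I :: "(nat + (nat + nat) + nat) set" where "A = {Inr (Inr 0), Inr (Inr 1)}"
    and "B = (\<lambda>i. Inr (Inl (Inl i))) ` {..<n - k - \<alpha> - 1} \<union> (\<lambda>i. Inr (Inl (Inr i))) ` {..<\<alpha> - 1}"
    and "I = insert (Inr (Inr 1)) ((\<lambda>i. Inr (Inl (Inr i))) ` {..<\<alpha> - 1})"
  have A: "Inl i \<notin> A" "Inr (Inl y) \<notin> A" "Inr (Inr i) \<in> A \<longleftrightarrow> i < 2" for i y
    unfolding A_def by auto
  have B: "Inl i \<notin> B" "Inr (Inl (Inl i)) \<in> B \<longleftrightarrow> i < n - k - \<alpha> - 1" "Inr (Inl (Inr i)) \<in> B \<longleftrightarrow> i < \<alpha> - 1"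
    "Inr (Inr i) \<notin> B" for i
    unfolding B_def by auto
  have I: "Inl i \<notin> I" "Inr (Inl (Inl i)) \<notin> I" "Inr (Inl (Inr i)) \<in> I \<longleftrightarrow> i < \<alpha> - 1"
    "Inr (Inr i) \<in> I \<longleftrightarrow> i = 1" for i
    unfolding I_def by auto
  have V: "Inl i \<in> pverts ?G \<longleftrightarrow> i < k" "Inr (Inl (Inl i)) \<in> pverts ?G \<longleftrightarrow> i < n - k - \<alpha> - 1"
    "Inr (Inl (Inr i)) \<in> pverts ?G \<longleftrightarrow> i < \<alpha> - 1" "Inr (Inr i) \<in> pverts ?G \<longleftrightarrow> i < 2" for i
    unfolding extremal_graph_def by (simp_all add: graph_iff)
  note fc = finite_card_graphs finite_card_union_join
  have arc: "(u, v) \<in> parcs ?G \<longleftrightarrow> u \<in> pverts ?G \<and> v \<in> pverts ?G \<and> u \<noteq> v \<and> \<not> cut_nonadj A B I u v" for u v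
  proof -
    have "\<forall>u v. (u, v) \<in> parcs ?G \<longleftrightarrow> u \<in> pverts ?G \<and> v \<in> pverts ?G \<and> u \<noteq> v \<and> \<not> cut_nonadj A B I u v"
      unfolding split_sum_all cut_nonadj_def
      by (simp add: A B I V) (auto simp: extremal_graph_def graph_iff)
    then show ?thesis by blast
  qed
  have "cut_graph ?G A B I"
  proof (rule cut_graphI[OF _ _ _ _ _ arc])
    show "finite (pverts ?G)" unfolding extremal_graph_def by (simp add: fc)
    show "A \<subseteq> pverts ?G" "B \<subseteq> pverts ?G" unfolding A_def B_def by (auto simp: V)
    show "A \<inter> B = {}" "I \<subseteq> A \<union> B" unfolding A_def B_def I_def by auto
  qed
  moreover have "card (pverts ?G) = n"
    using assms unfolding extremal_graph_def by (simp add: fc)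
  moreover have "card (B \<inter> I) = \<alpha> - 1"
  proof -
    have "B \<inter> I = (\<lambda>i. Inr (Inl (Inr i))) ` {..<\<alpha> - 1}" unfolding B_def I_def by auto
    then show ?thesis by (simp add: card_image inj_on_def)
  qed
  moreover have "card (B - I) = n - k - \<alpha> - 1"
  proof -
    have "B - I = (\<lambda>i. Inr (Inl (Inl i))) ` {..<n - k - \<alpha> - 1}" unfolding B_def I_def by auto
    then show ?thesis by (simp add: card_image inj_on_def)
  qed
  ultimately show ?thesis
    using that[of A B I "Inr (Inr 0)" "Inr (Inr 1)"] assms A B I V A_def by auto
qed

lemma extremal_graph_balanced_cut_graph:
  fixes k \<alpha> :: nat
  assumes "k \<ge> 1"
  obtains A B I a b where "cut_graph (extremal_graph_balanced k \<alpha>) A B I"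
    "card (pverts (extremal_graph_balanced k \<alpha>)) = k + \<alpha> + 2"
    "Inl 0 \<in> pverts (extremal_graph_balanced k \<alpha>)" "Inl 0 \<notin> A \<union> B"
    "A - I = {a}" "B - I = {b}" "card (A \<inter> I) = \<alpha> div 2" "card (B \<inter> I) = \<alpha> - \<alpha> div 2"
proof -
  let ?G = "extremal_graph_balanced k \<alpha>"
  define g h where "g = \<alpha> div 2" and "h = \<alpha> - \<alpha> div 2"
  have g: "nat \<lfloor>real \<alpha> / 2\<rfloor> = g" unfolding g_def
    by (metis floor_divide_of_nat_eq nat_int of_nat_numeral)
  have h: "nat \<lceil>real \<alpha> / 2\<rceil> = h" unfolding h_def
    by linarith
  have G: "?G = complete_graph k \<or>\<^sub>G ((complete_graph 1 \<or>\<^sub>G edgeless_graph g) \<union>\<^sub>G (complete_graph 1 \<or>\<^sub>G edgeless_graph h))"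
    unfolding extremal_graph_balanced_def g h ..
  define A B I :: "(nat + (nat + nat) + nat + nat) set"
    where "A = insert (Inr (Inl (Inl 0))) ((\<lambda>i. Inr (Inl (Inr i))) ` {..<g})"
    and "B = insert (Inr (Inr (Inl 0))) ((\<lambda>i. Inr (Inr (Inr i))) ` {..<h})"
    and "I = (\<lambda>i. Inr (Inl (Inr i))) ` {..<g} \<union> (\<lambda>i. Inr (Inr (Inr i))) ` {..<h}"
  have A: "Inl i \<notin> A" "Inr (Inl (Inl i)) \<in> A \<longleftrightarrow> i = 0" "Inr (Inl (Inr i)) \<in> A \<longleftrightarrow> i < g" "Inr (Inr y) \<notin> A" for i y
    unfolding A_def by auto
  have B: "Inl i \<notin> B" "Inr (Inr (Inl i)) \<in> B \<longleftrightarrow> i = 0" "Inr (Inr (Inr i)) \<in> B \<longleftrightarrow> i < h" "Inr (Inl y) \<notin> B" for i y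
    unfolding B_def by auto
  have I: "Inl i \<notin> I" "Inr (Inl (Inl i)) \<notin> I" "Inr (Inl (Inr i)) \<in> I \<longleftrightarrow> i < g"
    "Inr (Inr (Inl i)) \<notin> I" "Inr (Inr (Inr i)) \<in> I \<longleftrightarrow> i < h" for i
    unfolding I_def by auto
  have V: "Inl i \<in> pverts ?G \<longleftrightarrow> i < k" "Inr (Inl (Inl i)) \<in> pverts ?G \<longleftrightarrow> i = 0"
    "Inr (Inl (Inr i)) \<in> pverts ?G \<longleftrightarrow> i < g" "Inr (Inr (Inl i)) \<in> pverts ?G \<longleftrightarrow> i = 0"
    "Inr (Inr (Inr i)) \<in> pverts ?G \<longleftrightarrow> i < h" for i
    unfolding G by (simp_all add: graph_iff)
  note fc = finite_card_graphs finite_card_union_join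
  have arc: "(u, v) \<in> parcs ?G \<longleftrightarrow> u \<in> pverts ?G \<and> v \<in> pverts ?G \<and> u \<noteq> v \<and> \<not> cut_nonadj A B I u v" for u v
  proof -
    have "\<forall>u v. (u, v) \<in> parcs ?G \<longleftrightarrow> u \<in> pverts ?G \<and> v \<in> pverts ?G \<and> u \<noteq> v \<and> \<not> cut_nonadj A B I u v"
      unfolding split_sum_all cut_nonadj_def
      by (simp add: A B I V) (auto simp: G graph_iff)
    then show ?thesis by blast
  qed
  have "cut_graph ?G A B I"
  proof (rule cut_graphI[OF _ _ _ _ _ arc])
    show "finite (pverts ?G)" unfolding G by (simp add: fc)
    show "A \<subseteq> pverts ?G" "B \<subseteq> pverts ?G" unfolding A_def B_def by (auto simp: V)
    show "A \<inter> B = {}" "I \<subseteq> A \<union> B" unfolding A_def B_def I_def by auto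
  qed
  moreover have "card (pverts ?G) = k + \<alpha> + 2"
    unfolding G by (simp add: fc) (simp add: g_def h_def)
  moreover have "card (A \<inter> I) = g"
  proof -
    have "A \<inter> I = (\<lambda>i. Inr (Inl (Inr i))) ` {..<g}" unfolding A_def I_def by auto
    then show ?thesis by (simp add: card_image inj_on_def)
  qed
  moreover have "card (B \<inter> I) = h"
  proof -
    have "B \<inter> I = (\<lambda>i. Inr (Inr (Inr i))) ` {..<h}" unfolding B_def I_def by auto
    then show ?thesis by (simp add: card_image inj_on_def)
  qed
  moreover have "A - I = {Inr (Inl (Inl 0))}" "B - I = {Inr (Inr (Inl 0))}"
    unfolding A_def B_def I_def by auto
  ultimately show ?thesis
    using that[of A B I "Inr (Inl (Inl 0))" "Inr (Inr (Inl 0))"] assms A B V g_def h_def by auto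
qed

section \<open>From essential connectivity to a cut configuration\<close>

lemma essential_cut_attained:
  assumes "essential_connectivity G = enat k"
  obtains S where "essential_cut G S" "card S = k"
proof -
  let ?X = "(\<lambda>S. enat (card S)) ` {S. essential_cut G S}"
  have e: "Inf ?X = enat k" using assms unfolding essential_connectivity_def .
  \<comment> \<open>The infimum of the empty set is infinity, not \<open>enat k\<close>; a nonempty
    set of \<open>enat\<close> values attains its infimum.\<close>
  have "?X \<noteq> {}"
  proof
    assume "?X = {}"
    then show False using e by (simp only: Inf_enat_def) simp
  qed
  then have "Inf ?X \<in> ?X" unfolding Inf_enat_def by (auto intro: LeastI)
  then show ?thesis using e that by auto
qed

lemma independence_number_attained:
  assumes "finite (pverts G)"
  obtains I where "independent_set G I" "card I = independence_number G"
proof -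
  have "{I. independent_set G I} \<subseteq> Pow (pverts G)" unfolding independent_set_def by auto
  then have "finite {I. independent_set G I}" using assms by (meson finite_Pow_iff finite_subset)
  moreover have "independent_set G {}" unfolding independent_set_def by simp
  ultimately have "independence_number G \<in> card ` {I. independent_set G I}"
    unfolding independence_number_def by (intro Max_in) auto
  then show ?thesis using that by auto
qed

text \<open>An arc from \<open>C\<close> to another vertex of \<open>X\<close> could be reversed,
  making both ends strongly connected. If \<open>C\<close> has two vertices, the first arc of a walk
  between them cannot leave \<open>C\<close>.\<close>

lemma scc_of_induced_subgraph:
  assumes G: "pair_graph G" and X: "X \<subseteq> pverts G"
    and C: "C \<in> pre_digraph.sccs_verts (with_proj G \<restriction> X)"
  shows "C \<subseteq> X"
    and "\<And>u v. u \<in> C \<Longrightarrow> v \<in> X - C \<Longrightarrow> (u, v) \<notin> parcs G"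
    and "card C \<ge> 2 \<Longrightarrow> \<exists>u\<in>C. \<exists>v\<in>C. (u, v) \<in> parcs G"
proof -
  interpret G: pair_graph G by fact
  let ?H = "with_proj G \<restriction> X"
  interpret H: wf_digraph ?H by (rule G.wellformed_induce_subgraph)
  have ends: "(u, v) \<in> arcs_ends ?H \<longleftrightarrow> (u, v) \<in> parcs G \<and> u \<in> X \<and> v \<in> X" for u v
    unfolding arcs_ends_conv by force
  have sym: "(u, v) \<in> parcs G \<Longrightarrow> (v, u) \<in> parcs G" for u v by (rule G.arcs_symmetric)
  have Cprop: "C \<noteq> {}" "\<And>u v. u \<in> C \<Longrightarrow> v \<in> C \<Longrightarrow> u \<rightarrow>\<^sup>*\<^bsub>?H\<^esub> v"
    "\<And>u v. u \<in> C \<Longrightarrow> v \<notin> C \<Longrightarrow> \<not> u \<rightarrow>\<^sup>*\<^bsub>?H\<^esub> v \<or> \<not> v \<rightarrow>\<^sup>*\<^bsub>?H\<^esub> u"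
    using C unfolding pre_digraph.sccs_verts_def by blast+
  show CX: "C \<subseteq> X"
  proof
    fix u assume "u \<in> C"
    from Cprop(2)[OF this this] show "u \<in> X" by (auto elim: reachable_in_vertsE)
  qed
  show noarc: "(u, v) \<notin> parcs G" if "u \<in> C" "v \<in> X - C" for u v
  proof
    assume a: "(u, v) \<in> parcs G"
    have e: "(u, v) \<in> arcs_ends ?H" "(v, u) \<in> arcs_ends ?H" using ends a sym[OF a] that CX by auto
    have "u \<rightarrow>\<^sup>*\<^bsub>?H\<^esub> u" "v \<rightarrow>\<^sup>*\<^bsub>?H\<^esub> v" using that CX by (auto intro!: H.reachable_refl)
    then have "u \<rightarrow>\<^sup>*\<^bsub>?H\<^esub> v" "v \<rightarrow>\<^sup>*\<^bsub>?H\<^esub> u"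
      using H.adj_reachable_trans[OF e(1)] H.adj_reachable_trans[OF e(2)] by auto
    then show False using Cprop(3)[of u v] that by auto
  qed
  assume "card C \<ge> 2"
  then obtain u v where uv: "u \<in> C" "v \<in> C" "u \<noteq> v" by (rule obtain_two)
  then obtain p where p: "H.awalk u p v" using Cprop(2)[OF uv(1,2)] H.reachable_awalk by blast
  then obtain e p' where "p = e # p'" using uv(3) by (cases p) (auto simp: H.awalk_Nil_iff)
  then have e: "e \<in> parcs G" "fst e = u" "snd e \<in> X"
    using p by (auto simp: H.awalk_Cons_iff)
  have "snd e \<in> C" using noarc[OF uv(1), of "snd e"] e by (metis DiffI prod.collapse)
  then show "\<exists>u\<in>C. \<exists>v\<in>C. (u, v) \<in> parcs G" using e uv(1) by (metis prod.collapse)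
qed

text \<open>\<open>A\<close> is one nontrivial component and \<open>B\<close> the union of all the
  others, so that the sides exhaust the complement of the cut. A nontrivial component contains an
  edge and hence a vertex outside the independent set.\<close>

lemma essential_cut_config:
  assumes G: "pair_graph G" and conn: "Digraph_Component.connected (with_proj G)"
    and kappa: "essential_connectivity G = enat k"
  obtains A B I where
    "cut_config (pverts G) A B I (\<lambda>u v. real (graph_dist G u v)) (distance_spectral_radius G)"
    "card I = independence_number G" "card (pverts G) = k + card (A \<union> B)" "k \<ge> 1"
    "A - I \<noteq> {}" "B - I \<noteq> {}" "card A \<ge> 2" "card B \<ge> 2"
proof -
  interpret G: pair_graph G by fact
  let ?V = "pverts G"
  obtain S where S: "essential_cut G S" "card S = k" using kappa by (rule essential_cut_attained)
  obtain I where I: "independent_set G I" "card I = independence_number G"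
    using G.pair_finite_verts by (rule independence_number_attained)
  define X where "X = ?V - S"
  obtain C D where CD: "C \<in> pre_digraph.sccs_verts (with_proj G \<restriction> X)"
    "D \<in> pre_digraph.sccs_verts (with_proj G \<restriction> X)" "C \<noteq> D" "card C \<ge> 2" "card D \<ge> 2"
    using S(1) unfolding essential_cut_def X_def by blast
  have SV: "S \<subseteq> ?V" using S(1) unfolding essential_cut_def by blast
  have XV: "X \<subseteq> ?V" unfolding X_def by auto
  note sC = scc_of_induced_subgraph[OF G XV CD(1)] and sD = scc_of_induced_subgraph[OF G XV CD(2)]
  interpret H: wf_digraph "with_proj G \<restriction> X" by (rule G.wellformed_induce_subgraph)
  have "C \<inter> D = {}" using H.sccs_verts_disjoint[OF CD(1-3)] .
  define B where "B = X - C"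
  have DB: "D \<subseteq> B" using sD(1) \<open>C \<inter> D = {}\<close> unfolding B_def by auto
  have indep: "(u, v) \<notin> parcs G" if "u \<in> I" "v \<in> I" for u v
    using I(1) that G.pair_no_loops[of "(u, v)"] unfolding independent_set_def by (cases "u = v") auto
  have IV: "I \<subseteq> ?V" using I(1) unfolding independent_set_def by auto
  have finB: "finite B" unfolding B_def X_def using G.pair_finite_verts by auto
  have nonadj: "(u, v) \<notin> parcs G" if "cut_nonadj C B I u v" for u v
    using that indep sC(2)[of u v] sC(2)[of v u] G.arcs_symmetric[of u v]
    unfolding cut_nonadj_def B_def by blast
  have top: "top_eigenvalue ?V (\<lambda>u v. real (graph_dist G u v)) (distance_spectral_radius G)"
    using CD sC(1) XV G.pair_finite_verts graph_dist_sym[OF G]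
    by (intro distance_spectral_radius_top) auto
  have "cut_config ?V C B I (\<lambda>u v. real (graph_dist G u v)) (distance_spectral_radius G)"
  proof
    show "finite ?V" by (rule G.pair_finite_verts)
    show "?V \<noteq> {}" using conn unfolding connected_conv by simp
    show "C \<subseteq> ?V" "B \<subseteq> ?V" "I \<subseteq> ?V" "C \<inter> B = {}" using sC(1) XV IV unfolding B_def by auto
    show "real (graph_dist G u v) = real (graph_dist G v u)" for u v using graph_dist_sym[OF G] by simp
    fix u v assume uv: "u \<in> ?V" "v \<in> ?V"
    show "cut_matrix C B I u v \<le> real (graph_dist G u v)"
      using graph_dist_pos[OF G conn uv] graph_dist_nonadjacent[OF G conn uv] nonadj[of u v]
      unfolding cut_matrix_def by (cases "u = v"; cases "cut_nonadj C B I u v") auto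
  qed (rule top)
  moreover have "card ?V = k + card (C \<union> B)"
  proof -
    have "C \<union> B = X" using sC(1) unfolding B_def by auto
    moreover have "card ?V = card S + card X"
      using SV G.pair_finite_verts unfolding X_def by (intro card_split) auto
    ultimately show ?thesis using S(2) by simp
  qed
  moreover have "k \<ge> 1"
  proof (rule ccontr)
    assume "\<not> ?thesis"
    moreover have "finite S" using SV G.pair_finite_verts by (rule finite_subset)
    ultimately have "S = {}" using S(2) by (metis card_eq_0_iff less_one not_le)
    \<comment> \<open>Removing nothing leaves \<open>G\<close>, which is connected and so admits no
      empty cut.\<close>
    then have "with_proj G \<restriction> (?V - S) = with_proj G"
      unfolding induce_subgraph_def
      by (intro pre_digraph.equality) (auto dest: G.in_arcsD1 G.in_arcsD2)
    then show False using S(1) conn unfolding essential_cut_def by simp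
  qed
  moreover have "C - I \<noteq> {}" using sC(3)[OF CD(4)] indep by blast
  moreover have "B - I \<noteq> {}" using sD(3)[OF CD(5)] indep DB by blast
  moreover have "card B \<ge> 2" using CD(5) card_mono[OF finB DB] by simp
  ultimately show ?thesis using that I(2) CD(4) by blast
qed

text \<open>Distance 1 characterises adjacency, so the entrywise equality obtained in the equality
  case recovers the graph.\<close>

lemma cut_graph_of_dist:
  assumes G: "pair_graph G" and conn: "Digraph_Component.connected (with_proj G)"
    and sub: "A \<subseteq> pverts G" "B \<subseteq> pverts G" "A \<inter> B = {}" "I \<subseteq> A \<union> B"
    and D: "\<forall>u\<in>pverts G. \<forall>v\<in>pverts G. real (graph_dist G u v) = cut_matrix A B I u v"
  shows "cut_graph G A B I"
proof (rule cut_graphI)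
  interpret G: pair_graph G by fact
  show "finite (pverts G)" by (rule G.pair_finite_verts)
  fix u v
  show "(u, v) \<in> parcs G \<longleftrightarrow> u \<in> pverts G \<and> v \<in> pverts G \<and> u \<noteq> v \<and> \<not> cut_nonadj A B I u v"
  proof
    assume a: "(u, v) \<in> parcs G"
    then have uv: "u \<in> pverts G" "v \<in> pverts G" "u \<noteq> v"
      using G.in_arcsD1[OF a] G.in_arcsD2[OF a] G.pair_no_loops[OF a] by auto
    have "cut_matrix A B I u v = 1" using D uv graph_dist_adjacent[OF G a] by force
    then show "u \<in> pverts G \<and> v \<in> pverts G \<and> u \<noteq> v \<and> \<not> cut_nonadj A B I u v"
      using uv unfolding cut_matrix_def by (auto split: if_splits)
  next
    assume a: "u \<in> pverts G \<and> v \<in> pverts G \<and> u \<noteq> v \<and> \<not> cut_nonadj A B I u v"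
    then have "real (graph_dist G u v) = 1" using D unfolding cut_matrix_def by auto
    then show "(u, v) \<in> parcs G" using graph_dist_nonadjacent[OF G conn, of u v] a by force
  qed
qed (use sub in auto)

theorem theorem1p1:
  fixes G :: "'a pair_pre_digraph" and n k' \<alpha> :: nat
  assumes "\<alpha> \<ge> 2"
    and "pair_graph G"
    and "Digraph_Component.connected (with_proj G)"
    and "card (pverts G) = n"
    and "essential_connectivity G = enat k'"
    and "independence_number G = \<alpha>"
  shows "(n \<ge> k' + \<alpha> + 3 \<longrightarrow>
            distance_spectral_radius G \<ge> distance_spectral_radius (extremal_graph n k' \<alpha>) \<and>
            (distance_spectral_radius G = distance_spectral_radius (extremal_graph n k' \<alpha>) \<longleftrightarrow>
             digraph_iso (with_proj G) (with_proj (extremal_graph n k' \<alpha>)))) \<and>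
         (n = k' + \<alpha> + 2 \<longrightarrow>
            distance_spectral_radius G \<ge> distance_spectral_radius (extremal_graph_balanced k' \<alpha>) \<and>
            (distance_spectral_radius G = distance_spectral_radius (extremal_graph_balanced k' \<alpha>) \<longleftrightarrow>
             digraph_iso (with_proj G) (with_proj (extremal_graph_balanced k' \<alpha>))))"
proof -
  obtain A B I where conf: "cut_config (pverts G) A B I (\<lambda>u v. real (graph_dist G u v)) (distance_spectral_radius G)"
    and cI: "card I = \<alpha>" and cV: "card (pverts G) = k' + card (A \<union> B)" and k1: "k' \<ge> 1"
    and out: "A - I \<noteq> {}" "B - I \<noteq> {}" and AB2: "card A \<ge> 2" "card B \<ge> 2"
    using essential_cut_config[OF assms(2,3,5)] assms(6) by metis
  interpret cut_config "pverts G" A B I "\<lambda>u v. real (graph_dist G u v)" "distance_spectral_radius G" by (rule conf)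
  have cB: "card B = card (B \<inter> I) + card (B - I)" and cA: "card A = card (A \<inter> I) + card (A - I)"
    by (auto intro!: card_split finite_sub)
  have cAB: "card (A \<union> B) = card A + card B" using finite_sub disj by (simp add: card_Un_disjoint)
  have cIAB: "card I = card (A \<inter> I) + card (B \<inter> I)" if "I \<subseteq> A \<union> B"
    using that disj finite_sub by (intro card_split) auto
  have cg: "cut_graph G A B I" "cut_graph G B A I"
    if "I \<subseteq> A \<union> B" "\<forall>u\<in>pverts G. \<forall>v\<in>pverts G. real (graph_dist G u v) = cut_matrix A B I u v"
    using cut_graph_of_dist[OF assms(2,3) sub(1,2) disj that] cut_graph_swap by blast+
  have part1: "distance_spectral_radius G \<ge> distance_spectral_radius (extremal_graph n k' \<alpha>) \<and>
            (distance_spectral_radius G = distance_spectral_radius (extremal_graph n k' \<alpha>) \<longleftrightarrow>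
             digraph_iso (with_proj G) (with_proj (extremal_graph n k' \<alpha>)))"
    if n: "n \<ge> k' + \<alpha> + 3"
  proof -
    let ?H = "extremal_graph n k' \<alpha>"
    \<comment> \<open>\<open>n >= k' + \<alpha> + 3\<close> says exactly \<open>b0 >= 2\<close>;
      \<open>be\<close> leaves out the member of the independent set that lies in
      \<open>K_2\<close>.\<close>
    define b0 be where "b0 = n - k' - \<alpha> - 1" and "be = \<alpha> - 1"
    have b: "b0 \<ge> 2" "be \<ge> 1" "\<alpha> = be + 1" "n = k' + 2 + b0 + be"
      using n assms(1) unfolding b0_def be_def by auto
    obtain A' B' I' a w where H: "cut_graph ?H A' B' I'" "card (pverts ?H) = n"
      "Inl 0 \<in> pverts ?H" "Inl 0 \<notin> A' \<union> B'" "A' = {a, w}" "a \<notin> I'" "w \<in> I'" "a \<noteq> w"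
      "card (B' \<inter> I') = be" "card (B' - I') = b0"
    proof -
      have "\<alpha> \<ge> 1" "n \<ge> k' + \<alpha> + 2" using n assms(1) by auto
      then show ?thesis using extremal_graph_cut_graph[OF _ k1] that unfolding b0_def be_def by metis
    qed
    have I'AB: "I' \<subseteq> A' \<union> B'" using H(1) unfolding cut_graph_def by blast
    obtain t p q where N: "pendant_pair_numbers (real k') (real b0) (real be) (distance_spectral_radius ?H + 1) t p q"
      using pendant_pair_numbers_exist[OF cut_graph_config[OF H(1,3,4)] I'AB H(5-7) H(10,9), of k'] H(2) b k1 by auto
    have c: "card I = be + 1" "card (A \<union> B) = b0 + be + 2" using cI b cV assms(4) by auto
    note bound = pendant_pair_bound[OF N c cV b(1) out AB2]
    have "digraph_iso (with_proj G) (with_proj ?H)"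
      if eq: "distance_spectral_radius G = distance_spectral_radius ?H"
    proof -
      have s: "I \<subseteq> A \<union> B" "\<forall>u\<in>pverts G. \<forall>v\<in>pverts G. real (graph_dist G u v) = cut_matrix A B I u v"
        "card A = 2 \<and> card (A \<inter> I) = 1 \<or> card B = 2 \<and> card (B \<inter> I) = 1"
        using bound(2) eq by auto
      have A'I: "A' \<inter> I' = {w}" "A' - I' = {a}" using H(5-8) by auto
      have cVH: "card (pverts G) = card (pverts ?H)" using H(2) assms(4) by simp
      from s(3) show ?thesis
      proof
        assume "card A = 2 \<and> card (A \<inter> I) = 1"
        then show ?thesis
          using cIAB[OF s(1)] cA cB cAB c H(9,10) A'I cVH
          by (intro cut_graph_iso[OF cg(1)[OF s(1,2)] H(1)]) auto
      next
        \<comment> \<open>The pendant \<open>K_2\<close> sits on side \<open>B\<close>, so the sides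
          are matched in exchanged order.\<close>
        assume "card B = 2 \<and> card (B \<inter> I) = 1"
        then show ?thesis
          using cIAB[OF s(1)] cA cB cAB c H(9,10) A'I cVH
          by (intro cut_graph_iso[OF cg(2)[OF s(1,2)] H(1)]) auto
      qed
    qed
    then show ?thesis
      using bound(1) distance_spectral_radius_iso[OF assms(2) ne cut_graph_pair_graph[OF H(1)]] by auto
  qed
  have part2: "distance_spectral_radius G \<ge> distance_spectral_radius (extremal_graph_balanced k' \<alpha>) \<and>
            (distance_spectral_radius G = distance_spectral_radius (extremal_graph_balanced k' \<alpha>) \<longleftrightarrow>
             digraph_iso (with_proj G) (with_proj (extremal_graph_balanced k' \<alpha>)))"
    if n: "n = k' + \<alpha> + 2"
  proof -
    let ?H = "extremal_graph_balanced k' \<alpha>"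
    define g h where "g = \<alpha> div 2" and "h = \<alpha> - \<alpha> div 2"
    have gh: "g \<le> h" "h \<le> Suc g" "g \<ge> 1" "h \<ge> 1" "\<alpha> = g + h"
      using assms(1) unfolding g_def h_def by auto
    obtain A' B' I' a b where H: "cut_graph ?H A' B' I'" "card (pverts ?H) = k' + \<alpha> + 2"
      "Inl 0 \<in> pverts ?H" "Inl 0 \<notin> A' \<union> B'" "A' - I' = {a}" "B' - I' = {b}"
      "card (A' \<inter> I') = g" "card (B' \<inter> I') = h"
      using extremal_graph_balanced_cut_graph[OF k1, of \<alpha>] unfolding g_def h_def by metis
    have I'AB: "I' \<subseteq> A' \<union> B'" using H(1) unfolding cut_graph_def by blast
    obtain xi eta u v where N: "two_pendant_numbers (real k') (real g) (real h) (distance_spectral_radius ?H + 1) xi eta u v"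
      using two_pendant_numbers_exist[OF cut_graph_config[OF H(1,3,4)] I'AB H(5-8), of k'] H(2) gh k1 by auto
    have c: "card I = g + h" "card (A \<union> B) = g + h + 2" "card (pverts G) = k' + 2 + g + h"
      using cI gh cV assms(4) n by auto
    \<comment> \<open>Here \<open>n = k' + \<alpha> + 2\<close> leaves \<open>\<alpha> + 2\<close>
      vertices on the two sides: one centre for each side besides the \<open>g + h\<close>
      leaves.\<close>
    note bound = two_pendant_bound[OF N gh(1,2) c gh(3) k1 out AB2]
    have "digraph_iso (with_proj G) (with_proj ?H)"
      if eq: "distance_spectral_radius G = distance_spectral_radius ?H"
    proof -
      have s: "I \<subseteq> A \<union> B" "\<forall>u\<in>pverts G. \<forall>v\<in>pverts G. real (graph_dist G u v) = cut_matrix A B I u v"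
        "card (A - I) = 1" "card (B - I) = 1" "card (A \<inter> I) = g \<or> card (B \<inter> I) = g"
        using bound(2) eq by auto
      have cVH: "card (pverts G) = card (pverts ?H)" using H(2) assms(4) n by simp
      from s(5) show ?thesis
      proof
        assume "card (A \<inter> I) = g"
        then show ?thesis
          using cIAB[OF s(1)] s(3,4) c H(5-8) cVH
          by (intro cut_graph_iso[OF cg(1)[OF s(1,2)] H(1)]) auto
      next
        assume "card (B \<inter> I) = g"
        then show ?thesis
          using cIAB[OF s(1)] s(3,4) c H(5-8) cVH
          by (intro cut_graph_iso[OF cg(2)[OF s(1,2)] H(1)]) auto
      qed
    qed
    then show ?thesis
      using bound(1) distance_spectral_radius_iso[OF assms(2) ne cut_graph_pair_graph[OF H(1)]] by auto
  qed
  show ?thesis using part1 part2 by blast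
qed

end
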